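(* Let $d\in\mathbb{N}$, $m\in\mathbb{N}$, $\mathbf a\in\mathbb{Z}^d$, and suppose that the Korobov cubature formula $P_m(\cdot,\mathbf a)$ is exact on $\mathcal T(L,d)$ for some $L\in\mathbb{N}$, $L\ge 2$. Let $r\in\mathbb{N}$ and $1\le p<\infty$. There exist constants $c(d)>0$ (depending only on $d$) and $C(d,p)>0$ (depending only on $d$ and $p$) such that for any $v\in(0,1]$ with $v\ge c(d)/L$ we have $$\tilde D^{r}_p(\mathcal K_m(\mathbf a),v)\le C(d,p)\,L^{-r}\,(\log (Lv))^{(d-1)/2}.$$
   Context: Let $\Omega_d=[0,1)^d$. Hat functions: for $u>0$ let $h^1_u$ be the characteristic function on $\mathbb{R}$ of the interval $[-u/2,u/2)$, and for $r\ge 2$ let $h^r_u:=h^{r-1}_u * h^1_u$ (convolution on $\mathbb{R}$). For a box $B=\prod_{j=1}^d[z_j-ru_j/2,\,z_j+ru_j/2)$ with $u_j>0$ (every axis-parallel half-open box is of this form) define $h^r_B(\mathbf x):=\prod_{j=1}^d h^r_{u_j}(x_j-z_j)$. Its periodization is $\tilde h^r_B(\mathbf x):=\sum_{\mathbf n\in\mathbb{Z}^d}h^r_B(\mathbf n+\mathbf x)$. Periodic $r$-smooth fixed volume $L_p$-discrepancy: for $r\in\mathbb{N}$, $1\le p\le\infty$, $v\in(0,1]$ and a point set $\xi=\{\xi^\mu\}_{\mu=1}^m\subset[0,1)^d$ (points indexed by $\mu$, counted with multiplicity), $$\tilde D^r_p(\xi,v):=\sup_{B\subset\Omega_d:\ \mathrm{vol}(B)=v}\left\|\int_{\Omega_d}\tilde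 h^r_B(\mathbf x-\mathbf z)\,d\mathbf x-\frac1m\sum_{\mu=1}^m\tilde h^r_B(\xi^\mu-\mathbf z)\right\|_p,$$ where the supremum is over boxes $B=\prod_{j=1}^d[w_j-ru_j/2,\,w_j+ru_j/2)$ with $w_j\in\mathbb{R}$ and $u_j>0$, and the $L_p$-norm is taken with respect to $\mathbf z\in\Omega_d$. Korobov point sets and cubature formulas: for $m\in\mathbb{N}$ and $\mathbf a=(a_1,\dots,a_d)\in\mathbb{Z}^d$ put $\mathbf y^\mu:=(\{\mu a_1/m\},\dots,\{\mu a_d/m\})$, $\mu=1,\dots,m$, where $\{\cdot\}$ is the fractional part; $\mathcal K_m(\mathbf a):=\{\mathbf y^\mu\}_{\mu=1}^m$ and $P_m(f,\mathbf a):=\frac1m\sum_{\mu=1}^m f(\mathbf y^\mu)$. Hyperbolic cross: $\Gamma(N,d):=\{\mathbf k\in\mathbb{Z}^d:\prod_{j=1}^d\max(|k_j|,1)\le N\}$, and $\mathcal T(N,d)$ is the space of trigonometric polynomials $f(\mathbf x)=\sum_{\mathbf k\in\Gamma(N,d)}c_{\mathbf k}e^{i2\pi(\mathbf k,\mathbf x)}$. Exactness: $P_m(\cdot,\mathbf a)$ is exact on $\mathcal T(N,d)$ if $P_m(f,\mathbf a)=\int_{[0,1)^d}f(\mathbf x)\,d\mathbf x$ for all $f\in\mathcal T(N,d)$; equivalently, no $\mathbf k\in\Gamma(N,d)\setminus\{\mathbf 0\}$ satisfies $a_1k_1+\dots+a_dk_d\equiv 0\pmod m$. The constants do not depend on $m$,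 $\mathbf a$, $L$ or $v$. *)

theory Defs
  imports "HOL-Analysis.Analysis"
begin

text \<open>The dimension \<open>d\<close> is \<open>CARD('n)\<close>: points live in \<open>real ^ 'n\<close>,
  frequencies and periods in \<open>int ^ 'n\<close>.\<close>

definition unit_cube :: "(real ^ 'n) set" where
  "unit_cube = {x. \<forall>j. 0 \<le> x $ j \<and> x $ j < 1}"

definition int_vec :: "int ^ 'n \<Rightarrow> real ^ 'n" where
  "int_vec k = (\<chi> j. real_of_int (k $ j))"

definition convol :: "(real \<Rightarrow> real) \<Rightarrow> (real \<Rightarrow> real) \<Rightarrow> real \<Rightarrow> real" where
  "convol f g x = (LINT y|lborel. f y * g (x - y))"

text \<open>Only orders \<open>r \<ge> 1\<close> are specified; nothing is said about \<open>hat 0\<close>.\<close>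

fun hat :: "nat \<Rightarrow> real \<Rightarrow> real \<Rightarrow> real" where
  "hat (Suc 0) u = indicator {- u / 2 ..< u / 2}"
| "hat (Suc (Suc r)) u = convol (hat (Suc r) u) (hat (Suc 0) u)"

text \<open>A box is represented by its centre \<open>w\<close> and the vector \<open>u\<close>, where
  \<open>r * u $ j\<close> is the length of the \<open>j\<close>-th side.\<close>

definition box_of :: "nat \<Rightarrow> real ^ 'n \<Rightarrow> real ^ 'n \<Rightarrow> (real ^ 'n) set" where
  "box_of r w u =
     {x. \<forall>j. w $ j - real r * u $ j / 2 \<le> x $ j \<and> x $ j < w $ j + real r * u $ j / 2}"

definition box_hat :: "nat \<Rightarrow> real ^ 'n \<Rightarrow> real ^ 'n \<Rightarrow> real ^ 'n \<Rightarrow> real" where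
  "box_hat r w u x = (\<Prod>j\<in>UNIV. hat r (u $ j) (x $ j - w $ j))"

text \<open>For \<open>r \<ge> 1\<close> the function \<open>box_hat r w u\<close> vanishes outside the bounded set
  \<open>box_of r w u\<close>, so the sum over all integer vectors has finitely many nonzero terms.\<close>

definition periodic_box_hat :: "nat \<Rightarrow> real ^ 'n \<Rightarrow> real ^ 'n \<Rightarrow> real ^ 'n \<Rightarrow> real" where
  "periodic_box_hat r w u x = (\<Sum>\<^sub>\<infinity>n\<in>UNIV. box_hat r w u (int_vec n + x))"

definition Lp_norm_cube :: "real \<Rightarrow> (real ^ 'n \<Rightarrow> real) \<Rightarrow> real" where
  "Lp_norm_cube p f = (LINT z:unit_cube|lborel. \<bar>f z\<bar> powr p) powr (1 / p)"

definition box_error ::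
    "nat \<Rightarrow> (nat \<Rightarrow> real ^ 'n) \<Rightarrow> nat \<Rightarrow> real ^ 'n \<Rightarrow> real ^ 'n \<Rightarrow> real ^ 'n \<Rightarrow> real" where
  "box_error m \<xi> r w u z =
     (LINT x:unit_cube|lborel. periodic_box_hat r w u (x - z))
     - (1 / real m) * (\<Sum>\<mu>=1..m. periodic_box_hat r w u (\<xi> \<mu> - z))"

text \<open>The periodic \<open>r\<close>-smooth fixed volume discrepancy of the points \<open>\<xi> 1, \<dots>, \<xi> m\<close>,
  for finite exponents \<open>p\<close>. The supremum is taken in \<open>ereal\<close>, so that it needs no
  boundedness side condition.\<close>

definition periodic_discrepancy ::
    "nat \<Rightarrow> real \<Rightarrow> nat \<Rightarrow> (nat \<Rightarrow> real ^ 'n) \<Rightarrow> real \<Rightarrow> ereal" where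
  "periodic_discrepancy r p m \<xi> v =
     (SUP (w, u) \<in> {(w, u). (\<forall>j. u $ j > 0) \<and> box_of r w u \<subseteq> unit_cube
                            \<and> measure lborel (box_of r w u) = v}.
        ereal (Lp_norm_cube p (box_error m \<xi> r w u)))"

definition korobov_point :: "nat \<Rightarrow> int ^ 'n \<Rightarrow> nat \<Rightarrow> real ^ 'n" where
  "korobov_point m a \<mu> = (\<chi> j. frac (real \<mu> * real_of_int (a $ j) / real m))"

definition korobov_cubature :: "nat \<Rightarrow> int ^ 'n \<Rightarrow> (real ^ 'n \<Rightarrow> complex) \<Rightarrow> complex" where
  "korobov_cubature m a f = (1 / of_nat m) * (\<Sum>\<mu>=1..m. f (korobov_point m a \<mu>))"

definition hyperbolic_cross :: "nat \<Rightarrow> (int ^ 'n) set" where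
  "hyperbolic_cross N = {k. (\<Prod>j\<in>UNIV. max \<bar>k $ j\<bar> 1) \<le> int N}"

lemma finite_hyperbolic_cross: "finite (hyperbolic_cross N :: (int ^ 'n) set)"
proof -
  have "\<bar>k $ i\<bar> \<le> int N" if "k \<in> hyperbolic_cross N" for k :: "int ^ 'n" and i
  proof -
    have "max \<bar>k $ i\<bar> 1 * 1 \<le> max \<bar>k $ i\<bar> 1 * (\<Prod>j\<in>UNIV - {i}. max \<bar>k $ j\<bar> 1)"
      by (intro mult_left_mono prod_ge_1) auto
    also have "\<dots> = (\<Prod>j\<in>UNIV. max \<bar>k $ j\<bar> 1)"
      by (subst prod.remove[of UNIV i]) auto
    also have "\<dots> \<le> int N"
      using that by (simp add: hyperbolic_cross_def)
    finally show ?thesis by simp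
  qed
  hence "hyperbolic_cross N \<subseteq> vec_lambda ` (UNIV \<rightarrow>\<^sub>E {- int N..int N} :: ('n \<Rightarrow> int) set)"
    by (force simp: image_iff abs_le_iff intro!: bexI[of _ "\<lambda>i. _ $ i"])
  thus ?thesis
    by (rule finite_subset) (intro finite_imageI finite_PiE; simp)
qed

definition trig_polys :: "nat \<Rightarrow> (real ^ 'n \<Rightarrow> complex) set" where
  "trig_polys N =
     {f. \<exists>c :: int ^ 'n \<Rightarrow> complex. f = (\<lambda>x. \<Sum>k\<in>hyperbolic_cross N.
           c k * exp (\<i> * of_real (2 * pi * (int_vec k \<bullet> x))))}"

definition korobov_exact :: "nat \<Rightarrow> int ^ 'n \<Rightarrow> nat \<Rightarrow> bool" where
  "korobov_exact m a N \<longleftrightarrow>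
     (\<forall>f\<in>trig_polys N. korobov_cubature m a f = (LINT x:unit_cube|lborel. f x))"

end

(* On the grid (1/M)Z^d, with M a large multiple of m, the error function is, up to O(1/M), a
   trigonometric polynomial whose frequencies are the nonzero points k of the dual lattice
   { k. a . k = 0 mod m }; exactness on the hyperbolic cross says that these satisfy
   prod max(|k_j|, 1) > L. Its coefficients are products of r-th powers of numbers at most
   b_j = min(2 u_j, 1 / max(|k_j|, 1)). On the dual lattice L prod b_j <= 1, so that
   (L prod b_j)^r <= L prod b_j; this removes r from the problem and makes the constant independent
   of it.

   For an even exponent P the L_P norm is monotone in the absolute values of the coefficients. For
   nonnegative coefficients the P-th moment counts P-tuples of frequencies with vanishing alternating
   sum, and in each coordinate two members of the tuple have comparable size. By Hoelder's
   inequality this gives the Littlewood-Paley type bound |G|^2 <= C sum_s |G_s|^2 over dyadic blocks, one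
   coordinate after the other. A block of volume W contains at most O(W / L) dual lattice points
   and none if W <= L; summing over the blocks yields ln(L v)^(d - 1). *)

theory Submission
  imports Defs
begin

section \<open>Sums over dyadic boxes\<close>

text \<open>Working on a grid keeps every sum finite: the Fourier series of the first hat function
  is in general not absolutely convergent, whereas inversion modulo \<open>M\<close> is exact and
  even moments become finite counts. Passing back loses nothing, because the bounds hold on every
  translate of the grid and the unit cube is a disjoint union of translates of one cell.
  \<open>M\<close> depends on the box, so no constant may depend on \<open>M\<close>; only the zero
  frequency carries a sampling error, and \<open>M\<close> is chosen last to absorb it. The decisive
  saving occurs inside a block: P - 1 members of a vanishing signed sum determine the last one, so n
  dual points with coefficients at most w have P-th moment at most w^P * n^(P - 1). The missing
  factor n makes large blocks of volume W decay like (L / W)^(2 / P); blocks of small frequencies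
  decay because the side lengths cap their coefficients. Two points keep r out of the constant: the
  bound 1 / max(|k_j|, 1) must hold with constant exactly 1, and \<open>u_j\<close> is finally
  enlarged to the side length \<open>r * u_j\<close>, so that the logarithm contains L v.\<close>

lemma two_powr_neg_le:
  fixes e :: real
  assumes "0 \<le> e" "e \<le> 1"
  shows "2 powr (-e) \<le> 1 - e / 2"
proof -
  have "2 powr (-e) = exp ((1 - e) * 0 + e * (- ln 2))"
    by (simp add: powr_def)
  also have "\<dots> \<le> (1 - e) * exp 0 + e * exp (- ln 2)"
    using convex_onD[OF exp_convex, of e 0 "- ln 2"] assms by simp
  also have "\<dots> = 1 - e / 2"
    by (simp add: exp_minus field_simps)
  finally show ?thesis .
qed

text \<open>As long as \<open>y \<le> x\<close>, doubling \<open>x\<close> lowers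
  \<open>min 1 ((y / x) powr e)\<close> by at least \<open>e / 2\<close> of its value, by
  \<open>two_powr_neg_le\<close>. The terms are thus dominated by a telescoping sum, and the first
  index of the geometric series need not be located.\<close>

lemma sum_dyadic_decay:
  fixes U y e :: real
  assumes "U > 0" "y > 0" "0 < e" "e \<le> 1"
  shows "(\<Sum>t\<le>S. if y \<le> 2 ^ t * U then (y / (2 ^ t * U)) powr e else 0) \<le> 2 / e"
proof -
  define \<psi> where "\<psi> x = min 1 ((y / x) powr e)" for x :: real
  have step: "(if y \<le> x then (y / x) powr e else 0) \<le> 2 / e * (\<psi> x - \<psi> (2 * x))" if "x > 0" for x
  proof (cases "y \<le> x")
    case True
    have le1: "(y / x) powr e \<le> 1"
      using True assms that by (intro powr_le1) auto
    have eq: "(y / (2 * x)) powr e = (y / x) powr e * 2 powr (-e)"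
      using assms that by (simp add: powr_divide powr_minus powr_mult field_simps)
    have p: "(y / x) powr e * 2 powr (-e) \<le> (y / x) powr e * (1 - e / 2)"
      using two_powr_neg_le[of e] assms by (intro mult_left_mono) auto
    also have "\<dots> \<le> (y / x) powr e * 1"
      using assms by (intro mult_left_mono) auto
    finally have "\<psi> (2 * x) = (y / x) powr e * 2 powr (-e)"
      unfolding \<psi>_def eq using le1 by auto
    hence "\<psi> x - \<psi> (2 * x) \<ge> (y / x) powr e * (e / 2)"
      using p le1 by (simp add: \<psi>_def algebra_simps min_def)
    hence "2 / e * ((y / x) powr e * (e / 2)) \<le> 2 / e * (\<psi> x - \<psi> (2 * x))"
      using assms by (intro mult_left_mono) auto
    thus ?thesis using True assms by simp
  next
    case False
    have "(y / (2 * x)) powr e \<le> (y / x) powr e"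
      using assms that by (intro powr_mono2) (auto simp: field_simps)
    hence "\<psi> (2 * x) \<le> \<psi> x"
      unfolding \<psi>_def by (auto simp: min_def)
    thus ?thesis using False assms by simp
  qed
  have "(\<Sum>t\<le>S. if y \<le> 2 ^ t * U then (y / (2 ^ t * U)) powr e else 0)
        \<le> (\<Sum>t\<le>S. 2 / e * (\<psi> (2 ^ t * U) - \<psi> (2 ^ Suc t * U)))"
    using step[of "2 ^ _ * U"] assms by (intro sum_mono) (auto simp: mult.assoc)
  also have "\<dots> = 2 / e * (\<psi> U - \<psi> (2 ^ Suc S * U))"
    unfolding sum_distrib_left[symmetric] using sum_telescope[of "\<lambda>t. \<psi> (2 ^ t * U)" S]
    by simp
  also have "\<dots> \<le> 2 / e * 1"
  proof (intro mult_left_mono)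
    show "\<psi> U - \<psi> (2 ^ Suc S * U) \<le> 1"
    proof -
      have "\<psi> U \<le> 1" "0 \<le> \<psi> (2 ^ Suc S * U)" by (simp_all add: \<psi>_def)
      thus ?thesis by simp
    qed
  qed (use assms in auto)
  finally show ?thesis by simp
qed

text \<open>Telescoping again; the cap is 2 rather than 1 because \<open>2 * x < 2\<close> for every
  term \<open>x < 1\<close> that is counted.\<close>

lemma sum_dyadic_below_one:
  fixes U :: real
  assumes "U > 0"
  shows "(\<Sum>t\<le>S. if 2 ^ t * U < 1 then 2 ^ t * U else 0) \<le> 2"
proof -
  define \<psi> where "\<psi> x = min x (2::real)" for x :: real
  have "(\<Sum>t\<le>S. if 2 ^ t * U < 1 then 2 ^ t * U else 0)
        \<le> (\<Sum>t\<le>S. \<psi> (2 ^ Suc t * U) - \<psi> (2 ^ t * U))"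
    using assms by (intro sum_mono) (auto simp: \<psi>_def min_def)
  also have "\<dots> = \<psi> (2 ^ Suc S * U) - \<psi> U"
    using sum_telescope[of "\<lambda>t. - \<psi> (2 ^ t * U)" S] by simp
  also have "\<dots> \<le> 2"
    using assms by (auto simp: \<psi>_def)
  finally show ?thesis .
qed

text \<open>Above 1 the terms decay like \<open>x powr (-e)\<close>; below 1 they are at most
  \<open>x powr (2 - e) \<le> x\<close>. Only the upper half costs \<open>1 / e\<close>.\<close>

lemma sum_dyadic_min:
  fixes U e :: real
  assumes "U > 0" "0 < e" "e \<le> 1"
  shows "(\<Sum>t\<le>S. (2 ^ t * U) powr (-e) * (min (2 ^ t * U) 1)\<^sup>2) \<le> 2 / e + 2"
proof -
  have pt: "x powr (-e) * (min x 1)\<^sup>2 \<le> (if 1 \<le> x then (1 / x) powr e else 0) + (if x < 1 then x else 0)"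
    if "x > 0" for x :: real
  proof (cases "1 \<le> x")
    case True
    thus ?thesis by (simp add: powr_minus powr_divide field_simps)
  next
    case False
    have "x powr (-e) * x\<^sup>2 = x powr (2 - e)"
      using that by (simp flip: powr_add powr_numeral)
    also have "\<dots> \<le> x powr 1"
      using that False assms by (intro powr_mono') auto
    finally show ?thesis using False that by simp
  qed
  have "(\<Sum>t\<le>S. (2 ^ t * U) powr (-e) * (min (2 ^ t * U) 1)\<^sup>2) \<le>
      (\<Sum>t\<le>S. (if 1 \<le> 2 ^ t * U then (1 / (2 ^ t * U)) powr e else 0)
             + (if 2 ^ t * U < 1 then 2 ^ t * U else 0))"
    using assms by (intro sum_mono pt) auto
  also have "\<dots> \<le> 2 / e + 2"
    unfolding sum.distrib using assms by (intro add_mono sum_dyadic_decay sum_dyadic_below_one) auto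
  finally show ?thesis .
qed

text \<open>The result carries the small exponent \<open>e\<close>, but the constant depends on the
  fixed exponent \<open>a\<close> only: the coordinate summed here causes no factor
  \<open>1 / e\<close> and later no logarithm. For \<open>y \<ge> 1\<close> the cap by 1 suffices
  and the decay starts at \<open>y\<close>; for \<open>y < 1\<close> the condition on
  \<open>t\<close> is dropped and \<open>y powr a \<le> y powr e\<close>.\<close>

lemma sum_dyadic_inner:
  fixes U y a e :: real
  assumes "U > 0" "y > 0" "0 < e" "e \<le> a" "a \<le> 1"
  shows "(\<Sum>t\<le>S. if y < 2 ^ t * U then (y / (2 ^ t * U)) powr a * (min (2 ^ t * U) 1)\<^sup>2 else 0)
         \<le> (2 / a + 2) * y powr e"
proof (cases "y \<ge> 1")
  case True
  have "(\<Sum>t\<le>S. if y < 2 ^ t * U then (y / (2 ^ t * U)) powr a * (min (2 ^ t * U) 1)\<^sup>2 else 0)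
     \<le> (\<Sum>t\<le>S. if y \<le> 2 ^ t * U then (y / (2 ^ t * U)) powr a else 0)"
    using assms by (intro sum_mono) (auto intro!: mult_left_le power_le_one simp: min_def)
  also have "\<dots> \<le> 2 / a"
    using assms by (intro sum_dyadic_decay) auto
  also have "\<dots> \<le> (2 / a + 2) * 1"
    by simp
  also have "\<dots> \<le> (2 / a + 2) * y powr e"
    using assms True by (intro mult_left_mono ge_one_powr_ge_zero) auto
  finally show ?thesis .
next
  case False
  have "(\<Sum>t\<le>S. if y < 2 ^ t * U then (y / (2 ^ t * U)) powr a * (min (2 ^ t * U) 1)\<^sup>2 else 0)
     \<le> (\<Sum>t\<le>S. y powr a * ((2 ^ t * U) powr (-a) * (min (2 ^ t * U) 1)\<^sup>2))"
    using assms by (intro sum_mono) (auto simp: powr_divide powr_minus field_simps)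
  also have "\<dots> = y powr a * (\<Sum>t\<le>S. (2 ^ t * U) powr (-a) * (min (2 ^ t * U) 1)\<^sup>2)"
    by (simp add: sum_distrib_left)
  also have "\<dots> \<le> y powr a * (2 / a + 2)"
    using assms by (intro mult_left_mono sum_dyadic_min) auto
  also have "\<dots> \<le> y powr e * (2 / a + 2)"
    using assms False by (intro mult_right_mono powr_mono') auto
  finally show ?thesis by (simp add: mult.commute)
qed

lemma sum_PiE_insert:
  fixes f :: "('a \<Rightarrow> 'b) \<Rightarrow> 'c :: comm_monoid_add"
  assumes "j \<notin> I"
  shows "(\<Sum>s\<in>PiE (insert j I) B. f s) = (\<Sum>s\<in>PiE I B. \<Sum>t\<in>B j. f (s(j := t)))"
proof -
  have "(\<Sum>s\<in>PiE (insert j I) B. f s) = (\<Sum>z\<in>B j \<times> PiE I B. f ((\<lambda>(y, g). g(j := y)) z))"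
    unfolding PiE_insert_eq using inj_combinator[OF assms, of B] by (rule sum.reindex_cong) auto
  also have "\<dots> = (\<Sum>t\<in>B j. \<Sum>s\<in>PiE I B. f (s(j := t)))"
    by (simp add: sum.cartesian_product split_def)
  finally show ?thesis by (subst sum.swap)
qed

text \<open>In the last coordinate the condition \<open>V < \<Prod>x\<close> yields a geometric series; the other
  coordinates are summed by Rankin's trick with exponent \<open>a / ln V\<close>. Hence the power of the
  logarithm is one less than the number of coordinates.\<close>

lemma sum_dyadic_boxes:
  fixes U :: "'a \<Rightarrow> real" and V a :: real
  assumes I: "finite I" "j0 \<notin> I" and U: "\<And>j. U j > 0" and V: "V > 0" "ln V \<ge> 1"
    and a: "0 < a" "a \<le> 1"
  defines "x \<equiv> \<lambda>s j. 2 ^ s j * U j"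
  defines "J \<equiv> insert j0 I"
  shows "(\<Sum>s\<in>PiE J (\<lambda>_. {..S}). if V < (\<Prod>j\<in>J. x s j)
            then (V / (\<Prod>j\<in>J. x s j)) powr a * (\<Prod>j\<in>J. (min (x s j) 1)\<^sup>2) else 0)
         \<le> (2 / a + 2) * exp a * (4 / a) ^ card I * ln V ^ card I"
proof -
  \<comment> \<open>The exponent balances two losses: \<open>V powr e\<close> is the constant
    \<open>exp a\<close>, and each coordinate of \<open>I\<close> costs \<open>4 / e\<close>, a
    single factor \<open>ln V\<close>.\<close>
  define e where "e = a / ln V"
  have e: "0 < e" "e \<le> a" "e \<le> 1"
  proof -
    show "0 < e" unfolding e_def using a(1) V(2) by (rule divide_pos_pos[OF _ less_le_trans[OF zero_less_one]])
    show "e \<le> a" unfolding e_def using a V(2) divide_left_mono[of 1 "ln V" a] by simp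
    thus "e \<le> 1" using a by simp
  qed
  have x0: "x s j > 0" for s :: "'a \<Rightarrow> nat" and j using U by (simp add: x_def)
  have "(\<Sum>s\<in>PiE J (\<lambda>_. {..S}). if V < (\<Prod>j\<in>J. x s j)
            then (V / (\<Prod>j\<in>J. x s j)) powr a * (\<Prod>j\<in>J. (min (x s j) 1)\<^sup>2) else 0)
      = (\<Sum>s\<in>PiE I (\<lambda>_. {..S}). \<Sum>t\<le>S. (\<Prod>j\<in>I. (min (x s j) 1)\<^sup>2) *
           (if V / (\<Prod>j\<in>I. x s j) < 2 ^ t * U j0
            then (V / (\<Prod>j\<in>I. x s j) / (2 ^ t * U j0)) powr a * (min (2 ^ t * U j0) 1)\<^sup>2 else 0))"
    (is "_ = (\<Sum>s\<in>_. \<Sum>t\<le>S. ?m s * ?f s t)")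
  proof -
    have "x (s(j0 := t)) j0 = 2 ^ t * U j0" for s t by (simp add: x_def)
    moreover have "(\<Prod>j\<in>I. (min (x (s(j0 := t)) j) 1)\<^sup>2) = (\<Prod>j\<in>I. (min (x s j) 1)\<^sup>2)" for s t
      using I by (intro prod.cong) (auto simp: x_def)
    moreover have "(\<Prod>j\<in>I. x s j) > 0" for s using x0 by (intro prod_pos) auto
    moreover have "(\<Prod>j\<in>I. x (s(j0 := t)) j) = (\<Prod>j\<in>I. x s j)" for s t
      using I by (intro prod.cong) (auto simp: x_def)
    ultimately show ?thesis
      unfolding J_def sum_PiE_insert[OF I(2)] using I
      by (intro sum.cong refl) (auto simp: field_simps)
  qed
  also have "\<dots> \<le> (\<Sum>s\<in>PiE I (\<lambda>_. {..S}). ?m s * ((2 / a + 2) * (V / (\<Prod>j\<in>I. x s j)) powr e))"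
    unfolding sum_distrib_left[symmetric]
    using e a V(1) U x0 by (intro sum_mono mult_left_mono sum_dyadic_inner prod_nonneg divide_pos_pos prod_pos) auto
  also have "\<dots> = (2 / a + 2) * V powr e * (\<Sum>s\<in>PiE I (\<lambda>_. {..S}). \<Prod>j\<in>I. x s j powr (-e) * (min (x s j) 1)\<^sup>2)"
  proof -
    have "(V / (\<Prod>j\<in>I. x s j)) powr e = V powr e * (\<Prod>j\<in>I. x s j powr (-e))" for s
    proof -
      have "(V / (\<Prod>j\<in>I. x s j)) powr e = V powr e / (\<Prod>j\<in>I. x s j) powr e"
        using V(1) x0 by (simp add: powr_divide prod_nonneg less_imp_le)
      also have "(\<Prod>j\<in>I. x s j) powr e = (\<Prod>j\<in>I. x s j powr e)"
        using x0 by (simp add: prod_powr_distrib less_imp_le)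
      also have "V powr e / \<dots> = V powr e * (\<Prod>j\<in>I. x s j powr (-e))"
        using prod_inversef[of "\<lambda>j. x s j powr e" I] by (simp add: divide_inverse powr_minus o_def)
      finally show ?thesis .
    qed
    thus ?thesis by (simp add: sum_distrib_left prod.distrib mult_ac)
  qed
  also have "\<dots> = (2 / a + 2) * V powr e *
       (\<Prod>j\<in>I. \<Sum>t\<le>S. (2 ^ t * U j) powr (-e) * (min (2 ^ t * U j) 1)\<^sup>2)"
    using I by (subst prod_sum_PiE) (auto simp: x_def)
  also have "\<dots> \<le> (2 / a + 2) * V powr e * (\<Prod>j\<in>I. 4 / e)"
  proof -
    have "(\<Sum>t\<le>S. (2 ^ t * U j) powr (-e) * (min (2 ^ t * U j) 1)\<^sup>2) \<le> 4 / e" for j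
    proof -
      have "(\<Sum>t\<le>S. (2 ^ t * U j) powr (-e) * (min (2 ^ t * U j) 1)\<^sup>2) \<le> 2 / e + 2"
        using e U by (intro sum_dyadic_min) auto
      also have "\<dots> \<le> 4 / e" using e by (simp add: field_simps)
      finally show ?thesis .
    qed
    thus ?thesis using a
      by (intro mult_left_mono prod_mono conjI sum_nonneg) auto
  qed
  also have "\<dots> = (2 / a + 2) * exp a * (4 / a) ^ card I * ln V ^ card I"
  proof -
    have "V powr e = exp a" using V by (auto simp: e_def powr_def)
    moreover have "4 / e = 4 / a * ln V" by (simp add: e_def)
    ultimately show ?thesis by (simp only: prod_constant power_mult_distrib mult.assoc)
  qed
  finally show ?thesis .
qed

section \<open>Moments of trigonometric polynomials on a finite grid\<close>

definition sym_mod :: "nat \<Rightarrow> int \<Rightarrow> int" where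
  "sym_mod M x = (if 2 * (x mod int M) \<le> int M then x mod int M else x mod int M - int M)"

text \<open>The distance from \<open>x\<close> to the nearest multiple of \<open>M\<close>. On the
  grid a frequency has a meaning only modulo \<open>M\<close>, so its size is measured on the
  circle.\<close>

definition circ_abs :: "nat \<Rightarrow> int \<Rightarrow> int" where
  "circ_abs M x = \<bar>sym_mod M x\<bar>"

lemma dvd_sym_mod_diff: "int M dvd sym_mod M x - x"
proof -
  have *: "int M dvd x mod int M - x"
    by (simp flip: mod_eq_dvd_iff)
  have "int M dvd (x mod int M - x) - int M" using * by (rule dvd_diff) simp
  hence "int M dvd x mod int M - int M - x" by (simp only: diff_diff_eq add.commute)
  with * show ?thesis by (cases "2 * (x mod int M) \<le> int M") (simp_all only: sym_mod_def if_True if_False)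
qed

lemma circ_abs_nonneg [simp]: "0 \<le> circ_abs M x"
  by (simp add: circ_abs_def)

lemma circ_abs_le_abs:
  assumes "M > 0" "int M dvd y - x"
  shows "circ_abs M x \<le> \<bar>y\<bar>"
proof -
  have xy: "x mod int M = y mod int M"
    using assms by (metis mod_eq_dvd_iff)
  have r: "0 \<le> y mod int M" "y mod int M < int M" using assms by simp_all
  have y: "y = int M * (y div int M) + y mod int M" by simp
  consider "y div int M = 0" | "y div int M \<ge> 1" | "y div int M \<le> -1" by linarith
  thus ?thesis
  proof cases
    case 1
    hence "y = y mod int M" using y by simp
    thus ?thesis using r by (auto simp: circ_abs_def sym_mod_def xy)
  next
    case 2
    hence "int M * 1 \<le> int M * (y div int M)" using assms by (intro mult_left_mono) auto
    hence "int M + y mod int M \<le> y" using y by linarith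
    thus ?thesis using r by (auto simp: circ_abs_def sym_mod_def xy)
  next
    case 3
    hence "int M * (y div int M) \<le> int M * (-1)" using assms by (intro mult_left_mono) auto
    hence "y \<le> - int M + y mod int M" using y by linarith
    thus ?thesis using r by (auto simp: circ_abs_def sym_mod_def xy)
  qed
qed

lemma circ_abs_eq_0_iff:
  assumes "M > 0"
  shows "circ_abs M x = 0 \<longleftrightarrow> int M dvd x"
proof
  assume "circ_abs M x = 0"
  thus "int M dvd x" using dvd_sym_mod_diff[of M x] by (simp add: circ_abs_def)
next
  assume "int M dvd x"
  hence "circ_abs M x \<le> \<bar>0\<bar>" using assms by (intro circ_abs_le_abs) auto
  thus "circ_abs M x = 0" using circ_abs_nonneg[of M x] by linarith
qed

lemma circ_abs_le:
  assumes "M > 0"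
  shows "2 * circ_abs M x \<le> int M"
proof -
  have "0 \<le> x mod int M" "x mod int M < int M" using assms by simp_all
  thus ?thesis by (simp add: circ_abs_def sym_mod_def abs_if)
qed

text \<open>The bit length: level 0 contains 0 alone, and level \<open>s \<ge> 1\<close> is the
  dyadic block from \<open>2 ^ (s - 1)\<close> to \<open>2 ^ s - 1\<close> in absolute
  value.\<close>

definition level :: "int \<Rightarrow> nat" where
  "level x = (LEAST s. \<bar>x\<bar> < 2 ^ s)"

lemma abs_less_two_power_level: "\<bar>x\<bar> < 2 ^ level x"
proof -
  have "\<bar>x\<bar> < 2 ^ nat \<bar>x\<bar>"
    using of_nat_less_two_power[of "nat \<bar>x\<bar>", where 'a = int] by simp
  thus ?thesis unfolding level_def by (rule LeastI)
qed

lemma level_le: "\<bar>x\<bar> < 2 ^ s \<Longrightarrow> level x \<le> s"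
  unfolding level_def by (rule Least_le)

lemma two_power_level_le: "2 ^ level x \<le> 2 * max \<bar>x\<bar> 1"
proof (cases "level x")
  case (Suc t)
  have "\<not> \<bar>x\<bar> < 2 ^ t" using level_le[of x t] Suc by auto
  thus ?thesis using Suc by (simp add: max_def)
qed auto

lemma level_le_add:
  assumes "\<bar>x\<bar> \<le> 2 ^ B * \<bar>y\<bar>"
  shows "level x \<le> level y + B"
proof (rule level_le)
  have "2 ^ B * \<bar>y\<bar> < 2 ^ B * 2 ^ level y"
    using abs_less_two_power_level[of y] by simp
  with assms have "\<bar>x\<bar> < 2 ^ B * 2 ^ level y" by (rule order.strict_trans1)
  thus "\<bar>x\<bar> < 2 ^ (level y + B)" by (simp add: power_add mult.commute)
qed

definition circ_level :: "nat \<Rightarrow> int \<Rightarrow> nat" where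
  "circ_level M x = level (circ_abs M x)"

text \<open>Deliberately crude: it only makes the range of levels finite, and no constant depends on
  it.\<close>

lemma circ_level_le: "M > 0 \<Longrightarrow> circ_level M x \<le> M"
  unfolding circ_level_def
proof (rule level_le)
  assume "M > 0"
  hence "circ_abs M x \<le> int M" using circ_abs_le[of M x] by simp
  also have "\<dots> < 2 ^ M" using of_nat_less_two_power[of M, where 'a = int] by simp
  finally show "\<bar>circ_abs M x\<bar> < 2 ^ M" by simp
qed

lemma obtain_max:
  fixes f :: "'a \<Rightarrow> 'b::linorder"
  assumes "finite A" "A \<noteq> {}"
  obtains a where "a \<in> A" "\<And>b. b \<in> A \<Longrightarrow> f b \<le> f a"
proof -
  have "Max (f ` A) \<in> f ` A" using assms by (intro Max_in) auto
  then obtain a where "a \<in> A" "Max (f ` A) = f a" by auto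
  thus ?thesis using assms by (intro that[of a]) (auto intro: Max_ge simp flip: \<open>Max (f ` A) = f a\<close>)
qed

text \<open>Take the largest and the second largest term. Modulo \<open>M\<close> the largest is, up
  to signs, the sum of the others, so it exceeds the second largest by a factor of at most
  \<open>P - 1 \<le> 2 ^ P\<close>. Hence the two levels differ by at most \<open>P\<close>.\<close>

lemma vanishing_sum_close_levels:
  assumes M: "M > 0" and P: "P \<ge> 2" and \<sigma>: "\<And>i. \<bar>\<sigma> i\<bar> = (1::int)"
    and sum0: "int M dvd (\<Sum>i<P. \<sigma> i * x i)"
  shows "\<exists>i<P. \<exists>i'<P. i \<noteq> i' \<and> circ_level M (x i) \<le> circ_level M (x i') + P
           \<and> circ_level M (x i') \<le> circ_level M (x i) + P"
proof -
  obtain i where i: "i < P" "\<And>h. h < P \<Longrightarrow> circ_abs M (x h) \<le> circ_abs M (x i)"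
    using obtain_max[of "{..<P}" "\<lambda>h. circ_abs M (x h)"] P
    by (auto simp: lessThan_empty_iff)
  define R where "R = {..<P} - {i}"
  have "card R = P - 1" using i by (simp add: R_def)
  hence "card R \<noteq> 0" using P by simp
  hence "R \<noteq> {}" "finite R" by (auto simp: R_def simp del: Diff_eq_empty_iff)
  then obtain i' where i': "i' \<in> R" "\<And>h. h \<in> R \<Longrightarrow> circ_abs M (x h) \<le> circ_abs M (x i')"
    using obtain_max[of R "\<lambda>h. circ_abs M (x h)"] by auto
  have \<sigma>\<sigma>: "\<sigma> i * \<sigma> i = 1" using \<sigma>[of i] by (metis abs_mult_self_eq mult_1)
  \<comment> \<open>Multiplying the relation by \<open>\<sigma> i\<close> isolates
    \<open>x i\<close>, since \<open>\<sigma> i * \<sigma> i = 1\<close>; the other terms enter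
    through their smallest representatives.\<close>
  define y where "y = - (\<Sum>h\<in>R. \<sigma> i * \<sigma> h * sym_mod M (x h))"
  have "int M dvd (\<Sum>h\<in>R. \<sigma> i * \<sigma> h * (sym_mod M (x h) - x h)) + \<sigma> i * (\<Sum>i<P. \<sigma> i * x i)"
    by (intro dvd_add dvd_sum dvd_mult dvd_sym_mod_diff sum0)
  also have "(\<Sum>i<P. \<sigma> i * x i) = \<sigma> i * x i + (\<Sum>h\<in>R. \<sigma> h * x h)"
    using i by (simp add: R_def sum.remove)
  also have "(\<Sum>h\<in>R. \<sigma> i * \<sigma> h * (sym_mod M (x h) - x h)) + \<sigma> i * (\<sigma> i * x i + (\<Sum>h\<in>R. \<sigma> h * x h))
     = x i - y"
  proof -
    have "(\<Sum>h\<in>R. \<sigma> i * \<sigma> h * (sym_mod M (x h) - x h))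
        = (\<Sum>h\<in>R. \<sigma> i * \<sigma> h * sym_mod M (x h)) - \<sigma> i * (\<Sum>h\<in>R. \<sigma> h * x h)"
      by (simp add: right_diff_distrib sum_subtractf sum_distrib_left mult.assoc)
    moreover have "\<sigma> i * (\<sigma> i * x i) = x i" using \<sigma>\<sigma> by (simp flip: mult.assoc)
    ultimately show ?thesis by (simp add: y_def distrib_left)
  qed
  finally have "int M dvd y - x i" by (metis dvd_minus_iff minus_diff_eq)
  hence "circ_abs M (x i) \<le> \<bar>y\<bar>" by (intro circ_abs_le_abs M)
  also have "\<dots> \<le> (\<Sum>h\<in>R. \<bar>\<sigma> i * \<sigma> h * sym_mod M (x h)\<bar>)"
    unfolding y_def by (metis abs_minus_cancel sum_abs)
  also have "\<dots> = (\<Sum>h\<in>R. circ_abs M (x h))"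
    by (simp add: abs_mult \<sigma> circ_abs_def)
  also have "\<dots> \<le> (\<Sum>h\<in>R. circ_abs M (x i'))" using i' by (intro sum_mono) auto
  also have "\<dots> = int (P - 1) * circ_abs M (x i')" using \<open>card R = _\<close> by simp
  also have "\<dots> \<le> 2 ^ P * circ_abs M (x i')"
  proof (intro mult_right_mono)
    have "int P < 2 ^ P" by (rule of_nat_less_two_power)
    thus "int (P - 1) \<le> 2 ^ P" by linarith
  qed simp
  finally have "circ_level M (x i) \<le> circ_level M (x i') + P"
    unfolding circ_level_def by (intro level_le_add) simp
  moreover have "circ_abs M (x i') \<le> 2 ^ P * circ_abs M (x i)"
  proof -
    have "circ_abs M (x i') \<le> 1 * circ_abs M (x i)" using i i' by (auto simp: R_def)
    also have "\<dots> \<le> 2 ^ P * circ_abs M (x i)" by (intro mult_right_mono) auto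
    finally show ?thesis .
  qed
  hence "circ_level M (x i') \<le> circ_level M (x i) + P"
    unfolding circ_level_def by (intro level_le_add) simp
  ultimately show ?thesis using i i' by (auto simp: R_def)
qed

section \<open>Characters of the grid\<close>

lemma cis_sum: "cis (\<Sum>i\<in>I. f i) = (\<Prod>i\<in>I. cis (f i))"
  by (induction I rule: infinite_finite_induct) (simp_all flip: cis_mult)

lemma cis_int_multiple_eq:
  assumes "M > 0" "int M dvd x - y"
  shows "cis (2 * pi * of_int x / real M) = cis (2 * pi * of_int y / real M)"
proof -
  obtain q where q: "x = y + int M * q" using assms(2) by (metis dvd_def add.commute diff_add_cancel)
  have "2 * pi * of_int x / real M = 2 * pi * of_int y / real M + 2 * pi * of_int q"
    using assms(1) by (simp add: q field_simps)
  thus ?thesis by (simp flip: cis_mult)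
qed

lemma sum_roots_of_unity:
  assumes "M > 0"
  shows "(\<Sum>x\<in>{0..<int M}. cis (2 * pi * of_int (k * x) / real M)) = (if int M dvd k then of_nat M else 0)"
proof (cases "int M dvd k")
  case True
  have "cis (2 * pi * of_int (k * x) / real M) = 1" for x
    using cis_int_multiple_eq[of M "k * x" 0] True assms by simp
  thus ?thesis using True by simp
next
  case False
  define z where "z = cis (2 * pi * of_int k / real M)"
  have "real M * (2 * pi * of_int k / real M) = 2 * pi * of_int k" using assms by simp
  hence "z ^ M = cis (2 * pi * of_int k)" by (simp only: z_def Complex.DeMoivre)
  hence "z ^ M = 1" by simp
  have "z \<noteq> 1"
  proof
    assume "z = 1"
    hence "cos (2 * pi * of_int k / real M) = 1" by (auto simp: z_def complex_eq_iff)
    then obtain q :: int where "2 * pi * of_int k / real M = of_int q * 2 * pi"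
      by (auto simp: cos_one_2pi_int)
    hence "of_int k = (of_int (q * int M) :: real)" using assms by (simp add: field_simps)
    hence "k = q * int M" by (simp only: of_int_eq_iff)
    thus False using False by simp
  qed
  have "(\<Sum>x\<in>{0..<int M}. cis (2 * pi * of_int (k * x) / real M)) = (\<Sum>n<M. z ^ n)"
    by (rule sum.reindex_bij_witness[of _ int nat])
       (auto simp: z_def Complex.DeMoivre mult_ac)
  also have "\<dots> = 0" using \<open>z \<noteq> 1\<close> \<open>z ^ M = 1\<close> by (simp add: geometric_sum)
  finally show ?thesis using False by simp
qed

text \<open>The same residues serve as frequencies modulo \<open>M\<close> and, divided by
  \<open>M\<close>, as points of the torus.\<close>

definition grid :: "nat \<Rightarrow> ('n::finite \<Rightarrow> int) set" where
  "grid M = PiE UNIV (\<lambda>_. {0..<int M})"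

lemma finite_grid [simp]: "finite (grid M)"
  unfolding grid_def by (intro finite_PiE) auto

lemma card_grid: "card (grid M :: ('n::finite \<Rightarrow> int) set) = M ^ CARD('n)"
  by (simp add: grid_def card_PiE)

lemma grid_eqI:
  assumes "k \<in> grid M" "k' \<in> grid M" "\<And>j. int M dvd k j - k' j"
  shows "k = k'"
proof
  fix j
  have "k j mod int M = k' j mod int M" using assms(3)[of j] by (metis mod_eq_dvd_iff)
  moreover have "k j \<in> {0..<int M}" "k' j \<in> {0..<int M}" using assms by (auto simp: grid_def)
  ultimately show "k j = k' j" by simp
qed

lemma sum_grid_prod:
  fixes f :: "'n::finite \<Rightarrow> int \<Rightarrow> 'b::comm_semiring_1"
  shows "(\<Sum>k\<in>grid M. \<Prod>j\<in>UNIV. f j (k j)) = (\<Prod>j\<in>UNIV. \<Sum>x\<in>{0..<int M}. f j x)"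
  unfolding grid_def by (subst prod_sum_PiE) auto

definition chi :: "nat \<Rightarrow> ('n::finite \<Rightarrow> int) \<Rightarrow> ('n \<Rightarrow> int) \<Rightarrow> complex" where
  "chi M k n = cis (2 * pi * of_int (\<Sum>j\<in>UNIV. k j * n j) / real M)"

lemma chi_prod: "chi M k n = (\<Prod>j\<in>UNIV. cis (2 * pi * of_int (k j * n j) / real M))"
  unfolding chi_def by (simp add: sum_distrib_left sum_divide_distrib flip: cis_sum)

lemma cnj_chi: "cnj (chi M k n) = chi M (\<lambda>j. - k j) n"
  by (simp add: chi_def cis_cnj sum_negf)

lemma prod_chi: "(\<Prod>i\<in>I. chi M (k i) n) = chi M (\<lambda>j. \<Sum>i\<in>I. k i j) n"
proof -
  have eq: "(\<Sum>j\<in>UNIV. (\<Sum>i\<in>I. k i j) * n j) = (\<Sum>i\<in>I. \<Sum>j\<in>UNIV. k i j * n j)"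
    by (subst sum.swap) (simp add: sum_distrib_right)
  have "2 * pi * of_int (\<Sum>j\<in>UNIV. (\<Sum>i\<in>I. k i j) * n j) / real M
     = (\<Sum>i\<in>I. 2 * pi * of_int (\<Sum>j\<in>UNIV. k i j * n j) / real M)"
    unfolding eq by (simp only: of_int_sum sum_distrib_left sum_divide_distrib)
  thus ?thesis unfolding chi_def by (simp only: cis_sum)
qed

lemma sum_chi:
  fixes k :: "'n::finite \<Rightarrow> int"
  assumes "M > 0"
  shows "(\<Sum>n\<in>grid M. chi M k n) = (if \<forall>j. int M dvd k j then of_nat M ^ CARD('n) else 0)"
proof -
  have "(\<Sum>n\<in>grid M. chi M k n) = (\<Prod>j\<in>UNIV. if int M dvd k j then of_nat M else 0)"
    unfolding chi_prod sum_grid_prod[of "\<lambda>j x. cis (2 * pi * of_int (k j * x) / real M)"]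
      sum_roots_of_unity[OF assms] ..
  also have "\<dots> = (if \<forall>j. int M dvd k j then of_nat M ^ CARD('n) else 0)"
    by (auto intro!: prod_zero)
  finally show ?thesis .
qed

text \<open>\<open>trig_sum M \<sigma> f n\<close> is the value at the grid point \<open>n / M\<close> of the trigonometric polynomial with
  coefficients \<open>f\<close>; a sign \<open>\<sigma> = -1\<close> reflects the frequencies.\<close>

definition trig_sum :: "nat \<Rightarrow> int \<Rightarrow> (('n::finite \<Rightarrow> int) \<Rightarrow> complex) \<Rightarrow> ('n \<Rightarrow> int) \<Rightarrow> complex" where
  "trig_sum M \<sigma> f n = (\<Sum>k\<in>grid M. f k * chi M (\<lambda>j. \<sigma> * k j) n)"

lemma cnj_trig_sum: "cnj (trig_sum M \<sigma> f n) = trig_sum M (- \<sigma>) (\<lambda>k. cnj (f k)) n"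
  by (simp add: trig_sum_def cnj_chi)

lemma norm_trig_sum_real:
  assumes "\<bar>\<sigma>\<bar> = 1"
  shows "norm (trig_sum M \<sigma> (\<lambda>k. of_real (f k)) n) = norm (trig_sum M 1 (\<lambda>k. of_real (f k)) n)"
proof -
  have "\<sigma> = 1 \<or> \<sigma> = - 1" using assms by linarith
  moreover have "norm (trig_sum M (-1) (\<lambda>k. of_real (f k)) n) = norm (trig_sum M 1 (\<lambda>k. of_real (f k)) n)"
    using arg_cong[OF cnj_trig_sum[of M 1 "\<lambda>k. of_real (f k)" n], of norm] by simp
  ultimately show ?thesis by auto
qed

section \<open>Even moments as sums over vanishing signed sums\<close>

definition zero_sums :: "nat \<Rightarrow> ('i \<Rightarrow> int) \<Rightarrow> 'i set \<Rightarrow> ('i \<Rightarrow> 'n::finite \<Rightarrow> int) set" where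
  "zero_sums M \<sigma> I = {\<kappa>\<in>PiE I (\<lambda>_. grid M). \<forall>j. int M dvd (\<Sum>i\<in>I. \<sigma> i * \<kappa> i j)}"

lemma finite_zero_sums [simp]: "finite I \<Longrightarrow> finite (zero_sums M \<sigma> I)"
  unfolding zero_sums_def by (simp add: finite_PiE)

text \<open>Expanding the product gives for each tuple \<open>\<kappa>\<close> a single character,
  of frequency \<open>\<Sum>i\<in>I. \<sigma> i * \<kappa> i\<close>; orthogonality keeps exactly
  the tuples for which it is trivial.\<close>

lemma sum_prod_trig_sum:
  fixes f :: "'i \<Rightarrow> ('n::finite \<Rightarrow> int) \<Rightarrow> complex"
  assumes "M > 0" "finite I"
  shows "(\<Sum>n\<in>grid M. \<Prod>i\<in>I. trig_sum M (\<sigma> i) (f i) n)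
         = of_nat M ^ CARD('n) * (\<Sum>\<kappa>\<in>zero_sums M \<sigma> I. \<Prod>i\<in>I. f i (\<kappa> i))"
proof -
  have "(\<Sum>n\<in>grid M. \<Prod>i\<in>I. trig_sum M (\<sigma> i) (f i) n)
     = (\<Sum>n\<in>grid M. \<Sum>\<kappa>\<in>PiE I (\<lambda>_. grid M). (\<Prod>i\<in>I. f i (\<kappa> i)) * chi M (\<lambda>j. \<Sum>i\<in>I. \<sigma> i * \<kappa> i j) n)"
    unfolding trig_sum_def using assms by (simp add: prod_sum_PiE prod.distrib prod_chi)
  also have "\<dots> = (\<Sum>\<kappa>\<in>PiE I (\<lambda>_. grid M). (\<Prod>i\<in>I. f i (\<kappa> i)) *
       (\<Sum>n\<in>grid M. chi M (\<lambda>j. \<Sum>i\<in>I. \<sigma> i * \<kappa> i j) n))"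
    by (subst sum.swap) (simp add: sum_distrib_left)
  also have "\<dots> = (\<Sum>\<kappa>\<in>PiE I (\<lambda>_. grid M). if \<forall>j. int M dvd (\<Sum>i\<in>I. \<sigma> i * \<kappa> i j)
      then of_nat M ^ CARD('n) * (\<Prod>i\<in>I. f i (\<kappa> i)) else 0)"
    unfolding sum_chi[OF assms(1)] by (intro sum.cong) auto
  also have "\<dots> = (\<Sum>\<kappa>\<in>zero_sums M \<sigma> I. of_nat M ^ CARD('n) * (\<Prod>i\<in>I. f i (\<kappa> i)))"
    unfolding zero_sums_def using assms by (subst sum.inter_filter) (auto simp: finite_PiE)
  finally show ?thesis by (simp add: sum_distrib_left)
qed

text \<open>In |T|^P = T * cnj T * T * cnj T * ... the factors at odd places are conjugated, which
  reflects their frequencies.\<close>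

definition alt_sign :: "nat \<Rightarrow> int" where "alt_sign i = (-1) ^ i"

lemma abs_alt_sign [simp]: "\<bar>alt_sign i\<bar> = 1"
  by (simp add: alt_sign_def power_abs)

definition moment :: "nat \<Rightarrow> nat \<Rightarrow> (('n::finite \<Rightarrow> int) \<Rightarrow> complex) \<Rightarrow> real" where
  "moment M P f = (\<Sum>n\<in>grid M. norm (trig_sum M 1 f n) ^ P) / real M ^ CARD('n)"

lemma moment_nonneg: "0 \<le> moment M P f"
  unfolding moment_def by (intro divide_nonneg_nonneg sum_nonneg) auto

lemma moment_eq_zero_sums:
  fixes f :: "('n::finite \<Rightarrow> int) \<Rightarrow> complex"
  assumes "M > 0" "even P"
  shows "of_real (moment M P f) =
     (\<Sum>\<kappa>\<in>zero_sums M alt_sign {..<P}. \<Prod>i<P. if even i then f (\<kappa> i) else cnj (f (\<kappa> i)))"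
proof -
  obtain q where q: "P = 2 * q" using assms by (elim evenE)
  define F where "F = (\<lambda>i::nat. if even i then f else (\<lambda>k. cnj (f k)))"
  have "(\<Prod>i<2*q. trig_sum M (alt_sign i) (F i) n) = of_real (norm (trig_sum M 1 f n) ^ (2 * q))" for n q
  proof (induction q)
    case (Suc q)
    have "alt_sign (2 * q) = 1" "alt_sign (Suc (2 * q)) = -1" by (simp_all add: alt_sign_def)
    moreover have "F (2 * q) = f" "F (Suc (2 * q)) = (\<lambda>k. cnj (f k))" by (simp_all add: F_def)
    moreover have "trig_sum M (-1) (\<lambda>k. cnj (f k)) n = cnj (trig_sum M 1 f n)"
      by (simp add: cnj_trig_sum)
    moreover have "w * cnj w = of_real (norm w ^ 2)" for w by (rule complex_norm_square[symmetric])
    ultimately show ?case using Suc.IH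
      by (simp add: mult.assoc power2_eq_square)
  qed auto
  hence "(\<Sum>n\<in>grid M. \<Prod>i<P. trig_sum M (alt_sign i) (F i) n) = of_real (\<Sum>n\<in>grid M. norm (trig_sum M 1 f n) ^ P)"
    by (simp add: q)
  hence "of_real (\<Sum>n\<in>grid M. norm (trig_sum M 1 f n) ^ P) =
     of_nat M ^ CARD('n) * (\<Sum>\<kappa>\<in>zero_sums M alt_sign {..<P}. \<Prod>i<P. F i (\<kappa> i))"
    using sum_prod_trig_sum[OF assms(1), of "{..<P}" alt_sign F] by simp
  moreover have "(\<Prod>i<P. F i (\<kappa> i)) = (\<Prod>i<P. if even i then f (\<kappa> i) else cnj (f (\<kappa> i)))" for \<kappa>
    by (intro prod.cong) (auto simp: F_def)
  ultimately show ?thesis using assms(1) by (simp add: moment_def divide_eq_eq mult.commute)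
qed

lemma moment_real_eq:
  fixes g :: "('n::finite \<Rightarrow> int) \<Rightarrow> real"
  assumes "M > 0" "even P"
  shows "moment M P (\<lambda>k. of_real (g k)) = (\<Sum>\<kappa>\<in>zero_sums M alt_sign {..<P}. \<Prod>i<P. g (\<kappa> i))"
proof -
  have "of_real (moment M P (\<lambda>k. of_real (g k))) =
      (of_real (\<Sum>\<kappa>\<in>zero_sums M alt_sign {..<P}. \<Prod>i<P. g (\<kappa> i)) :: complex)"
    unfolding moment_eq_zero_sums[OF assms] by (simp cong: if_cong)
  thus ?thesis by (simp only: of_real_eq_iff)
qed

text \<open>The index set \<open>zero_sums\<close> does not involve the coefficients, so the
  triangle inequality suffices. This discards the phases of the Fourier coefficients, which depend
  on the offset of the grid; from here on only nonnegative coefficients matter.\<close>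

lemma moment_majorant:
  fixes f :: "('n::finite \<Rightarrow> int) \<Rightarrow> complex"
  assumes "M > 0" "even P" "\<And>k. k \<in> grid M \<Longrightarrow> norm (f k) \<le> g k"
  shows "moment M P f \<le> moment M P (\<lambda>k. of_real (g k))"
proof -
  have "moment M P f = norm (of_real (moment M P f) :: complex)"
    using moment_nonneg[of M P f] by simp
  also have "\<dots> \<le> (\<Sum>\<kappa>\<in>zero_sums M alt_sign {..<P}. norm (\<Prod>i<P. if even i then f (\<kappa> i) else cnj (f (\<kappa> i))))"
    unfolding moment_eq_zero_sums[OF assms(1,2)] by (rule norm_sum)
  also have "\<dots> \<le> (\<Sum>\<kappa>\<in>zero_sums M alt_sign {..<P}. \<Prod>i<P. g (\<kappa> i))"
    unfolding prod_norm[symmetric]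
    by (intro sum_mono prod_mono) (auto simp: zero_sums_def intro!: assms(3))
  finally show ?thesis by (simp add: moment_real_eq[OF assms(1,2)])
qed

text \<open>The way back from counting tuples to functions on the grid, with a different function at
  each place, so that Hoelder's inequality becomes available.\<close>

lemma sum_zero_sums_le:
  fixes g :: "nat \<Rightarrow> ('n::finite \<Rightarrow> int) \<Rightarrow> real"
  assumes "M > 0"
  shows "(\<Sum>\<kappa>\<in>zero_sums M alt_sign {..<P}. \<Prod>i<P. g i (\<kappa> i)) \<le>
    (\<Sum>n\<in>grid M. \<Prod>i<P. norm (trig_sum M 1 (\<lambda>k. of_real (g i k)) n)) / real M ^ CARD('n)"
proof -
  define T where "T = (\<Sum>\<kappa>\<in>zero_sums M alt_sign {..<P}. \<Prod>i<P. g i (\<kappa> i))"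
  have "of_nat M ^ CARD('n) * of_real T =
     (\<Sum>n\<in>grid M. \<Prod>i<P. trig_sum M (alt_sign i) (\<lambda>k. of_real (g i k)) n)"
    using sum_prod_trig_sum[OF assms, of "{..<P}" alt_sign "\<lambda>i k. of_real (g i k)"]
    by (simp add: T_def)
  hence "norm (of_nat M ^ CARD('n) * of_real T :: complex) \<le>
     (\<Sum>n\<in>grid M. norm (\<Prod>i<P. trig_sum M (alt_sign i) (\<lambda>k. of_real (g i k)) n))"
    by (simp only: norm_sum)
  also have "norm (of_nat M ^ CARD('n) * of_real T :: complex) = real M ^ CARD('n) * \<bar>T\<bar>"
    by (simp only: norm_mult norm_power norm_of_nat norm_of_real)
  also have "(\<Sum>n\<in>grid M. norm (\<Prod>i<P. trig_sum M (alt_sign i) (\<lambda>k. of_real (g i k)) n))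
      = (\<Sum>n\<in>grid M. \<Prod>i<P. norm (trig_sum M 1 (\<lambda>k. of_real (g i k)) n))"
    unfolding prod_norm[symmetric] by (intro sum.cong prod.cong refl norm_trig_sum_real) simp
  finally have "\<bar>T\<bar> \<le>
      (\<Sum>n\<in>grid M. \<Prod>i<P. norm (trig_sum M 1 (\<lambda>k. of_real (g i k)) n)) / real M ^ CARD('n)"
    using assms by (simp add: field_simps)
  thus ?thesis unfolding T_def by linarith
qed

section \<open>A Littlewood--Paley inequality for nonnegative coefficients\<close>

text \<open>Hoelder's inequality with exponents P/2 and P/(P - 2), obtained by summing the weighted
  Young inequality for the normalised terms. Positivity of the \<open>b\<close>-sum matters at
  \<open>P = 2\<close>: there \<open>0 powr 0 = 0\<close> would make the right side vanish.\<close>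

lemma Holder_sum_square:
  fixes a b :: "'i \<Rightarrow> real"
  assumes P: "P \<ge> 2" and nn: "\<And>n. n \<in> N \<Longrightarrow> 0 \<le> a n" "\<And>n. n \<in> N \<Longrightarrow> 0 \<le> b n"
    and N: "finite N" and B: "(\<Sum>n\<in>N. b n ^ P) > 0"
  shows "(\<Sum>n\<in>N. (a n)\<^sup>2 * b n ^ (P - 2))
         \<le> (\<Sum>n\<in>N. a n ^ P) powr (2 / P) * (\<Sum>n\<in>N. b n ^ P) powr (1 - 2 / P)"
proof (cases "(\<Sum>n\<in>N. a n ^ P) = 0")
  case True
  hence "a n = 0" if "n \<in> N" for n
    using that nn N P by (subst (asm) sum_nonneg_eq_0_iff) auto
  thus ?thesis by simp
next
  case False
  define A where "A = (\<Sum>n\<in>N. a n ^ P)"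
  define B where "B = (\<Sum>n\<in>N. b n ^ P)"
  have "A \<ge> 0" unfolding A_def using nn by (intro sum_nonneg) auto
  hence A: "A > 0" using False by (simp add: A_def)
  have B': "B > 0" using B by (simp add: B_def)
  have pw: "x ^ k = (x ^ P) powr (k / P)" if "x > 0" for x :: real and k :: nat
    using that P by (simp add: powr_powr flip: powr_realpow)
  define D where "D = A powr (2 / P) * B powr (1 - 2 / P)"
  have D: "D > 0" using A B' by (simp add: D_def)
  have "(a n)\<^sup>2 * b n ^ (P - 2) \<le> D * (2 / P * (a n ^ P / A) + (1 - 2 / P) * (b n ^ P / B))"
    if n: "n \<in> N" for n
  \<comment> \<open>At \<open>P = 2\<close> a zero of \<open>b\<close> is harmless since
    \<open>b n ^ 0 = 1\<close>, but the rewriting by \<open>powr\<close> needs positive bases; hence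
    the separate cases.\<close>
  proof (cases "a n = 0 \<or> b n = 0 \<and> P > 2")
    case True
    have "0 \<le> D * (2 / P * (a n ^ P / A) + (1 - 2 / P) * (b n ^ P / B))"
      using D A B' nn[OF n] P by (intro mult_nonneg_nonneg add_nonneg_nonneg divide_nonneg_nonneg) auto
    moreover have "(a n)\<^sup>2 * b n ^ (P - 2) = 0" using True by auto
    ultimately show ?thesis by (rule ord_eq_le_trans[rotated])
  next
    case False
    show ?thesis
    proof (cases "P = 2")
      case True
      thus ?thesis using A B' by (simp add: D_def)
    next
      case F: False
      hence pos: "a n > 0" "b n > 0" using False nn[OF n] P by (auto simp: less_le)
      have "(a n)\<^sup>2 * b n ^ (P - 2) = (a n ^ P) powr (2 / P) * (b n ^ P) powr (1 - 2 / P)"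
        using pw[OF pos(1), of 2] pw[OF pos(2), of "P - 2"] P by (simp add: of_nat_diff diff_divide_distrib)
      also have "\<dots> = D * ((a n ^ P / A) powr (2 / P) * (b n ^ P / B) powr (1 - 2 / P))"
        using A B' pos by (simp add: D_def powr_divide)
      also have "\<dots> \<le> D * (2 / P * (a n ^ P / A) + (1 - 2 / P) * (b n ^ P / B))"
        using D A B' pos P by (intro mult_left_mono Youngs_inequality_0) auto
      finally show ?thesis .
    qed
  qed
  hence "(\<Sum>n\<in>N. (a n)\<^sup>2 * b n ^ (P - 2)) \<le>
      (\<Sum>n\<in>N. D * (2 / P * (a n ^ P / A) + (1 - 2 / P) * (b n ^ P / B)))"
    by (intro sum_mono)
  also have "\<dots> = D * (2 / P * (A / A) + (1 - 2 / P) * (B / B))"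
    unfolding A_def B_def by (simp add: sum.distrib flip: sum_distrib_left sum_divide_distrib)
  also have "\<dots> = D" using A B' by simp
  finally show ?thesis by (simp add: D_def A_def B_def)
qed

definition level_part :: "nat \<Rightarrow> 'n set \<Rightarrow> ('n \<Rightarrow> nat) \<Rightarrow> (('n \<Rightarrow> int) \<Rightarrow> real) \<Rightarrow> ('n \<Rightarrow> int) \<Rightarrow> real" where
  "level_part M J s g k = (if \<forall>j\<in>J. circ_level M (k j) = s j then g k else 0)"

text \<open>The square of an \<open>L\<^sub>P\<close> norm.\<close>

definition norm2 :: "nat \<Rightarrow> nat \<Rightarrow> (('n::finite \<Rightarrow> int) \<Rightarrow> real) \<Rightarrow> real" where
  "norm2 M P g = moment M P (\<lambda>k. of_real (g k)) powr (2 / P)"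

text \<open>The shape that remains after two of the \<open>P\<close> factors have been restricted to
  a block \<open>h\<close> while the other \<open>P - 2\<close> still carry all of
  \<open>g\<close>.\<close>

definition mixed_moment ::
    "nat \<Rightarrow> nat \<Rightarrow> (('n::finite \<Rightarrow> int) \<Rightarrow> real) \<Rightarrow> (('n \<Rightarrow> int) \<Rightarrow> real) \<Rightarrow> real" where
  "mixed_moment M P h g = (\<Sum>n\<in>grid M. (norm (trig_sum M 1 (\<lambda>k. of_real (h k)) n))\<^sup>2 *
     norm (trig_sum M 1 (\<lambda>k. of_real (g k)) n) ^ (P - 2)) / real M ^ CARD('n)"

lemma mixed_moment_le:
  fixes g :: "('n::finite \<Rightarrow> int) \<Rightarrow> real"
  assumes "M > 0" "P \<ge> 2" "moment M P (\<lambda>k. of_real (g k)) > 0"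
  shows "mixed_moment M P h g \<le> norm2 M P h * moment M P (\<lambda>k. of_real (g k)) powr (1 - 2 / P)"
proof -
  define D where "D = real M ^ CARD('n)"
  have D: "D > 0" using assms by (simp add: D_def)
  define a where "a n = norm (trig_sum M 1 (\<lambda>k. of_real (h k)) n)" for n
  define b where "b n = norm (trig_sum M 1 (\<lambda>k. of_real (g k)) n)" for n
  have B: "(\<Sum>n\<in>grid M. b n ^ P) > 0"
    using assms D by (simp add: moment_def b_def D_def zero_less_divide_iff)
  have "mixed_moment M P h g = (\<Sum>n\<in>grid M. (a n)\<^sup>2 * b n ^ (P - 2)) / D"
    by (simp add: mixed_moment_def a_def b_def D_def)
  also have "\<dots> \<le> ((\<Sum>n\<in>grid M. a n ^ P) powr (2 / P) * (\<Sum>n\<in>grid M. b n ^ P) powr (1 - 2 / P)) / D"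
    using assms D B by (intro divide_right_mono Holder_sum_square) (auto simp: a_def b_def)
  also have "D = D powr (2 / P) * D powr (1 - 2 / P)"
    using D by (simp flip: powr_add)
  also have "((\<Sum>n\<in>grid M. a n ^ P) powr (2 / P) * (\<Sum>n\<in>grid M. b n ^ P) powr (1 - 2 / P)) / \<dots>
     = ((\<Sum>n\<in>grid M. a n ^ P) / D) powr (2 / P) * ((\<Sum>n\<in>grid M. b n ^ P) / D) powr (1 - 2 / P)"
    using D by (simp add: powr_divide sum_nonneg a_def b_def)
  finally show ?thesis by (simp add: norm2_def moment_def a_def b_def D_def)
qed

text \<open>For nonnegative coefficients the high moment is a sum over vanishing signed sums of
  frequencies. Two of the frequencies have comparable size, and the remaining ones may be left
  unrestricted, so no maximal function is needed.\<close>

lemma moment_le_sum_mixed_moment: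
  fixes g :: "('n::finite \<Rightarrow> int) \<Rightarrow> real"
  assumes M: "M > 0" and P: "P \<ge> 2" "even P" and g: "\<And>k. 0 \<le> g k"
  shows "moment M P (\<lambda>k. of_real (g k)) \<le>
     real (P\<^sup>2 * (2 * P + 1)) * (\<Sum>t\<le>M. mixed_moment M P (level_part M {j} (\<lambda>_. t) g) g)"
proof -
  define part where "part t = level_part M {j} (\<lambda>_. t) g" for t
  have part: "0 \<le> part t k" for t k using g by (simp add: part_def level_part_def)
  define A where "A t = mixed_moment M P (part t) g" for t
  define Y where "Y = {(t, t'). t \<le> M \<and> t' \<le> M \<and> t \<le> t' + P \<and> t' \<le> t + P}"
  define X where "X = {(i, i'). i < P \<and> i' < P \<and> i \<noteq> i'}"
  have fX: "finite X" and fY: "finite Y"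
    by (rule finite_subset[of _ "{..P} \<times> {..P}"], force simp: X_def, simp)
       (rule finite_subset[of _ "{..M} \<times> {..M}"], force simp: Y_def, simp)
  \<comment> \<open>At the places \<open>i\<close> and \<open>i'\<close> the coefficients are
    restricted to the levels \<open>t\<close> and \<open>t'\<close>. Every vanishing sum is caught
    by some choice; catching it several times is harmless because all terms are nonnegative.\<close>
  define F where "F = (\<lambda>((i, i'), (t, t')). (\<lambda>_::nat. g)(i := part t, i' := part t'))"
  have Fnn: "0 \<le> F x i k" for x i k using g part by (auto simp: F_def split: prod.split)
  have "(\<Prod>i<P. g (\<kappa> i)) \<le> (\<Sum>x\<in>X \<times> Y. \<Prod>i<P. F x i (\<kappa> i))"
    if \<kappa>: "\<kappa> \<in> zero_sums M alt_sign {..<P}" for \<kappa> :: "nat \<Rightarrow> 'n \<Rightarrow> int"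
  proof -
    have "int M dvd (\<Sum>i<P. alt_sign i * \<kappa> i j)" using \<kappa> by (simp add: zero_sums_def)
    from vanishing_sum_close_levels[OF M P(1) _ this] obtain i i' where
      i: "i < P" "i' < P" "i \<noteq> i'" "circ_level M (\<kappa> i j) \<le> circ_level M (\<kappa> i' j) + P"
        "circ_level M (\<kappa> i' j) \<le> circ_level M (\<kappa> i j) + P" by auto
    define x where "x = ((i, i'), (circ_level M (\<kappa> i j), circ_level M (\<kappa> i' j)))"
    have "x \<in> X \<times> Y" using i circ_level_le[OF M] by (auto simp: x_def X_def Y_def)
    hence "(\<Prod>h<P. F x h (\<kappa> h)) \<le> (\<Sum>x\<in>X \<times> Y. \<Prod>h<P. F x h (\<kappa> h))"
      using fX fY Fnn by (intro member_le_sum) (auto intro: prod_nonneg)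
    moreover have "(\<Prod>h<P. F x h (\<kappa> h)) = (\<Prod>h<P. g (\<kappa> h))"
      by (intro prod.cong refl) (simp add: F_def x_def part_def level_part_def)
    ultimately show ?thesis by simp
  qed
  hence "moment M P (\<lambda>k. of_real (g k)) \<le>
      (\<Sum>\<kappa>\<in>zero_sums M alt_sign {..<P}. \<Sum>x\<in>X \<times> Y. \<Prod>i<P. F x i (\<kappa> i))"
    unfolding moment_real_eq[OF M P(2)] by (rule sum_mono)
  also have "\<dots> = (\<Sum>x\<in>X \<times> Y. \<Sum>\<kappa>\<in>zero_sums M alt_sign {..<P}. \<Prod>i<P. F x i (\<kappa> i))"
    by (rule sum.swap)
  also have "\<dots> \<le> (\<Sum>x\<in>X \<times> Y. (A (fst (snd x)) + A (snd (snd x))) / 2)"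
  proof (rule sum_mono)
    fix x assume "x \<in> X \<times> Y"
    then obtain i i' t t' where x: "x = ((i, i'), (t, t'))" "i < P" "i' < P" "i \<noteq> i'"
      by (auto simp: X_def)
    define G where "G n = norm (trig_sum M 1 (\<lambda>k. of_real (g k)) n)" for n
    define H where "H t n = norm (trig_sum M 1 (\<lambda>k. of_real (part t k)) n)" for t n
    have "(\<Sum>\<kappa>\<in>zero_sums M alt_sign {..<P}. \<Prod>h<P. F x h (\<kappa> h)) \<le>
       (\<Sum>n\<in>grid M. \<Prod>h<P. norm (trig_sum M 1 (\<lambda>k. of_real (F x h k)) n)) / real M ^ CARD('n)"
      by (rule sum_zero_sums_le[OF M])
    also have "\<dots> = (\<Sum>n\<in>grid M. H t n * H t' n * G n ^ (P - 2)) / real M ^ CARD('n)"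
    proof -
      have "(\<Prod>h<P. norm (trig_sum M 1 (\<lambda>k. of_real (F x h k)) n)) = H t n * H t' n * G n ^ (P - 2)" for n
      proof -
        define R where "R = {..<P} - {i} - {i'}"
        have "card R = P - 2" using x by (simp add: R_def)
        have "(\<Prod>h<P. norm (trig_sum M 1 (\<lambda>k. of_real (F x h k)) n)) =
          H t n * (H t' n * (\<Prod>h\<in>R. norm (trig_sum M 1 (\<lambda>k. of_real (F x h k)) n)))"
          using x by (simp add: R_def prod.remove[of "{..<P}" i] prod.remove[of "{..<P} - {i}" i'] F_def H_def)
        also have "(\<Prod>h\<in>R. norm (trig_sum M 1 (\<lambda>k. of_real (F x h k)) n)) = (\<Prod>h\<in>R. G n)"
          by (intro prod.cong) (auto simp: R_def F_def x(1) G_def)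
        finally show ?thesis using \<open>card R = P - 2\<close> by simp
      qed
      thus ?thesis by simp
    qed
    also have "\<dots> \<le> (\<Sum>n\<in>grid M. ((H t n)\<^sup>2 * G n ^ (P - 2) + (H t' n)\<^sup>2 * G n ^ (P - 2)) / 2) / real M ^ CARD('n)"
    proof (intro divide_right_mono sum_mono)
      fix n
      \<comment> \<open>This decouples the two levels, so that only squares of one block
        remain.\<close>
      have "H t n * H t' n \<le> ((H t n)\<^sup>2 + (H t' n)\<^sup>2) / 2"
        using sum_squares_bound[of "H t n" "H t' n"] by simp
      hence "H t n * H t' n * G n ^ (P - 2) \<le> ((H t n)\<^sup>2 + (H t' n)\<^sup>2) / 2 * G n ^ (P - 2)"
        by (rule mult_right_mono) (simp add: G_def)
      thus "H t n * H t' n * G n ^ (P - 2) \<le> ((H t n)\<^sup>2 * G n ^ (P - 2) + (H t' n)\<^sup>2 * G n ^ (P - 2)) / 2"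
        by (simp add: distrib_right)
    qed simp
    also have "\<dots> = (A t + A t') / 2"
      by (simp add: A_def mixed_moment_def H_def G_def sum.distrib add_divide_distrib flip: sum_divide_distrib)
    finally show "(\<Sum>\<kappa>\<in>zero_sums M alt_sign {..<P}. \<Prod>h<P. F x h (\<kappa> h)) \<le> (A (fst (snd x)) + A (snd (snd x))) / 2"
      by (simp add: x)
  qed
  also have "\<dots> = card X * (\<Sum>y\<in>Y. (A (fst y) + A (snd y)) / 2)"
    unfolding sum.cartesian_product' by simp
  also have "\<dots> \<le> real (P\<^sup>2) * (\<Sum>y\<in>Y. (A (fst y) + A (snd y)) / 2)"
  proof (intro mult_right_mono sum_nonneg)
    have "card X \<le> card ({..<P} \<times> {..<P})" by (intro card_mono) (auto simp: X_def)
    thus "real (card X) \<le> real (P\<^sup>2)" by (simp add: power2_eq_square flip: of_nat_mult)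
  qed (auto simp: A_def mixed_moment_def intro!: add_nonneg_nonneg divide_nonneg_nonneg sum_nonneg)
  also have "(\<Sum>y\<in>Y. (A (fst y) + A (snd y)) / 2) = (\<Sum>y\<in>Y. A (fst y))"
  proof -
    have "(\<Sum>y\<in>Y. A (snd y)) = (\<Sum>y\<in>Y. A (fst y))"
      by (rule sum.reindex_bij_witness[of _ prod.swap prod.swap]) (auto simp: Y_def)
    thus ?thesis by (simp add: sum.distrib flip: sum_divide_distrib)
  qed
  also have "(\<Sum>y\<in>Y. A (fst y)) = (\<Sum>t\<le>M. \<Sum>t'\<in>{t'. t' \<le> M \<and> t \<le> t' + P \<and> t' \<le> t + P}. A t)"
    by (subst sum.Sigma) (auto simp: Y_def split_def intro!: sum.cong)
  \<comment> \<open>Origin of the constant: at most \<open>P\<^sup>2\<close> pairs of places, and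
    for each level \<open>t\<close> at most \<open>2 * P + 1\<close> levels \<open>t'\<close> within
    distance \<open>P\<close>.\<close>
  also have "real (P\<^sup>2) * \<dots> \<le> real (P\<^sup>2) * (\<Sum>t\<le>M. real (2 * P + 1) * A t)"
  proof (intro mult_left_mono sum_mono)
    fix t
    have "card {t'. t' \<le> M \<and> t \<le> t' + P \<and> t' \<le> t + P} \<le> card {t - P..t + P}"
      by (intro card_mono) auto
    also have "\<dots> \<le> 2 * P + 1" by simp
    finally have "real (card {t'. t' \<le> M \<and> t \<le> t' + P \<and> t' \<le> t + P}) \<le> real (2 * P + 1)"
      by (simp only: of_nat_le_iff)
    moreover have "0 \<le> A t"
      unfolding A_def mixed_moment_def by (intro divide_nonneg_nonneg sum_nonneg) auto
    ultimately show "(\<Sum>t'\<in>{t'. t' \<le> M \<and> t \<le> t' + P \<and> t' \<le> t + P}. A t) \<le> real (2 * P + 1) * A t"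
      unfolding sum_constant by (rule mult_right_mono)
  qed simp
  also have "\<dots> = real (P\<^sup>2 * (2 * P + 1)) * (\<Sum>t\<le>M. A t)"
    by (simp only: of_nat_mult[of "P\<^sup>2"] mult.assoc sum_distrib_left)
  finally show ?thesis by (simp only: A_def part_def)
qed

text \<open>By Hoelder each mixed moment is at most the squared norm of its block times
  \<open>m powr (1 - 2 / P)\<close>, where \<open>m\<close> is the moment of \<open>g\<close>.
  Dividing this power out leaves \<open>m powr (2 / P)\<close> on the left: the square function
  bound in one coordinate, already combined with the triangle inequality for the squares.\<close>

lemma norm2_le_sum_level:
  fixes g :: "('n::finite \<Rightarrow> int) \<Rightarrow> real"
  assumes M: "M > 0" and P: "P \<ge> 2" "even P" and g: "\<And>k. 0 \<le> g k"
  shows "norm2 M P g \<le> real (P\<^sup>2 * (2 * P + 1)) * (\<Sum>t\<le>M. norm2 M P (level_part M {j} (\<lambda>_. t) g))"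
proof (cases "moment M P (\<lambda>k. of_real (g k)) = 0")
  case True
  thus ?thesis by (auto simp: norm2_def intro!: mult_nonneg_nonneg sum_nonneg)
next
  case False
  define m where "m = moment M P (\<lambda>k. of_real (g k))"
  have m: "m > 0" using False moment_nonneg[of M P "\<lambda>k. of_real (g k)"] by (simp add: m_def)
  define K where "K = real (P\<^sup>2 * (2 * P + 1))"
  define W where "W = (\<Sum>t\<le>M. norm2 M P (level_part M {j} (\<lambda>_. t) g))"
  have "m \<le> K * (\<Sum>t\<le>M. mixed_moment M P (level_part M {j} (\<lambda>_. t) g) g)"
    unfolding m_def K_def by (rule moment_le_sum_mixed_moment[OF M P g])
  also have "\<dots> \<le> K * (\<Sum>t\<le>M. norm2 M P (level_part M {j} (\<lambda>_. t) g) * m powr (1 - 2 / P))"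
    unfolding m_def using m by (intro mult_left_mono sum_mono mixed_moment_le M P) (auto simp: K_def m_def)
  also have "\<dots> = K * W * m powr (1 - 2 / P)" by (simp add: W_def sum_distrib_right mult.assoc)
  finally have "m / m powr (1 - 2 / P) \<le> K * W" using m by (simp add: divide_le_eq)
  moreover have "m / m powr (1 - 2 / P) = m powr (2 / P)"
    using m powr_diff[of m 1 "1 - 2 / P"] by simp
  ultimately show ?thesis by (simp add: norm2_def m_def K_def W_def)
qed

text \<open>The blocks again have nonnegative coefficients, so the bound for one coordinate can be
  iterated; each coordinate contributes one factor.\<close>

lemma norm2_le_sum_levels:
  fixes g :: "('n::finite \<Rightarrow> int) \<Rightarrow> real"
  assumes M: "M > 0" and P: "P \<ge> 2" "even P" and g: "\<And>k. 0 \<le> g k"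
  shows "norm2 M P g \<le> real (P\<^sup>2 * (2 * P + 1)) ^ card J *
     (\<Sum>s\<in>PiE J (\<lambda>_. {..M}). norm2 M P (level_part M J s g))"
  using finite[of J]
proof (induction J rule: finite_induct)
  case empty
  show ?case by (simp add: level_part_def)
next
  case (insert j J)
  define K where "K = real (P\<^sup>2 * (2 * P + 1))"
  have "norm2 M P g \<le> K ^ card J * (\<Sum>s\<in>PiE J (\<lambda>_. {..M}). norm2 M P (level_part M J s g))"
    using insert.IH by (simp add: K_def)
  also have "\<dots> \<le> K ^ card J * (\<Sum>s\<in>PiE J (\<lambda>_. {..M}).
      K * (\<Sum>t\<le>M. norm2 M P (level_part M {j} (\<lambda>_. t) (level_part M J s g))))"
    unfolding K_def using g
    by (intro mult_left_mono sum_mono norm2_le_sum_level M P) (auto simp: level_part_def)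
  also have "\<dots> = K ^ card (insert j J) * (\<Sum>s\<in>PiE J (\<lambda>_. {..M}). \<Sum>t\<le>M.
      norm2 M P (level_part M (insert j J) (s(j := t)) g))"
  proof -
    have "level_part M {j} (\<lambda>_. t) (level_part M J s g) = level_part M (insert j J) (s(j := t)) g" for s t
      using insert.hyps by (auto simp: level_part_def fun_eq_iff)
    thus ?thesis using insert.hyps by (simp add: mult_ac flip: sum_distrib_left)
  qed
  finally show ?case unfolding K_def sum_PiE_insert[OF insert.hyps(2)] .
qed

text \<open>In a vanishing signed sum the first \<open>P - 1\<close> frequencies determine the last
  modulo \<open>M\<close>, and the grid contains one representative per class. The exponent
  \<open>P - 1\<close> instead of \<open>P\<close> is what later makes large blocks decay.\<close>

lemma moment_le_card_support:
  fixes g :: "('n::finite \<Rightarrow> int) \<Rightarrow> real"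
  assumes M: "M > 0" and P: "P > 0" "even P"
    and g: "\<And>k. k \<in> grid M \<Longrightarrow> 0 \<le> g k \<and> g k \<le> w" and w: "0 \<le> w"
    and A: "\<And>k. k \<in> grid M \<Longrightarrow> g k \<noteq> 0 \<Longrightarrow> k \<in> A" "A \<subseteq> grid M"
  shows "moment M P (\<lambda>k. of_real (g k)) \<le> w ^ P * real (card A) ^ (P - 1)"
proof -
  define Z where "Z = {\<kappa>\<in>zero_sums M alt_sign {..<P}. \<forall>i<P. \<kappa> i \<in> A}"
  obtain p where p: "P = Suc p" using P(1) by (cases P) auto
  have fA: "finite A" using A(2) finite_grid finite_subset by blast
  have "moment M P (\<lambda>k. of_real (g k)) = (\<Sum>\<kappa>\<in>Z. \<Prod>i<P. g (\<kappa> i))"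
    unfolding moment_real_eq[OF M P(2)]
  proof (rule sum.mono_neutral_right)
    show "\<forall>\<kappa>\<in>zero_sums M alt_sign {..<P} - Z. (\<Prod>i<P. g (\<kappa> i)) = 0"
    proof
      fix \<kappa> assume \<kappa>: "\<kappa> \<in> zero_sums M alt_sign {..<P} - Z"
      then obtain i where "i < P" "\<kappa> i \<notin> A" by (auto simp: Z_def)
      moreover have "\<kappa> i \<in> grid M" using \<kappa> \<open>i < P\<close> by (auto simp: zero_sums_def PiE_iff)
      ultimately show "(\<Prod>i<P. g (\<kappa> i)) = 0" using A(1) by (intro prod_zero) auto
    qed
  qed (auto simp: Z_def)
  also have "\<dots> \<le> (\<Sum>\<kappa>\<in>Z. \<Prod>i<P. w)"
    by (intro sum_mono prod_mono g) (auto simp: Z_def zero_sums_def PiE_iff)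
  also have "\<dots> = w ^ P * real (card Z)" by (simp add: mult.commute)
  also have "\<dots> \<le> w ^ P * real (card A) ^ (P - 1)"
  proof (intro mult_left_mono)
    have "inj_on (\<lambda>\<kappa>. restrict \<kappa> {..<p}) Z"
    proof (rule inj_onI)
      fix \<kappa> \<kappa>' assume \<kappa>: "\<kappa> \<in> Z" "\<kappa>' \<in> Z" and eq: "restrict \<kappa> {..<p} = restrict \<kappa>' {..<p}"
      have eq': "\<kappa> i = \<kappa>' i" if "i < p" for i using fun_cong[OF eq, of i] that by simp
      have "\<kappa> p = \<kappa>' p"
      proof (rule grid_eqI)
        fix j
        have "int M dvd (\<Sum>i<P. alt_sign i * \<kappa> i j) - (\<Sum>i<P. alt_sign i * \<kappa>' i j)"
          using \<kappa> by (intro dvd_diff) (auto simp: Z_def zero_sums_def)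
        also have "\<dots> = alt_sign p * (\<kappa> p j - \<kappa>' p j)"
          using eq' by (simp add: p right_diff_distrib)
        finally have "int M dvd alt_sign p * (alt_sign p * (\<kappa> p j - \<kappa>' p j))" by (rule dvd_mult)
        thus "int M dvd \<kappa> p j - \<kappa>' p j"
          by (simp add: alt_sign_def flip: mult.assoc power_mult_distrib)
      qed (use \<kappa> p A in \<open>auto simp: Z_def\<close>)
      moreover have "\<kappa> i = \<kappa>' i" if "i \<ge> P" for i
        using \<kappa> that by (auto simp: Z_def zero_sums_def PiE_iff extensional_def)
      ultimately show "\<kappa> = \<kappa>'" using eq' p by (metis ext less_Suc_eq not_less)
    qed
    moreover have "(\<lambda>\<kappa>. restrict \<kappa> {..<p}) ` Z \<subseteq> PiE {..<p} (\<lambda>_. A)"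
      by (auto simp: Z_def p)
    ultimately have "card Z \<le> card (PiE {..<p} (\<lambda>_. A))"
      using fA by (intro card_inj_on_le finite_PiE) auto
    hence "card Z \<le> card A ^ p" by (simp add: card_PiE)
    thus "real (card Z) \<le> real (card A) ^ (P - 1)" by (simp add: p flip: of_nat_power)
  qed (use w in auto)
  finally show ?thesis .
qed

section \<open>Dyadic blocks of the dual lattice\<close>

definition box_size :: "('n::finite \<Rightarrow> int) \<Rightarrow> int" where
  "box_size z = (\<Prod>j\<in>UNIV. max \<bar>z j\<bar> 1)"

text \<open>When \<open>m dvd M\<close> the congruence depends only on \<open>k\<close> modulo
  \<open>M\<close>, so these residues represent the dual lattice. The zero residue carries the mean
  value and is treated separately.\<close>

definition dual_residues :: "nat \<Rightarrow> nat \<Rightarrow> ('n::finite \<Rightarrow> int) \<Rightarrow> ('n \<Rightarrow> int) set" where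
  "dual_residues M m a = {k\<in>grid M. k \<noteq> (\<lambda>_. 0) \<and> int m dvd (\<Sum>j\<in>UNIV. a j * k j)}"

text \<open>Exactness on the hyperbolic cross in arithmetic form: the dual lattice has no nonzero
  point in the cross.\<close>

definition gap :: "nat \<Rightarrow> ('n::finite \<Rightarrow> int) \<Rightarrow> nat \<Rightarrow> bool" where
  "gap m a L \<longleftrightarrow> (\<forall>z. z \<noteq> (\<lambda>_. 0) \<longrightarrow> int m dvd (\<Sum>j\<in>UNIV. a j * z j) \<longrightarrow> int L < box_size z)"

lemma finite_dual_residues [simp]: "finite (dual_residues M m a)"
  unfolding dual_residues_def by simp

lemma dvd_inner_cong:
  fixes a :: "'n::finite \<Rightarrow> int"
  assumes "int m dvd (\<Sum>j\<in>UNIV. a j * k j)" "\<And>j. int m dvd z j - k j"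
  shows "int m dvd (\<Sum>j\<in>UNIV. a j * z j)"
proof -
  have "int m dvd (\<Sum>j\<in>UNIV. a j * k j) + (\<Sum>j\<in>UNIV. a j * (z j - k j))"
    by (rule dvd_add[OF assms(1)], intro dvd_sum dvd_mult assms(2))
  also have "\<dots> = (\<Sum>j\<in>UNIV. a j * z j)"
    by (simp add: algebra_simps flip: sum.distrib)
  finally show ?thesis .
qed

text \<open>The representatives of least absolute value still lie in the dual lattice because
  \<open>m dvd M\<close>, and they do not all vanish because \<open>k\<close> is not zero modulo
  \<open>M\<close>.\<close>

lemma dual_residues_box_size:
  assumes "gap m a L" "m dvd M" "M > 0" "k \<in> dual_residues M m a"
  shows "int L < (\<Prod>j\<in>UNIV. max (circ_abs M (k j)) 1)"
proof -
  define z where "z j = sym_mod M (k j)" for j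
  have "int m dvd (\<Sum>j\<in>UNIV. a j * z j)"
  proof (rule dvd_inner_cong)
    show "int m dvd (\<Sum>j\<in>UNIV. a j * k j)" using assms by (simp add: dual_residues_def)
    show "int m dvd z j - k j" for j
      using dvd_sym_mod_diff[of M "k j"] assms(2) by (auto simp: z_def intro: dvd_trans)
  qed
  moreover have "z \<noteq> (\<lambda>_. 0)"
  proof
    assume z: "z = (\<lambda>_. 0)"
    have "k = (\<lambda>_. 0)"
    proof (rule grid_eqI)
      show "int M dvd k j - 0" for j
        using fun_cong[OF z, of j] circ_abs_eq_0_iff[of M "k j"] assms(3) by (simp add: circ_abs_def z_def)
    qed (use assms in \<open>auto simp: dual_residues_def grid_def\<close>)
    thus False using assms by (simp add: dual_residues_def)
  qed
  ultimately have "int L < box_size z" using assms(1) by (auto simp: gap_def)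
  thus ?thesis by (simp add: box_size_def z_def circ_abs_def)
qed

text \<open>Serves to choose a cell of prescribed dyadic volume that is in no coordinate longer than
  a given block.\<close>

lemma exists_le_sum_eq:
  fixes s :: "'a \<Rightarrow> nat"
  assumes "finite I" "l \<le> sum s I"
  shows "\<exists>t. (\<forall>j\<in>I. t j \<le> s j) \<and> sum t I = l"
  using assms
proof (induction I arbitrary: l rule: finite_induct)
  case (insert j I)
  have "l - min l (s j) \<le> sum s I" using insert.prems insert.hyps by (simp add: min_def le_diff_conv add.commute)
  then obtain t where t: "\<forall>i\<in>I. t i \<le> s i" "sum t I = l - min l (s j)"
    using insert.IH[of "l - min l (s j)"] by auto
  have "sum (t(j := min l (s j))) I = sum t I"
    using insert.hyps by (intro sum.cong) auto
  thus ?case using t insert.hyps by (intro exI[of _ "t(j := min l (s j))"]) auto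
qed auto

text \<open>Pigeonhole: the block is cut into cells with sides \<open>2 ^ t j\<close> and volume at
  most \<open>L\<close>. Two dual points in one cell would differ by a nonzero dual point of box
  size at most \<open>L\<close>, which \<open>gap\<close> forbids, so the number of points is at
  most the number of cells. For the bound \<open>L < W\<close> a single point of the block
  suffices.\<close>

lemma dual_residues_level:
  fixes a :: "'n::finite \<Rightarrow> int" and s :: "'n \<Rightarrow> nat"
  assumes gap: "gap m a L" and M: "m dvd M" "M > 0" and L: "L > 0"
  defines "A \<equiv> {k\<in>dual_residues M m a. \<forall>j. circ_level M (k j) = s j}"
  defines "W \<equiv> (\<Prod>j\<in>UNIV. 2 ^ s j) :: real"
  assumes "A \<noteq> {}"
  shows "real L < W" "real (card A) \<le> 2 ^ (CARD('n) + 1) * (W / L)"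
proof -
  have lev: "\<bar>sym_mod M (k j)\<bar> < 2 ^ s j" if "k \<in> A" for k j
    using abs_less_two_power_level[of "circ_abs M (k j)"] that by (auto simp: A_def circ_level_def circ_abs_def)
  obtain k where k: "k \<in> A" using assms by auto
  have "int L < (\<Prod>j\<in>UNIV. max (circ_abs M (k j)) 1)"
    using k by (intro dual_residues_box_size[OF gap M]) (auto simp: A_def)
  also have "\<dots> \<le> (\<Prod>j\<in>UNIV. 2 ^ s j)"
    using lev[OF k] by (intro prod_mono) (auto simp: circ_abs_def less_imp_le)
  finally have "real_of_int (int L) < real_of_int (\<Prod>j\<in>UNIV. 2 ^ s j)" by (simp only: of_int_less_iff)
  thus LW: "real L < W" by (simp add: W_def)
  \<comment> \<open>The largest power of two not exceeding \<open>L\<close>: cells of this volume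
    still separate the points, and the count loses only a factor 2.\<close>
  obtain l where l: "2 ^ l \<le> L" "L < 2 ^ (l + 1)"
    using ex_power_ivl1[of 2 L] L by auto
  have W2: "W = 2 ^ (\<Sum>j\<in>UNIV. s j)" by (simp add: W_def power_sum)
  have "real (2 ^ l) < W" using l(1) LW by (meson of_nat_le_iff order.strict_trans1)
  hence "(2::real) ^ l < 2 ^ (\<Sum>j\<in>UNIV. s j)" by (simp add: W2)
  hence "l \<le> (\<Sum>j\<in>UNIV. s j)" by (simp add: power_strict_increasing_iff)
  then obtain t where t: "\<And>j. t j \<le> s j" "(\<Sum>j\<in>UNIV. t j) = l"
    using exists_le_sum_eq[of UNIV l s] by auto
  \<comment> \<open>The index of the cell that contains the point; \<open>div\<close> rounds down,
    so cells of negative coordinates have the same length.\<close>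
  define f where "f k = (\<lambda>j. sym_mod M (k j) div 2 ^ t j)" for k :: "'n \<Rightarrow> int"
  define B where "B = PiE UNIV (\<lambda>j. {- (2 ^ (s j - t j))..<2 ^ (s j - t j) :: int})"
  have "f k \<in> B" if "k \<in> A" for k
  proof -
    have "- (2 ^ (s j - t j)) \<le> sym_mod M (k j) div 2 ^ t j \<and> sym_mod M (k j) div 2 ^ t j < 2 ^ (s j - t j)" for j
    proof -
      have e: "(2::int) ^ s j = 2 ^ (s j - t j) * 2 ^ t j" using t(1)[of j] by (simp flip: power_add)
      define q r where "q = sym_mod M (k j) div 2 ^ t j" and "r = sym_mod M (k j) mod 2 ^ t j"
      have "sym_mod M (k j) = 2 ^ t j * q + r" "0 \<le> r" "r < 2 ^ t j" by (simp_all add: q_def r_def)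
      moreover have "\<bar>sym_mod M (k j)\<bar> < 2 ^ t j * 2 ^ (s j - t j)"
        using lev[OF that, of j] by (simp add: e mult.commute)
      ultimately have "2 ^ t j * q < 2 ^ t j * 2 ^ (s j - t j)" "- (2 ^ t j * 2 ^ (s j - t j)) < 2 ^ t j * q + 2 ^ t j"
        by linarith+
      hence "2 ^ t j * q < 2 ^ t j * 2 ^ (s j - t j)" "2 ^ t j * (- (2 ^ (s j - t j))) < 2 ^ t j * (q + 1)"
        by (simp_all only: distrib_left mult_minus_right mult_1_right)
      hence "q < 2 ^ (s j - t j)" "- (2 ^ (s j - t j)) < q + 1"
        by (simp_all only: mult_less_cancel_left_pos zero_less_power zero_less_numeral)
      thus ?thesis by (simp add: q_def)
    qed
    thus ?thesis by (auto simp: B_def f_def)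
  qed
  moreover have "inj_on f A"
  proof (rule inj_onI)
    fix k k' assume k: "k \<in> A" "k' \<in> A" and eq: "f k = f k'"
    define z where "z j = sym_mod M (k j) - sym_mod M (k' j)" for j
    have zs: "\<bar>z j\<bar> < 2 ^ t j" for j
    proof -
      have "sym_mod M (k j) = 2 ^ t j * (sym_mod M (k j) div 2 ^ t j) + sym_mod M (k j) mod 2 ^ t j"
        "sym_mod M (k' j) = 2 ^ t j * (sym_mod M (k' j) div 2 ^ t j) + sym_mod M (k' j) mod 2 ^ t j"
        by (rule mult_div_mod_eq[symmetric])+
      moreover have "sym_mod M (k j) div 2 ^ t j = sym_mod M (k' j) div 2 ^ t j"
        using fun_cong[OF eq, of j] by (simp add: f_def)
      moreover have "0 \<le> x mod 2 ^ t j" "x mod 2 ^ t j < 2 ^ t j" for x :: int by simp_all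
      ultimately show ?thesis unfolding z_def by (smt (verit))
    qed
    have zd: "int M dvd z j - (k j - k' j)" for j
      using dvd_diff[OF dvd_sym_mod_diff[of M "k j"] dvd_sym_mod_diff[of M "k' j"]]
      by (simp add: z_def algebra_simps)
    have "int m dvd (\<Sum>j\<in>UNIV. a j * (k j - k' j))"
      using k dvd_diff[of "int m" "\<Sum>j\<in>UNIV. a j * k j" "\<Sum>j\<in>UNIV. a j * k' j"]
      by (simp add: A_def dual_residues_def right_diff_distrib sum_subtractf)
    hence "int m dvd (\<Sum>j\<in>UNIV. a j * z j)"
      by (rule dvd_inner_cong) (rule dvd_trans[OF _ zd], simp add: M)
    moreover have "box_size z \<le> int L"
    proof -
      have "box_size z \<le> (\<Prod>j\<in>UNIV. 2 ^ t j)"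
        unfolding box_size_def using zs by (intro prod_mono) (auto simp: less_imp_le)
      also have "\<dots> = int (2 ^ l)" by (simp add: t(2) flip: power_sum)
      finally show ?thesis using l(1) by linarith
    qed
    ultimately have "z = (\<lambda>_. 0)" using gap by (force simp: gap_def)
    thus "k = k'"
    proof (intro grid_eqI[of k M])
      fix j assume "z = (\<lambda>_. 0)"
      thus "int M dvd k j - k' j" using zd[of j] by (simp add: dvd_diff_commute)
    qed (use k in \<open>auto simp: A_def dual_residues_def\<close>)
  qed
  ultimately have "card A \<le> card B"
    by (intro card_inj_on_le[of f]) (auto simp: B_def intro!: finite_PiE)
  also have "card B = (\<Prod>j\<in>UNIV. 2 * 2 ^ (s j - t j))"
    by (simp add: B_def card_PiE nat_mult_distrib nat_power_eq)
  finally have "real (card A) \<le> real (\<Prod>j\<in>(UNIV::'n set). 2 * 2 ^ (s j - t j))" by (simp only: of_nat_le_iff)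
  also have "\<dots> = 2 ^ CARD('n) * (W / 2 ^ l)"
  proof -
    have "(\<Prod>j\<in>UNIV. (2::real) ^ (s j - t j)) = W / 2 ^ l"
      using t by (simp add: W_def power_diff prod_dividef power_sum[symmetric])
    thus ?thesis by (simp add: prod.distrib)
  qed
  also have "\<dots> \<le> 2 ^ CARD('n) * (2 * (W / L))"
  proof (intro mult_left_mono)
    have "real L \<le> real (2 ^ (l + 1))" using l(2) by (simp only: of_nat_le_iff)
    hence "W * L \<le> W * (2 * 2 ^ l)" by (intro mult_left_mono) (auto simp: W_def prod_nonneg)
    thus "W / 2 ^ l \<le> 2 * (W / L)" using L by (simp add: field_simps)
  qed auto
  finally show "real (card A) \<le> 2 ^ (CARD('n) + 1) * (W / L)" by (simp add: mult_ac)
qed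

text \<open>The majorant of the Fourier coefficients after a factor \<open>(1 / L) ^ r\<close> has
  been split off. It is applied with \<open>U j = r * u_j\<close>, the side lengths of the box, so
  that \<open>L * (\<Prod>j. U j)\<close> is L v.\<close>

definition weight :: "nat \<Rightarrow> nat \<Rightarrow> ('n::finite \<Rightarrow> int) \<Rightarrow> ('n \<Rightarrow> real) \<Rightarrow> nat \<Rightarrow> ('n \<Rightarrow> int) \<Rightarrow> real" where
  "weight M m a U L k = (if k \<in> dual_residues M m a
     then L * (\<Prod>j\<in>UNIV. min (2 * U j) (1 / max (circ_abs M (k j)) 1)) else 0)"

lemma weight_nonneg: "(\<And>j. U j > 0) \<Longrightarrow> 0 \<le> weight M m a U L k"
proof -
  assume U: "\<And>j. U j > 0"
  have "0 \<le> L * (\<Prod>j\<in>UNIV. min (2 * U j) (1 / max (circ_abs M (k j)) 1))"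
    using U by (intro mult_nonneg_nonneg prod_nonneg) (auto simp: less_imp_le)
  thus ?thesis by (simp add: weight_def)
qed

text \<open>In the block \<open>max(|k_j|, 1)\<close> is at least \<open>2 ^ s j / 2\<close>, so the
  coefficients are at most \<open>w\<close>. With \<open>n\<close> points the squared norm is at
  most \<open>w\<^sup>2 * n powr (2 - 2 / P)\<close>, where \<open>n\<close> is at most of order
  \<open>W / L\<close>. The square of \<open>W / L\<close> cancels against \<open>w\<^sup>2\<close>,
  and \<open>(L / W) powr (2 / P)\<close> remains as decay. The numbers \<open>x s j\<close> compare
  the block with \<open>1 / U j\<close>.\<close>

lemma norm2_level_weight:
  fixes a :: "'n::finite \<Rightarrow> int" and s :: "'n \<Rightarrow> nat"
  assumes gap: "gap m a L" and M: "m dvd M" "M > 0" and L: "L > 0" and P: "P \<ge> 2" "even P"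
    and U: "\<And>j. U j > 0"
  defines "x \<equiv> \<lambda>(s :: 'n \<Rightarrow> nat) j. 2 ^ s j * U j" and "V \<equiv> L * (\<Prod>j\<in>UNIV. U j)"
  shows "norm2 M P (level_part M UNIV s (weight M m a U L)) \<le> 4 ^ (2 * CARD('n) + 1) *
    (if V < (\<Prod>j\<in>UNIV. x s j) then (V / (\<Prod>j\<in>UNIV. x s j)) powr (2 / P) * (\<Prod>j\<in>UNIV. (min (x s j) 1)\<^sup>2) else 0)"
proof -
  define A where "A = {k\<in>dual_residues M m a. \<forall>j. circ_level M (k j) = s j}"
  define W where "W = (\<Prod>j\<in>UNIV. 2 ^ s j :: real)"
  define D where "D = (\<Prod>j\<in>UNIV. min (x s j) 1)"
  define w where "w = L * (2 ^ CARD('n) / W * D)"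
  define g where "g = level_part M UNIV s (weight M m a U L)"
  have W: "W > 0" unfolding W_def by (intro prod_pos) auto
  have D: "D \<ge> 0" unfolding D_def x_def using U by (intro prod_nonneg) (auto simp: less_imp_le)
  have w: "w \<ge> 0" using W D by (simp add: w_def)
  have Ux: "V / (\<Prod>j\<in>UNIV. x s j) = L / W"
  proof -
    have "U j \<noteq> 0" for j using U[of j] by simp
    thus ?thesis by (simp add: V_def x_def W_def prod.distrib)
  qed
  have xpos: "(\<Prod>j\<in>UNIV. x s j) > 0" unfolding x_def using U by (intro prod_pos) auto
  have cond: "V < (\<Prod>j\<in>UNIV. x s j) \<longleftrightarrow> L < W"
    using Ux W xpos by (metis divide_less_eq_1_pos)
  have gle: "0 \<le> g k \<and> g k \<le> w" for k
  proof
    show "0 \<le> g k" using weight_nonneg[of U M m a L k, OF U] by (simp add: g_def level_part_def)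
    show "g k \<le> w"
    proof (cases "k \<in> A")
      case False
      thus ?thesis using w by (auto simp: g_def level_part_def weight_def A_def)
    next
      case True
      have "g k = L * (\<Prod>j\<in>UNIV. min (2 * U j) (1 / max (circ_abs M (k j)) 1))"
        using True by (auto simp: g_def level_part_def weight_def A_def)
      also have "\<dots> \<le> L * (\<Prod>j\<in>UNIV. 2 / 2 ^ s j * min (x s j) 1)"
      proof (intro mult_left_mono prod_mono conjI)
        fix j
        have "2 ^ s j \<le> 2 * max (circ_abs M (k j)) 1"
          using two_power_level_le[of "circ_abs M (k j)"] True by (auto simp: A_def circ_level_def)
        hence "real_of_int (2 ^ s j) \<le> real_of_int (2 * max (circ_abs M (k j)) 1)"
          by (simp only: of_int_le_iff)
        hence "1 / max (circ_abs M (k j)) 1 \<le> 2 / (2 ^ s j :: real)"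
          by (simp add: field_simps)
        hence "min (2 * U j) (1 / max (circ_abs M (k j)) 1) \<le> min (2 * U j) (2 / (2 ^ s j :: real))"
          by (rule min.mono[OF order_refl])
        also have "\<dots> = 2 / 2 ^ s j * min (x s j) 1"
          by (simp add: min_mult_distrib_left x_def)
        finally show "min (2 * U j) (1 / max (circ_abs M (k j)) 1) \<le> 2 / 2 ^ s j * min (x s j) 1" .
      qed (use U in \<open>auto simp: less_imp_le\<close>)
      also have "\<dots> = w"
        by (simp add: w_def W_def D_def prod.distrib prod_dividef)
      finally show ?thesis .
    qed
  qed
  have mom: "moment M P (\<lambda>k. of_real (g k)) \<le> w ^ P * real (card A) ^ (P - 1)"
  proof (rule moment_le_card_support[OF M(2) _ P(2) gle w])
    show "A \<subseteq> grid M" by (auto simp: A_def dual_residues_def)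
    show "k \<in> A" if "g k \<noteq> 0" for k
      using that by (auto simp: g_def level_part_def weight_def A_def split: if_splits)
  qed (use P in auto)
  show ?thesis
  proof (cases "A = {}")
    case True
    hence "moment M P (\<lambda>k. of_real (g k)) = 0"
      using mom moment_nonneg[of M P "\<lambda>k. of_real (g k)"] P by (simp add: power_0_left)
    hence "norm2 M P g = 0" by (simp add: norm2_def)
    moreover have "0 \<le> (\<Prod>j\<in>UNIV. (min (x s j) 1)\<^sup>2)" by (intro prod_nonneg) auto
    ultimately show ?thesis by (auto simp flip: g_def)
  next
    case False
    define n where "n = real (card A)"
    have fA: "finite A" by (auto simp: A_def)
    hence n: "n > 0" using False by (simp add: n_def card_gt_0_iff)
    have LW: "L < W" and nW: "n \<le> 2 ^ (CARD('n) + 1) * (W / L)"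
      using dual_residues_level[OF gap M L, of s] False by (simp_all add: A_def W_def n_def)
    have a1: "2 / P \<le> 1" using P by simp
    have "norm2 M P g \<le> (w ^ P * n ^ (P - 1)) powr (2 / P)"
      unfolding norm2_def n_def using mom moment_nonneg by (intro powr_mono2) auto
    also have "\<dots> = w\<^sup>2 * n powr (2 - 2 / P)"
    proof (cases "w = 0")
      case True thus ?thesis using P by (simp add: power_0_left)
    next
      case F: False
      hence "w > 0" using w by simp
      hence "(w ^ P * n ^ (P - 1)) powr (2 / P) = (w powr P) powr (2 / P) * (n powr (P - 1)) powr (2 / P)"
        using n P by (simp add: powr_mult powr_realpow flip: powr_realpow)
      also have "\<dots> = w powr 2 * n powr (2 - 2 / P)"
        using P by (simp add: powr_powr of_nat_diff field_simps)
      finally show ?thesis using \<open>w > 0\<close> by simp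
    qed
    also have "\<dots> \<le> w\<^sup>2 * (2 ^ (CARD('n) + 1) * (W / L)) powr (2 - 2 / P)"
      using n nW a1 by (intro mult_left_mono powr_mono2) auto
    also have "\<dots> = w\<^sup>2 * ((2 ^ (CARD('n) + 1)) powr (2 - 2 / P) * (W / L) powr (2 - 2 / P))"
      using W L by (subst powr_mult) auto
    \<comment> \<open>Raising the exponent of the constant to 2 removes \<open>P\<close> from it;
      together with the factor \<open>(2 ^ CARD('n))\<^sup>2\<close> inside \<open>w\<^sup>2\<close>
      it becomes \<open>4 ^ (2 * CARD('n) + 1)\<close>.\<close>
    also have "\<dots> \<le> w\<^sup>2 * ((2 ^ (CARD('n) + 1)) powr 2 * (W / L) powr (2 - 2 / P))"
      by (intro mult_left_mono mult_right_mono powr_mono one_le_power) auto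
    also have "(W / L) powr (2 - 2 / P) = (W / L)\<^sup>2 * (L / W) powr (2 / P)"
    proof -
      have "(W / L) powr (2 - 2 / P) = (W / L) powr 2 / (W / L) powr (2 / P)"
        by (rule powr_diff)
      thus ?thesis using W L by (simp add: powr_divide power_divide)
    qed
    also have "w\<^sup>2 * ((2 ^ (CARD('n) + 1)) powr 2 * ((W / L)\<^sup>2 * (L / W) powr (2 / P)))
      = 4 ^ (2 * CARD('n) + 1) * ((L / W) powr (2 / P) * D\<^sup>2)"
    proof -
      have "((2::real) ^ (CARD('n) + 1)) powr 2 = 2 ^ (2 * (CARD('n) + 1))"
        by (simp flip: power_mult add: mult.commute)
      moreover have "(4::real) ^ (2 * CARD('n) + 1) = 2 ^ (2 * (CARD('n) + 1)) * (2 ^ CARD('n))\<^sup>2"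
        by (simp add: power_mult power_add flip: power_mult_distrib power2_eq_square)
           (simp add: power2_eq_square flip: power_mult_distrib)
      ultimately show ?thesis using W L by (simp add: w_def power_mult_distrib power_divide)
    qed
    finally show ?thesis
      using LW unfolding cond Ux by (simp add: g_def D_def prod_power_distrib)
  qed
qed

lemma norm2_weight:
  fixes a :: "'n::finite \<Rightarrow> int"
  assumes gap: "gap m a L" and M: "m dvd M" "M > 0" and L: "L > 0" and P: "P \<ge> 2" "even P"
    and U: "\<And>j. U j > 0"
  defines "V \<equiv> L * (\<Prod>j\<in>UNIV. U j)"
  assumes V: "ln V \<ge> 1"
  shows "norm2 M P (weight M m a U L) \<le> real (P\<^sup>2 * (2 * P + 1)) ^ CARD('n) * 4 ^ (2 * CARD('n) + 1) *
    ((real P + 2) * exp 1 * (2 * real P) ^ (CARD('n) - 1)) * ln V ^ (CARD('n) - 1)"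
proof -
  define K where "K = real (P\<^sup>2 * (2 * P + 1)) ^ CARD('n)"
  define C where "C = (4::real) ^ (2 * CARD('n) + 1)"
  define x where "x = (\<lambda>(s :: 'n \<Rightarrow> nat) j. 2 ^ s j * U j)"
  \<comment> \<open>Any coordinate can be the one that is summed without a logarithm.\<close>
  obtain j0 :: 'n where True by simp
  define I where "I = UNIV - {j0}"
  have I: "finite I" "j0 \<notin> I" "insert j0 I = UNIV" "card I = CARD('n) - 1"
    by (auto simp: I_def)
  have "(\<Prod>j\<in>UNIV. U j) > 0" using U by (intro prod_pos) auto
  hence V0: "V > 0" using L by (simp add: V_def)
  have "norm2 M P (weight M m a U L) \<le> K * (\<Sum>s\<in>PiE UNIV (\<lambda>_. {..M}). norm2 M P (level_part M UNIV s (weight M m a U L)))"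
    unfolding K_def by (intro norm2_le_sum_levels M P weight_nonneg U)
  also have "\<dots> \<le> K * (\<Sum>s\<in>PiE UNIV (\<lambda>_. {..M}). C * (if V < (\<Prod>j\<in>UNIV. x s j)
      then (V / (\<Prod>j\<in>UNIV. x s j)) powr (2 / P) * (\<Prod>j\<in>UNIV. (min (x s j) 1)\<^sup>2) else 0))"
    unfolding C_def x_def V_def
    by (intro mult_left_mono sum_mono norm2_level_weight[OF gap M L P U]) (simp add: K_def)
  also have "\<dots> = K * C * (\<Sum>s\<in>PiE UNIV (\<lambda>_. {..M}). (if V < (\<Prod>j\<in>UNIV. x s j)
      then (V / (\<Prod>j\<in>UNIV. x s j)) powr (2 / P) * (\<Prod>j\<in>UNIV. (min (x s j) 1)\<^sup>2) else 0))"
    by (simp add: mult.assoc flip: sum_distrib_left)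
  also have "\<dots> \<le> K * C * ((2 / (2 / P) + 2) * exp (2 / P) * (4 / (2 / P)) ^ card I * ln V ^ card I)"
    using sum_dyadic_boxes[of I j0 U V "2 / P" M, unfolded I(3)] I U V V0 P
    unfolding x_def K_def C_def by (intro mult_left_mono) simp_all
  \<comment> \<open>With \<open>a = 2 / P\<close> the factors \<open>2 / a + 2\<close> and
    \<open>4 / a\<close> are \<open>P + 2\<close> and \<open>2 * P\<close>, and
    \<open>a \<le> 1\<close> gives \<open>exp a \<le> exp 1\<close>.\<close>
  also have "\<dots> \<le> K * C * ((real P + 2) * exp 1 * (2 * real P) ^ card I * ln V ^ card I)"
  proof (intro mult_left_mono mult_right_mono)
    show "(2 / (2 / P) + 2) * exp (2 / P) * (4 / (2 / P)) ^ card I \<le> (real P + 2) * exp 1 * (2 * real P) ^ card I"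
      using P by (intro mult_mono) auto
  qed (use V in \<open>auto simp: K_def C_def\<close>)
  finally show ?thesis by (simp add: K_def C_def I(4) mult_ac)
qed

section \<open>Tiling the unit cube\<close>

text \<open>A translate is integrable exactly when the function is, and the integral of a
  non-integrable function is 0 by default; this settles the equality also for non-measurable
  functions.\<close>

lemma lborel_integral_translate:
  fixes f :: "'a::euclidean_space \<Rightarrow> 'b::{banach, second_countable_topology}"
  shows "integral\<^sup>L lborel (\<lambda>x. f (x + c)) = integral\<^sup>L lborel f"
    and "integrable lborel (\<lambda>x. f (x + c)) \<longleftrightarrow> integrable lborel f"
proof -
  have m: "f \<in> borel_measurable borel \<longleftrightarrow> (\<lambda>x. f (x + c)) \<in> borel_measurable borel"
  proof
    assume "(\<lambda>x. f (x + c)) \<in> borel_measurable borel"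
    hence "(\<lambda>x. f (x + c)) \<circ> (\<lambda>x. x - c) \<in> borel_measurable borel"
      by (intro measurable_comp[of _ borel borel]) auto
    thus "f \<in> borel_measurable borel" by (simp add: o_def)
  next
    assume "f \<in> borel_measurable borel"
    thus "(\<lambda>x. f (x + c)) \<in> borel_measurable borel"
      by (rule measurable_compose[rotated]) auto
  qed
  have *: "integral\<^sup>L (distr lborel borel ((+) c)) f = integral\<^sup>L lborel (\<lambda>x. f (x + c))"
    if "f \<in> borel_measurable borel"
    using that by (subst integral_distr) (auto simp: add.commute)
  have **: "integrable (distr lborel borel ((+) c)) f \<longleftrightarrow> integrable lborel (\<lambda>x. f (x + c))"
    if "f \<in> borel_measurable borel"
    using that by (subst integrable_distr_eq) (auto simp: add.commute)
  show i: "integrable lborel (\<lambda>x. f (x + c)) \<longleftrightarrow> integrable lborel f"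
  proof (cases "f \<in> borel_measurable borel")
    case True thus ?thesis using ** unfolding lborel_distr_plus by simp
  next
    case False thus ?thesis using m borel_measurable_integrable[of lborel f]
        borel_measurable_integrable[of lborel "\<lambda>x. f (x + c)"] by auto
  qed
  show "integral\<^sup>L lborel (\<lambda>x. f (x + c)) = integral\<^sup>L lborel f"
  proof (cases "f \<in> borel_measurable borel")
    case True thus ?thesis using * unfolding lborel_distr_plus by simp
  next
    case False
    hence "\<not> integrable lborel f" using borel_measurable_integrable[of lborel f] by auto
    thus ?thesis using i by (simp add: not_integrable_integral_eq)
  qed
qed

text \<open>That \<open>A\<close> is the disjoint union of translates of \<open>B\<close> is
  expressed by an identity of indicators, which multiplies well over coordinates and turns directly
  into a sum of integrals.\<close>

lemma set_integral_tiles: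
  fixes f :: "'a::euclidean_space \<Rightarrow> 'b::{banach, second_countable_topology}"
  assumes I: "finite I" and B: "B \<in> sets borel"
    and tiles: "\<And>x. indicator A x = (\<Sum>i\<in>I. indicator B (x - \<tau> i) :: real)"
    and f: "set_integrable lborel A f"
  shows "set_integrable lborel B (\<lambda>x. \<Sum>i\<in>I. f (x + \<tau> i))"
    and "(LINT x:A|lborel. f x) = (LINT x:B|lborel. \<Sum>i\<in>I. f (x + \<tau> i))"
proof -
  \<comment> \<open>Each tile lies in \<open>A\<close>, because its indicator is one term of a sum
    of nonnegative terms with value \<open>indicator A x\<close>.\<close>
  have sub: "indicator B (x - \<tau> i) * indicator A x = (indicator B (x - \<tau> i) :: real)" if "i \<in> I" for i x
  proof -
    have "indicator B (x - \<tau> i) \<le> (indicator A x :: real)"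
      unfolding tiles using that I by (intro member_le_sum) auto
    thus ?thesis by (auto simp: indicator_def split: if_splits)
  qed
  have int: "integrable lborel (\<lambda>x. indicator B (x - \<tau> i) *\<^sub>R f x)" if "i \<in> I" for i
  proof -
    have "(\<lambda>x. x - \<tau> i) -` B \<in> sets borel"
      using measurable_sets_borel[of "\<lambda>x. x - \<tau> i" borel B] B by simp
    hence "integrable lborel (\<lambda>x. indicator ((\<lambda>x. x - \<tau> i) -` B) x *\<^sub>R (indicator A x *\<^sub>R f x))"
      by (intro integrable_mult_indicator f[unfolded set_integrable_def]) simp
    thus ?thesis using sub[OF that] by (simp add: indicator_vimage)
  qed
  have int': "integrable lborel (\<lambda>x. indicator B x *\<^sub>R f (x + \<tau> i))" if "i \<in> I" for i
    using int[OF that] lborel_integral_translate(2)[of "\<lambda>x. indicator B (x - \<tau> i) *\<^sub>R f x" "\<tau> i"] by simp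
  have eq: "indicator B x *\<^sub>R (\<Sum>i\<in>I. f (x + \<tau> i)) = (\<Sum>i\<in>I. indicator B x *\<^sub>R f (x + \<tau> i))" for x
    by (rule scaleR_right.sum)
  show "set_integrable lborel B (\<lambda>x. \<Sum>i\<in>I. f (x + \<tau> i))"
    unfolding set_integrable_def eq using int' by (intro Bochner_Integration.integrable_sum)
  have "(LINT x:A|lborel. f x) = (LINT x|lborel. (\<Sum>i\<in>I. indicator B (x - \<tau> i) *\<^sub>R f x))"
    unfolding set_lebesgue_integral_def tiles by (simp add: scaleR_left.sum)
  also have "\<dots> = (\<Sum>i\<in>I. LINT x|lborel. indicator B (x - \<tau> i) *\<^sub>R f x)"
    using int by (intro Bochner_Integration.integral_sum)
  also have "\<dots> = (\<Sum>i\<in>I. LINT x|lborel. indicator B x *\<^sub>R f (x + \<tau> i))"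
  proof (rule sum.cong[OF refl])
    fix i
    show "(LINT x|lborel. indicator B (x - \<tau> i) *\<^sub>R f x) = (LINT x|lborel. indicator B x *\<^sub>R f (x + \<tau> i))"
      using lborel_integral_translate(1)[of "\<lambda>x. indicator B (x - \<tau> i) *\<^sub>R f x" "\<tau> i"] by simp
  qed
  also have "\<dots> = (LINT x:B|lborel. \<Sum>i\<in>I. f (x + \<tau> i))"
    unfolding set_lebesgue_integral_def eq using int' by (intro Bochner_Integration.integral_sum[symmetric])
  finally show "(LINT x:A|lborel. f x) = (LINT x:B|lborel. \<Sum>i\<in>I. f (x + \<tau> i))" .
qed

text \<open>The only tile that can contain \<open>x\<close> is the one with index
  \<open>\<lfloor>(x - c) * M\<rfloor>\<close>, and this index lies in \<open>{0..<M}\<close>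
  exactly when \<open>x\<close> lies in the interval.\<close>

lemma interval_tiles:
  fixes c x :: real
  assumes "M > 0"
  shows "indicator {c..<c + 1} x = (\<Sum>n\<in>{0..<int M}. indicator {c..<c + 1 / real M} (x - of_int n / real M) :: real)"
proof -
  define l where "l = \<lfloor>(x - c) * real M\<rfloor>"
  have "x - of_int n / real M \<in> {c..<c + 1 / real M} \<longleftrightarrow> n = l" for n
  proof -
    have "n = l \<longleftrightarrow> of_int n \<le> (x - c) * real M \<and> (x - c) * real M < of_int n + 1"
      unfolding l_def by (subst eq_commute, rule floor_eq_iff)
    also have "\<dots> \<longleftrightarrow> x - of_int n / real M \<in> {c..<c + 1 / real M}"
    proof -
      have "x - of_int n / real M = (x * real M - of_int n) / real M" "c + 1 / real M = (c * real M + 1) / real M"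
        "c = c * real M / real M" using assms by (simp_all add: field_simps)
      hence "x - of_int n / real M \<in> {c..<c + 1 / real M} \<longleftrightarrow>
          c * real M \<le> x * real M - of_int n \<and> x * real M - of_int n < c * real M + 1"
        using assms by (metis (no_types, lifting) atLeastLessThan_iff divide_le_cancel divide_less_cancel
            not_less of_nat_0_less_iff)
      thus ?thesis by (auto simp: algebra_simps)
    qed
    finally show ?thesis ..
  qed
  hence "(\<Sum>n\<in>{0..<int M}. indicator {c..<c + 1 / real M} (x - of_int n / real M) :: real)
      = (\<Sum>n\<in>{0..<int M}. if n = l then 1 else 0)"
    by (intro sum.cong) (auto simp: indicator_def)
  also have "\<dots> = (if l \<in> {0..<int M} then 1 else 0)" by simp
  also have "l \<in> {0..<int M} \<longleftrightarrow> x \<in> {c..<c + 1}"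
    using assms by (auto simp: l_def floor_less_iff le_floor_iff zero_le_mult_iff mult_less_cancel_right1)
  finally show ?thesis by (simp add: indicator_def)
qed

definition small_cube :: "nat \<Rightarrow> (real ^ 'n) set" where
  "small_cube M = {x. \<forall>j. 0 \<le> x $ j \<and> x $ j < 1 / real M}"

definition grid_point :: "nat \<Rightarrow> ('n \<Rightarrow> int) \<Rightarrow> real ^ 'n" where
  "grid_point M n = (\<chi> j. of_int (n j) / real M)"

lemma borel_vec_nth [measurable]: "(\<lambda>x::real ^ 'n. x $ j) \<in> borel_measurable borel"
  by (intro borel_measurable_continuous_onI continuous_intros)

lemma sets_small_cube [measurable]: "small_cube M \<in> sets borel"
  unfolding small_cube_def by measurable

lemma sets_unit_cube [measurable]: "unit_cube \<in> sets borel"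
  unfolding unit_cube_def by measurable

lemma unit_cube_tiles:
  fixes x :: "real ^ 'n"
  assumes "M > 0"
  shows "indicator unit_cube x = (\<Sum>n\<in>grid M. indicator (small_cube M) (x - grid_point M n) :: real)"
proof -
  have p: "indicator {x::real^'n. \<forall>j. x $ j \<in> A j} x = (\<Prod>j\<in>UNIV. indicator (A j) (x $ j) :: real)" for A x
    by (auto simp: indicator_def intro!: prod_zero[symmetric])
  have "indicator unit_cube x = (\<Prod>j\<in>UNIV. indicator {0..<0 + 1} (x $ j) :: real)"
    using p[of "\<lambda>_. {0..<1}" x] by (simp add: unit_cube_def)
  also have "\<dots> = (\<Prod>j\<in>UNIV. \<Sum>n\<in>{0..<int M}. indicator {0..<0 + 1 / real M} (x $ j - of_int n / real M))"
    unfolding interval_tiles[OF assms, of 0] ..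
  also have "\<dots> = (\<Sum>n\<in>grid M. \<Prod>j\<in>UNIV. indicator {0..<0 + 1 / real M} (x $ j - of_int (n j) / real M))"
    by (rule sum_grid_prod[symmetric])
  also have "\<dots> = (\<Sum>n\<in>grid M. indicator (small_cube M) (x - grid_point M n))"
    using p[of "\<lambda>_. {0..<1 / real M}"] by (simp add: small_cube_def grid_point_def)
  finally show ?thesis .
qed

lemma measure_half_open_box:
  fixes a b :: "real ^ 'n"
  assumes "\<And>j. a $ j \<le> b $ j"
  shows "emeasure lborel {x. \<forall>j. a $ j \<le> x $ j \<and> x $ j < b $ j} = ennreal (\<Prod>j\<in>UNIV. b $ j - a $ j)"
proof (rule antisym)
  let ?H = "{x. \<forall>j. a $ j \<le> x $ j \<and> x $ j < b $ j}"
  have H: "?H \<in> sets borel" by measurable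
  have "box a b \<subseteq> ?H" "?H \<subseteq> cbox a b" by (auto simp: mem_box_cart less_imp_le)
  hence "emeasure lborel (box a b) \<le> emeasure lborel ?H" "emeasure lborel ?H \<le> emeasure lborel (cbox a b)"
    using H by (auto intro!: emeasure_mono)
  moreover have "emeasure lborel (cbox a b) = ennreal (\<Prod>j\<in>UNIV. b $ j - a $ j)"
  proof -
    have "emeasure lborel (cbox a b) = ennreal (measure lborel (cbox a b))"
      using emeasure_bounded_finite[OF bounded_cbox[of a b]] by (intro emeasure_eq_ennreal_measure) auto
    moreover have "cbox a b \<noteq> {}" using assms by (auto simp: interval_eq_empty_cart not_less)
    ultimately show ?thesis by (simp add: content_cbox_cart)
  qed
  moreover have "emeasure lborel (box a b) = emeasure lborel (cbox a b)"
    by (simp add: emeasure_lborel_box_eq emeasure_lborel_cbox_eq)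
  ultimately show "emeasure lborel ?H \<le> ennreal (\<Prod>j\<in>UNIV. b $ j - a $ j)"
    "ennreal (\<Prod>j\<in>UNIV. b $ j - a $ j) \<le> emeasure lborel ?H" by simp_all
qed

lemma emeasure_unit_cube: "emeasure lborel (unit_cube :: (real ^ 'n) set) = 1"
  using measure_half_open_box[of "0 :: real ^ 'n" 1] by (simp add: unit_cube_def)

lemma set_integrable_unit_cube:
  fixes f :: "real ^ 'n \<Rightarrow> 'b::{banach, second_countable_topology}"
  assumes "f \<in> borel_measurable borel" "\<And>x. norm (f x) \<le> B"
  shows "set_integrable lborel unit_cube f"
  unfolding set_integrable_def
  by (rule integrableI_bounded_set_indicator[of _ _ _ B])
     (use assms in \<open>auto simp: emeasure_unit_cube\<close>)

text \<open>Transfers a bound that is uniform over all translates of the grid to the integral, with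
  no discretisation error: integrating over the cube is averaging over the grid and then over one
  cell.\<close>

lemma unit_cube_integral_le:
  fixes f :: "real ^ 'n \<Rightarrow> real"
  assumes M: "M > 0" and f: "set_integrable lborel unit_cube f"
    and le: "\<And>z. (\<Sum>n\<in>grid M. f (z + grid_point M n)) / real M ^ CARD('n) \<le> B"
  shows "(LINT z:unit_cube|lborel. f z) \<le> B"
proof -
  define D where "D = real M ^ CARD('n)"
  have D: "D > 0" using M by (simp add: D_def)
  have int1: "set_integrable lborel unit_cube (\<lambda>_ :: real ^ 'n. 1 :: real)"
    by (rule set_integrable_unit_cube[of _ 1]) auto
  \<comment> \<open>Tiling the constant 1 yields the volume of the small cube, without computing it
    as a product.\<close>
  have fin: "set_integrable lborel (small_cube M :: (real ^ 'n) set) (\<lambda>_. D)"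
    and one: "(LINT z:(small_cube M :: (real ^ 'n) set)|lborel. D) = (LINT z:(unit_cube :: (real ^ 'n) set)|lborel. 1)"
    using set_integral_tiles[OF finite_grid sets_small_cube unit_cube_tiles[OF M] int1]
    by (simp_all only: sum_constant card_grid D_def of_nat_power mult_1_right)
  have "(LINT z:unit_cube|lborel. f z) = (LINT z:small_cube M|lborel. \<Sum>n\<in>grid M. f (z + grid_point M n))"
    by (rule set_integral_tiles(2)[OF finite_grid sets_small_cube unit_cube_tiles[OF M] f])
  also have "\<dots> \<le> (LINT z:(small_cube M :: (real ^ 'n) set)|lborel. D * B)"
  proof (rule set_integral_mono)
    show "set_integrable lborel (small_cube M) (\<lambda>z. \<Sum>n\<in>grid M. f (z + grid_point M n))"
      by (rule set_integral_tiles(1)[OF finite_grid sets_small_cube unit_cube_tiles[OF M] f])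
    show "set_integrable lborel (small_cube M :: (real ^ 'n) set) (\<lambda>_. D * B)"
      using fin by (rule set_integrable_mult_left)
    show "(\<Sum>n\<in>grid M. f (z + grid_point M n)) \<le> D * B" for z
      using le[of z] D by (simp add: divide_le_eq mult.commute flip: D_def)
  qed
  also have "\<dots> = (LINT z:(small_cube M :: (real ^ 'n) set)|lborel. D) * B" by (rule set_integral_mult_left)
  also have "\<dots> = B" unfolding one
    using emeasure_unit_cube[where 'n = 'n] by (simp add: set_lebesgue_integral_def measure_def)
  finally show ?thesis .
qed

section \<open>Periodic hat functions and their discrete Fourier coefficients\<close>

text \<open>The representative modulo one in \<open>{-1/2..<1/2}\<close>, the period that contains
  the support of a hat of total width at most 1.\<close>

definition centred :: "real \<Rightarrow> real" where
  "centred x = frac (x + 1 / 2) - 1 / 2"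

lemma centred_ge: "- 1 / 2 \<le> centred x" and centred_less: "centred x < 1 / 2"
  using frac_ge_0[of "x + 1 / 2"] frac_lt_1[of "x + 1 / 2"] by (simp_all add: centred_def)

lemma centred_eq_diff: "centred x = x - of_int \<lfloor>x + 1 / 2\<rfloor>"
  by (simp add: centred_def frac_def)

lemma centred_add_int: "centred (x + of_int l) = centred x"
proof -
  have "\<lfloor>x + of_int l + 1 / 2\<rfloor> = \<lfloor>x + 1 / 2\<rfloor> + l"
    using floor_add_int[of "x + 1 / 2" l] by (simp add: algebra_simps)
  thus ?thesis by (simp add: centred_eq_diff)
qed

lemma centred_unique: "- 1 / 2 \<le> x + of_int l \<Longrightarrow> x + of_int l < 1 / 2 \<Longrightarrow> centred x = x + of_int l"
proof -
  assume "- 1 / 2 \<le> x + of_int l" "x + of_int l < 1 / 2"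
  hence "\<lfloor>x + 1 / 2\<rfloor> = - l" by (simp add: floor_eq_iff)
  thus ?thesis by (simp add: centred_eq_diff)
qed

lemma centred_measurable [measurable]: "centred \<in> borel_measurable borel"
  unfolding centred_eq_diff[abs_def] by measurable

lemma hat_1_eq: "hat (Suc 0) u x = (if - u / 2 \<le> x \<and> x < u / 2 then 1 else 0)"
  by (simp add: indicator_def)

declare hat.simps [simp del]

lemma hat_measurable [measurable]: "hat (Suc r) u \<in> borel_measurable borel"
proof (induction r)
  case 0
  show ?case by (simp add: hat.simps)
next
  case (Suc r)
  have [measurable]: "hat (Suc 0) u \<in> borel_measurable borel" by (simp add: hat.simps)
  note Suc [measurable]
  show ?case unfolding hat.simps convol_def[abs_def] by measurable
qed

lemma hat_nonneg: "0 \<le> hat (Suc r) u x"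
proof (induction r arbitrary: x)
  case (Suc r)
  thus ?case by (auto simp: hat.simps(2) convol_def hat_1_eq intro!: Bochner_Integration.integral_nonneg)
qed (simp add: hat_1_eq)

lemma hat_le_1:
  assumes "0 < u" "u \<le> 1"
  shows "hat (Suc r) u x \<le> 1"
proof (induction r arbitrary: x)
  case (Suc r)
  have "hat (Suc (Suc r)) u x = (LINT y|lborel. hat (Suc r) u y * hat (Suc 0) u (x - y))"
    by (simp add: hat.simps(2) convol_def)
  also have "\<dots> \<le> (LINT y|lborel. indicator {x - u / 2..x + u / 2} y)"
  proof (rule integral_mono')
    show "hat (Suc r) u y * hat (Suc 0) u (x - y) \<le> indicator {x - u / 2..x + u / 2} y" for y
      using Suc[of y] by (auto simp: hat_1_eq indicator_def)
  qed (auto simp: emeasure_lborel_Icc_eq)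
  also have "\<dots> = u" using assms by simp
  finally show ?case using assms by simp
qed (simp add: hat_1_eq)

text \<open>The half-open form survives convolution, since a weak and a strict bound add up on each
  side as needed. It matters for boxes of side exactly 1, whose integer translates then do not
  overlap.\<close>

lemma hat_support:
  assumes "u > 0" "hat (Suc r) u x \<noteq> 0"
  shows "- (real (Suc r) * u / 2) \<le> x \<and> x < real (Suc r) * u / 2"
  using assms(2)
proof (induction r arbitrary: x)
  case (Suc r)
  have "\<exists>y. hat (Suc r) u y * hat (Suc 0) u (x - y) \<noteq> 0"
  proof (rule ccontr)
    assume "\<not> ?thesis"
    hence "hat (Suc r) u y * hat (Suc 0) u (x - y) = 0" for y by blast
    thus False using Suc.prems by (simp only: hat.simps(2) convol_def integral_zero)
  qed
  then obtain y where "hat (Suc r) u y \<noteq> 0" "hat (Suc 0) u (x - y) \<noteq> 0" by auto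
  thus ?case using Suc.IH[of y] by (auto simp: hat_1_eq field_simps split: if_splits)
qed (simp add: hat_1_eq split: if_splits)

text \<open>For orders \<open>r \<ge> 1\<close> with \<open>r * u \<le> 1\<close> at most one
  integer shift of a point meets the support, so this closed form replaces the infinite sum of the
  periodization; see \<open>periodic_box_hat_eq_prod\<close>.\<close>

definition periodic_hat :: "nat \<Rightarrow> real \<Rightarrow> real \<Rightarrow> real" where
  "periodic_hat r u x = hat r u (centred x)"

lemma periodic_hat_add_int: "periodic_hat r u (x + of_int l) = periodic_hat r u x"
  by (simp add: periodic_hat_def centred_add_int)

lemma periodic_hat_measurable [measurable]: "periodic_hat (Suc r) u \<in> borel_measurable borel"
  unfolding periodic_hat_def[abs_def] by measurable

lemma periodic_hat_bounds:
  assumes "0 < u" "u \<le> 1"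
  shows "0 \<le> periodic_hat (Suc r) u x" "periodic_hat (Suc r) u x \<le> 1"
  using hat_nonneg hat_le_1[OF assms] by (simp_all add: periodic_hat_def)

text \<open>Because the support of \<open>hat (Suc (Suc r)) u\<close> has length at most one, convolution on the line and
  on the circle agree.\<close>

lemma periodic_hat_convolution:
  assumes u: "u > 0" "real (Suc (Suc r)) * u \<le> 1"
  shows "periodic_hat (Suc (Suc r)) u y =
    (LINT t:{-1/2..<1/2}|lborel. periodic_hat (Suc r) u t * periodic_hat (Suc 0) u (y - t))"
proof -
  define x where "x = centred y"
  have x: "- 1 / 2 \<le> x" "x < 1 / 2" using centred_ge centred_less by (simp_all add: x_def)
  define \<rho> where "\<rho> = real (Suc r) * u / 2"
  have \<rho>: "\<rho> + u / 2 \<le> 1 / 2" using u(2) by (simp add: \<rho>_def field_simps)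
  have "hat (Suc r) u t * hat (Suc 0) u (x - t) =
     indicator {-1/2..<1/2} t *\<^sub>R (periodic_hat (Suc r) u t * periodic_hat (Suc 0) u (y - t))" for t
  proof (cases "- \<rho> \<le> t \<and> t < \<rho>")
    case False
    hence z: "hat (Suc r) u t = 0" using hat_support[OF u(1), of r t] by (auto simp: \<rho>_def)
    have "periodic_hat (Suc r) u t = 0" if "- 1 / 2 \<le> t" "t < 1 / 2"
      using centred_unique[of t 0] that z by (simp add: periodic_hat_def)
    thus ?thesis using z by (auto simp: indicator_def)
  next
    case True
    hence t: "- 1 / 2 \<le> t" "t < 1 / 2" using \<rho> u(1) by linarith+
    have ct: "centred t = t" using centred_unique[of t 0] t by simp
    have cyt: "centred (y - t) = centred (x - t)"
      using centred_add_int[of "x - t" "\<lfloor>y + 1 / 2\<rfloor>"] by (simp add: x_def centred_eq_diff[of y] algebra_simps)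
    \<comment> \<open>If \<open>x - t\<close> leaves the period, both sides vanish: the wrapped
      difference is at least \<open>1 / 2 - \<rho> \<ge> u / 2\<close> away from 0, apart from the
      endpoint that the half-open indicator excludes.\<close>
    have "hat (Suc 0) u (x - t) = hat (Suc 0) u (centred (x - t))"
    proof -
      consider "- 1 / 2 \<le> x - t" "x - t < 1 / 2" | "x - t < - 1 / 2" | "1 / 2 \<le> x - t" by linarith
      thus ?thesis
      proof cases
        case 1
        thus ?thesis using centred_unique[of "x - t" 0] by simp
      next
        case 2
        hence "centred (x - t) = x - t + 1" using centred_unique[of "x - t" 1] x t by simp
        thus ?thesis using 2 x True \<rho> u by (simp add: hat_1_eq)
      next
        case 3
        hence "centred (x - t) = x - t - 1" using centred_unique[of "x - t" "-1"] x t by simp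
        thus ?thesis using 3 x True \<rho> u by (simp add: hat_1_eq)
      qed
    qed
    thus ?thesis using t by (simp add: periodic_hat_def ct cyt)
  qed
  thus ?thesis
    by (simp add: periodic_hat_def[of "Suc (Suc r)"] x_def[symmetric] hat.simps(2) convol_def set_lebesgue_integral_def)
qed

section \<open>Discrete Fourier coefficients on shifted grids\<close>

definition dft :: "nat \<Rightarrow> (real \<Rightarrow> real) \<Rightarrow> real \<Rightarrow> int \<Rightarrow> complex" where
  "dft M q y k = (\<Sum>n\<in>{0..<int M}. of_real (q (y + of_int n / real M)) *
      cis (2 * pi * of_int (- (k * n)) / real M)) / of_nat M"

lemma dft_measurable [measurable]:
  assumes [measurable]: "q \<in> borel_measurable borel"
  shows "(\<lambda>y. dft M q y k) \<in> borel_measurable borel"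
  unfolding dft_def by measurable

lemma sum_residues_shift:
  fixes f :: "int \<Rightarrow> 'a::comm_monoid_add"
  assumes "M > 0" "\<And>x y. int M dvd x - y \<Longrightarrow> f x = f y"
  shows "(\<Sum>n\<in>{0..<int M}. f (n + l)) = (\<Sum>n\<in>{0..<int M}. f n)"
proof (rule sum.reindex_bij_witness[of _ "\<lambda>n. (n - l) mod int M" "\<lambda>n. (n + l) mod int M"])
  fix n assume "n \<in> {0..<int M}"
  thus "((n + l) mod int M - l) mod int M = n" "((n - l) mod int M + l) mod int M = n"
    by (simp_all add: mod_simps)
  show "f ((n + l) mod int M) = f (n + l)"
    by (intro assms(2)) (simp flip: mod_eq_dvd_iff)
qed (use assms(1) in auto)

lemma periodic_cong:
  fixes q :: "real \<Rightarrow> 'a"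
  assumes "M > 0" "\<And>x l. q (x + of_int l) = q x" "int M dvd x - y"
  shows "q (c + of_int x / real M) = q (c + of_int y / real M)"
proof -
  obtain l where "x - y = int M * l" using assms(3) by auto
  hence "x = y + int M * l" by simp
  hence "c + of_int x / real M = (c + of_int y / real M) + of_int l"
    using assms(1) by (simp add: field_simps)
  thus ?thesis by (simp only: assms(2))
qed

text \<open>The offset \<open>y\<close> is carried along because the estimates must hold on every
  translate of the grid. By this lemma only its position inside one cell affects the modulus of a
  coefficient.\<close>

lemma dft_shift:
  assumes M: "M > 0" and q: "\<And>x l. q (x + of_int l) = q x"
  shows "dft M q (y + of_int l / real M) k = cis (2 * pi * of_int (k * l) / real M) * dft M q y k"
proof -
  define f where "f n = of_real (q (y + of_int n / real M)) * cis (2 * pi * of_int (- (k * (n - l))) / real M)"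
    for n :: int
  have "f x = f x'" if d: "int M dvd x - x'" for x x'
  proof -
    have "int M dvd - (k * (x - l)) - - (k * (x' - l))"
    proof -
      have "- (k * (x - l)) - - (k * (x' - l)) = (- k) * (x - x')" by (simp add: algebra_simps)
      thus ?thesis using d by simp
    qed
    thus ?thesis unfolding f_def
      using periodic_cong[of M q x x' y, OF M q d] cis_int_multiple_eq[OF M] by metis
  qed
  hence "(\<Sum>n\<in>{0..<int M}. f (n + l)) = (\<Sum>n\<in>{0..<int M}. f n)"
    by (rule sum_residues_shift[OF M])
  moreover have "f (n + l) = of_real (q (y + of_int l / real M + of_int n / real M)) *
      cis (2 * pi * of_int (- (k * n)) / real M)" for n
    by (simp add: f_def add_divide_distrib add_ac)
  moreover have "f n = cis (2 * pi * of_int (k * l) / real M) *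
      (of_real (q (y + of_int n / real M)) * cis (2 * pi * of_int (- (k * n)) / real M))" for n
  proof -
    have "2 * pi * of_int (- (k * (n - l))) / real M =
       2 * pi * of_int (k * l) / real M + 2 * pi * of_int (- (k * n)) / real M"
      by (simp add: algebra_simps diff_divide_distrib)
    thus ?thesis unfolding f_def by (simp add: cis_mult[symmetric] mult_ac del: of_int_minus of_int_mult)
  qed
  ultimately show ?thesis
    unfolding dft_def by (simp add: sum_distrib_left)
qed

lemma dft_inversion:
  assumes M: "M > 0" and q: "\<And>x l. q (x + of_int l) = q x"
  shows "of_real (q (y + of_int x / real M)) =
    (\<Sum>k\<in>{0..<int M}. dft M q y k * cis (2 * pi * of_int (k * x) / real M))"
proof -
  have "(\<Sum>k\<in>{0..<int M}. dft M q y k * cis (2 * pi * of_int (k * x) / real M))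
    = (\<Sum>k\<in>{0..<int M}. \<Sum>n\<in>{0..<int M}. of_real (q (y + of_int n / real M)) / of_nat M *
          cis (2 * pi * of_int ((x - n) * k) / real M))"
  proof (rule sum.cong[OF refl])
    fix k
    have "cis (2 * pi * of_int (- (k * n)) / real M) * cis (2 * pi * of_int (k * x) / real M)
        = cis (2 * pi * of_int ((x - n) * k) / real M)" for n
      by (simp add: cis_mult algebra_simps add_divide_distrib diff_divide_distrib)
    thus "dft M q y k * cis (2 * pi * of_int (k * x) / real M) =
      (\<Sum>n\<in>{0..<int M}. of_real (q (y + of_int n / real M)) / of_nat M *
          cis (2 * pi * of_int ((x - n) * k) / real M))"
      unfolding dft_def by (simp add: sum_distrib_right sum_divide_distrib mult.assoc del: of_int_mult of_int_minus)
  qed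
  also have "\<dots> = (\<Sum>n\<in>{0..<int M}. of_real (q (y + of_int n / real M)) / of_nat M *
          (if int M dvd x - n then of_nat M else 0))"
    by (subst sum.swap) (simp only: sum_distrib_left[symmetric] sum_roots_of_unity[OF M])
  also have "\<dots> = (\<Sum>n\<in>{0..<int M}. if n = x mod int M then of_real (q (y + of_int x / real M)) else 0)"
  proof (rule sum.cong[OF refl])
    fix n assume n: "n \<in> {0..<int M}"
    have "int M dvd x - n \<longleftrightarrow> n = x mod int M"
      using n by (auto simp flip: mod_eq_dvd_iff)
    moreover have "q (y + of_int n / real M) = q (y + of_int x / real M)" if "int M dvd x - n"
      using periodic_cong[of M q x n y, OF M q that] by simp
    ultimately show "of_real (q (y + of_int n / real M)) / of_nat M * (if int M dvd x - n then of_nat M else 0)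
        = (if n = x mod int M then of_real (q (y + of_int x / real M)) else (0::complex))"
      using M by auto
  qed
  also have "\<dots> = of_real (q (y + of_int x / real M))" using M by simp
  finally show ?thesis ..
qed

text \<open>Sampling does not turn the convolution into a plain product of coefficients. Cutting the
  circle into \<open>M\<close> cells and collecting the phases of \<open>dft_shift\<close> gives
  instead the average of the products over all offsets \<open>t\<close> in one cell. Bounds that are
  uniform in the offset therefore multiply from one order to the next.\<close>

lemma dft_periodic_hat_Suc:
  assumes M: "M > 0" and u: "u > 0" "real (Suc (Suc r)) * u \<le> 1"
  shows "dft M (periodic_hat (Suc (Suc r)) u) y k = of_nat M *
    (LINT t:{-1/2..<-1/2 + 1 / real M}|lborel.
       dft M (periodic_hat (Suc r) u) t k * dft M (periodic_hat (Suc 0) u) (y - t) k)"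
proof -
  define q where "q = periodic_hat (Suc r) u"
  define p where "p = periodic_hat (Suc 0) u"
  have [measurable]: "q \<in> borel_measurable borel" "p \<in> borel_measurable borel"
    by (simp_all add: q_def p_def)
  have "real 1 * u \<le> real (Suc (Suc r)) * u" using u(1) by (intro mult_right_mono) auto
  hence u1: "u \<le> 1" using u(2) by simp
  have bq: "0 \<le> q t" "q t \<le> 1" "0 \<le> p t" "p t \<le> 1" for t
    using periodic_hat_bounds[OF u(1) u1] by (simp_all add: q_def p_def)
  let ?C = "{-1/2..<1/2} :: real set"
  have bnd: "set_integrable lborel ?C f" if "f \<in> borel_measurable borel" "\<And>x. norm (f x) \<le> 1"
    for f :: "real \<Rightarrow> complex"
    unfolding set_integrable_def
    by (rule integrableI_bounded_set_indicator[of _ _ _ 1]) (use that in auto)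
  define g where "g n t = of_real (q t * p (y + of_int n / real M - t)) * cis (2 * pi * of_int (- (k * n)) / real M) / of_nat M"
    for n t
  have gi: "set_integrable lborel ?C (g n)" for n
  proof (rule bnd)
    show "g n \<in> borel_measurable borel" unfolding g_def by measurable
    fix x
    have "q x * p (y + of_int n / real M - x) \<le> 1 * 1" using bq by (intro mult_mono) auto
    hence "norm (g n x) \<le> 1 / real M" using bq by (simp add: g_def norm_mult norm_divide divide_right_mono)
    also have "\<dots> \<le> 1" using M by simp
    finally show "norm (g n x) \<le> 1" .
  qed
  define f where "f t = of_real (q t) * dft M p (y - t) k" for t
  have fg: "f t = (\<Sum>n\<in>{0..<int M}. g n t)" for t
    unfolding f_def dft_def g_def
    by (simp add: sum_divide_distrib sum_distrib_left mult.assoc algebra_simps del: of_int_minus of_int_mult)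
  have fi: "set_integrable lborel ?C f"
    using gi unfolding set_integrable_def fg scaleR_right.sum by (intro Bochner_Integration.integrable_sum)
  have "dft M (periodic_hat (Suc (Suc r)) u) y k = (\<Sum>n\<in>{0..<int M}. LINT t:?C|lborel. g n t)"
  proof -
    have "of_real (periodic_hat (Suc (Suc r)) u (y + of_int n / real M)) * cis (2 * pi * of_int (- (k * n)) / real M) / of_nat M
        = (LINT t:?C|lborel. g n t)" for n
      unfolding periodic_hat_convolution[OF u] set_integral_complex_of_real[symmetric] g_def q_def p_def
      by (simp only: set_integral_mult_left set_integral_divide_zero)
    thus ?thesis unfolding dft_def by (simp add: sum_divide_distrib del: of_int_minus of_int_mult)
  qed
  also have "\<dots> = (LINT t:?C|lborel. f t)"
    using gi unfolding set_integrable_def set_lebesgue_integral_def fg scaleR_right.sum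
    by (intro Bochner_Integration.integral_sum[symmetric])
  also have "\<dots> = (LINT t:{-1/2..<-1/2 + 1 / real M}|lborel. \<Sum>n\<in>{0..<int M}. f (t + of_int n / real M))"
    using interval_tiles[OF M, of "-1/2"] fi by (intro set_integral_tiles(2)) auto
  also have "(\<lambda>t. \<Sum>n\<in>{0..<int M}. f (t + of_int n / real M)) = (\<lambda>t. of_nat M * (dft M q t k * dft M p (y - t) k))"
  proof
    fix t
    have "f (t + of_int n / real M) = of_real (q (t + of_int n / real M)) *
       cis (2 * pi * of_int (- (k * n)) / real M) * dft M p (y - t) k" for n
    proof -
      have "y - (t + of_int n / real M) = (y - t) + of_int (- n) / real M" by simp
      hence "dft M p (y - (t + of_int n / real M)) k = cis (2 * pi * of_int (k * (- n)) / real M) * dft M p (y - t) k"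
        by (simp only:) (rule dft_shift[OF M], simp add: p_def periodic_hat_add_int)
      thus ?thesis by (simp add: f_def mult_ac)
    qed
    thus "(\<Sum>n\<in>{0..<int M}. f (t + of_int n / real M)) = of_nat M * (dft M q t k * dft M p (y - t) k)"
      using M by (simp add: dft_def[of M q] sum_distrib_right)
  qed
  also have "(LINT t:{-1/2..<-1/2 + 1 / real M}|lborel. of_nat M * (dft M q t k * dft M p (y - t) k))
     = of_nat M * (LINT t:{-1/2..<-1/2 + 1 / real M}|lborel. dft M q t k * dft M p (y - t) k)"
    by (rule set_integral_mult_right)
  finally show ?thesis by (simp add: q_def p_def)
qed

lemma norm_set_integral_le:
  fixes f :: "real \<Rightarrow> complex"
  assumes "a \<le> b" "\<And>t. norm (f t) \<le> K"
  shows "norm (LINT t:{a..<b}|lborel. f t) \<le> K * (b - a)"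
proof -
  have K: "K \<ge> 0" using assms(2)[of 0] norm_ge_zero order_trans by blast
  have "norm (LINT t:{a..<b}|lborel. f t) \<le> (LINT t|lborel. norm (indicator {a..<b} t *\<^sub>R f t))"
    unfolding set_lebesgue_integral_def by (rule integral_norm_bound)
  also have "\<dots> \<le> (LINT t|lborel. K * indicator {a..<b} t)"
  proof (rule integral_mono')
    show "integrable lborel (\<lambda>t. K * indicator {a..<b} t)" using assms(1) by simp
    show "norm (indicator {a..<b} t *\<^sub>R f t) \<le> K * indicator {a..<b} t" for t
      using assms(2)[of t] by (simp add: indicator_def)
  qed (use K in auto)
  also have "\<dots> = K * (b - a)" using assms(1) by simp
  finally show ?thesis .
qed

text \<open>The samples in an interval have consecutive indices, and their number differs from
  \<open>u * M\<close> by at most 1; the coefficient is thus a geometric sum up to a phase.\<close>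

lemma dft_indicator:
  assumes M: "M > 0" and u: "u > 0" "u \<le> 1"
  shows "\<exists>p p' l. p \<le> p' \<and> p' - p \<le> int M \<and> \<bar>of_int (p' - p) - u * real M\<bar> \<le> 1 \<and>
    dft M (periodic_hat (Suc 0) u) y k = cis (2 * pi * of_int (k * l) / real M) *
      ((\<Sum>n\<in>{p..<p'}. cis (2 * pi * of_int (- (k * n)) / real M)) / of_nat M)"
proof -
  \<comment> \<open>Moves the offset into the first cell of \<open>{-1/2..<1/2}\<close>; then the
    \<open>M\<close> samples are their own centred representatives and the interval is not wrapped
    around.\<close>
  define l where "l = \<lfloor>(y + 1 / 2) * real M\<rfloor>"
  define y' where "y' = y - of_int l / real M"
  have y': "- 1 / 2 \<le> y'" "(y' + 1 / 2) * real M < 1"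
  proof -
    have "of_int l \<le> (y + 1 / 2) * real M" "(y + 1 / 2) * real M < of_int l + 1"
      by (simp_all add: l_def)
    moreover have "(y' + 1 / 2) * real M = (y + 1 / 2) * real M - of_int l"
      using M by (simp add: y'_def field_simps)
    ultimately have "0 \<le> (y' + 1 / 2) * real M" "(y' + 1 / 2) * real M < 1" by simp_all
    thus "(y' + 1 / 2) * real M < 1" "- 1 / 2 \<le> y'" using M by (simp_all add: zero_le_mult_iff)
  qed
  define s where "s = (- u / 2 - y') * real M"
  define s' where "s' = (u / 2 - y') * real M"
  define p where "p = \<lceil>s\<rceil>"
  define p' where "p' = \<lceil>s'\<rceil>"
  have p_iff: "n \<in> {p..<p'} \<longleftrightarrow> - u / 2 \<le> y' + of_int n / real M \<and> y' + of_int n / real M < u / 2" for n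
  proof -
    have "n \<in> {p..<p'} \<longleftrightarrow> (- u / 2 - y') * real M \<le> of_int n \<and> of_int n < (u / 2 - y') * real M"
      by (simp add: p_def p'_def s_def s'_def ceiling_le_iff less_ceiling_iff)
    also have "\<dots> \<longleftrightarrow> - u / 2 - y' \<le> of_int n / real M \<and> of_int n / real M < u / 2 - y'"
      using M by (simp add: pos_le_divide_eq pos_divide_less_eq)
    finally show ?thesis by (simp add: algebra_simps)
  qed
  have "p \<le> p'" unfolding p_def p'_def s_def s'_def using u by (intro ceiling_mono mult_right_mono) auto
  have uM: "u * real M = s' - s" by (simp add: s_def s'_def algebra_simps)
  have "s \<le> of_int p" "of_int p < s + 1" "s' \<le> of_int p'" "of_int p' < s' + 1"
    unfolding p_def p'_def by linarith+
  hence "\<bar>of_int (p' - p) - u * real M\<bar> \<le> 1" unfolding uM by simp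
  have "p \<ge> 0"
  proof -
    have "0 * real M \<le> (1 / 2 - u / 2) * real M" using u by (intro mult_right_mono) auto
    hence "- 1 < s" unfolding s_def using y'(2) by (simp add: algebra_simps)
    also have "\<dots> \<le> of_int p" by (simp add: p_def)
    finally show ?thesis by simp
  qed
  have "p' \<le> int M"
  proof -
    have "s' \<le> 1 * real M" unfolding s'_def using u y' by (intro mult_right_mono) linarith+
    thus ?thesis by (simp add: p'_def ceiling_le_iff)
  qed
  have "dft M (periodic_hat (Suc 0) u) y' k = (\<Sum>n\<in>{p..<p'}. cis (2 * pi * of_int (- (k * n)) / real M)) / of_nat M"
  proof -
    have "(\<Sum>n\<in>{0..<int M}. of_real (periodic_hat (Suc 0) u (y' + of_int n / real M)) * cis (2 * pi * of_int (- (k * n)) / real M))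
      = (\<Sum>n\<in>{0..<int M}. if n \<in> {p..<p'} then cis (2 * pi * of_int (- (k * n)) / real M) else 0)"
    proof (rule sum.cong[OF refl])
      fix n assume n: "n \<in> {0..<int M}"
      have "real_of_int n \<le> real_of_int (int M - 1)" using n by (subst of_int_le_iff) simp
      hence "real_of_int n \<le> real M - 1" by simp
      hence "(y' + of_int n / real M) * real M < 1 / 2 * real M"
        using y'(2) M by (simp add: algebra_simps)
      hence "y' + of_int n / real M < 1 / 2" using M by (simp only: mult_less_cancel_right_pos of_nat_0_less_iff)
      moreover have "- 1 / 2 \<le> y' + of_int n / real M" 
      proof -
        have "0 \<le> of_int n / real M" using n by simp
        thus ?thesis using y'(1) by linarith
      qed
      ultimately have "centred (y' + of_int n / real M) = y' + of_int n / real M"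
        using centred_unique[of "y' + of_int n / real M" 0] by simp
      thus "of_real (periodic_hat (Suc 0) u (y' + of_int n / real M)) * cis (2 * pi * of_int (- (k * n)) / real M)
        = (if n \<in> {p..<p'} then cis (2 * pi * of_int (- (k * n)) / real M) else 0)"
        using p_iff[of n] by (simp add: periodic_hat_def hat_1_eq)
    qed
    also have "\<dots> = (\<Sum>n\<in>{0..<int M} \<inter> {p..<p'}. cis (2 * pi * of_int (- (k * n)) / real M))"
      by (rule sum.inter_restrict[symmetric]) simp
    also have "{0..<int M} \<inter> {p..<p'} = {p..<p'}" using \<open>p \<ge> 0\<close> \<open>p' \<le> int M\<close> by auto
    finally show ?thesis by (simp add: dft_def)
  qed
  moreover have "dft M (periodic_hat (Suc 0) u) y k =
      cis (2 * pi * of_int (k * l) / real M) * dft M (periodic_hat (Suc 0) u) y' k"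
    using dft_shift[OF M, of "periodic_hat (Suc 0) u" y' l k] by (simp add: y'_def periodic_hat_add_int)
  ultimately show ?thesis
    using \<open>p \<le> p'\<close> \<open>\<bar>of_int (p' - p) - u * real M\<bar> \<le> 1\<close> \<open>p \<ge> 0\<close> \<open>p' \<le> int M\<close>
    by (intro exI[of _ p] exI[of _ p'] exI[of _ l]) auto
qed

text \<open>Jordan's inequality: a concave function lies above its chord.\<close>

lemma sin_ge_chord:
  assumes "0 \<le> x" "x \<le> pi / 2"
  shows "2 * x / pi \<le> sin x"
proof -
  have "concave_on {0..pi / 2} sin"
    by (rule f''_le0_imp_concave[of _ _ cos "\<lambda>x. - sin x"])
       (auto intro!: derivative_eq_intros sin_ge_zero)
  from concave_onD[OF this, of "2 * x / pi" 0 "pi / 2"] show ?thesis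
    using assms by (simp add: field_simps)
qed

text \<open>Here |1 - e^(i t)| = 2 |sin(t / 2)|, and the symmetric representative of
  \<open>k\<close> keeps the half angle within \<open>pi / 2\<close>, where Jordan's inequality
  applies.\<close>

lemma norm_one_minus_cis:
  assumes M: "M > 0"
  shows "norm (1 - cis (2 * pi * of_int (- k) / real M)) \<ge> 4 * circ_abs M k / real M"
proof -
  define s where "s = sym_mod M k"
  have "int M dvd - k - - s" using dvd_sym_mod_diff[of M k] by (simp add: s_def)
  hence "cis (2 * pi * of_int (- k) / real M) = cis (2 * pi * of_int (- s) / real M)"
    by (rule cis_int_multiple_eq[OF M])
  also have "norm (1 - \<dots>) = 2 * \<bar>sin (pi * of_int s / real M)\<bar>"
    using dist_exp_i_1[of "2 * pi * of_int (- s) / real M"]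
    by (simp add: norm_minus_commute cis_conv_exp)
  also have "\<bar>sin (pi * of_int s / real M)\<bar> = \<bar>sin (pi * \<bar>of_int s\<bar> / real M)\<bar>"
    by (cases "s \<ge> 0") auto
  finally have eq: "norm (1 - cis (2 * pi * of_int (- k) / real M)) = 2 * \<bar>sin (pi * \<bar>of_int s\<bar> / real M)\<bar>" .
  have "2 * circ_abs M k \<le> int M" by (rule circ_abs_le[OF M])
  hence "of_int (2 * circ_abs M k) \<le> real_of_int (int M)" by (simp only: of_int_le_iff)
  hence c: "2 * \<bar>of_int s\<bar> \<le> real M" by (simp add: circ_abs_def s_def)
  have "2 * (pi * \<bar>of_int s\<bar> / real M) / pi \<le> sin (pi * \<bar>of_int s\<bar> / real M)"
    using c M by (intro sin_ge_chord) (auto simp: field_simps)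
  hence "2 * \<bar>of_int s\<bar> / real M \<le> \<bar>sin (pi * \<bar>of_int s\<bar> / real M)\<bar>" by simp
  thus ?thesis unfolding eq by (simp add: circ_abs_def s_def)
qed

lemma sum_int_telescope:
  fixes f :: "int \<Rightarrow> 'a::ab_group_add"
  assumes "p \<le> p'"
  shows "(\<Sum>n\<in>{p..<p'}. f n - f (n + 1)) = f p - f p'"
  using assms
proof (induction p' rule: int_ge_induct)
  case (step i)
  have "{p..<i + 1} = insert i {p..<i}" using step.hyps by auto
  thus ?case using step by simp
qed simp

text \<open>The sum telescopes after multiplication by \<open>1 - z\<close>. The product form also
  covers multiples of \<open>M\<close>, where \<open>z = 1\<close>.\<close>

lemma norm_geometric_sum_cis:
  assumes M: "M > 0" and "p \<le> p'"
  shows "circ_abs M k * norm (\<Sum>n\<in>{p..<p'}. cis (2 * pi * of_int (- (k * n)) / real M)) \<le> real M / 2"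
proof -
  define f where "f n = cis (2 * pi * of_int (- (k * n)) / real M)" for n :: int
  define z where "z = cis (2 * pi * of_int (- k) / real M)"
  have "f (n + 1) = z * f n" for n
    by (simp add: f_def z_def cis_mult algebra_simps add_divide_distrib diff_divide_distrib)
  hence "(1 - z) * (\<Sum>n\<in>{p..<p'}. f n) = (\<Sum>n\<in>{p..<p'}. f n - f (n + 1))"
    by (simp add: sum_distrib_left algebra_simps)
  also have "\<dots> = f p - f p'" by (rule sum_int_telescope) fact
  finally have "norm (1 - z) * norm (\<Sum>n\<in>{p..<p'}. f n) \<le> 2"
    using norm_triangle_ineq4[of "f p" "f p'"] by (simp add: f_def flip: norm_mult)
  moreover have "4 * circ_abs M k / real M * norm (\<Sum>n\<in>{p..<p'}. f n) \<le> norm (1 - z) * norm (\<Sum>n\<in>{p..<p'}. f n)"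
    using norm_one_minus_cis[OF M, of k] by (intro mult_right_mono) (auto simp: z_def)
  ultimately have "4 * circ_abs M k / real M * norm (\<Sum>n\<in>{p..<p'}. f n) \<le> 2" by linarith
  thus ?thesis using M by (simp add: f_def field_simps)
qed

text \<open>One bound counts samples, the other uses the geometric sum. The constant 1 in the second
  is essential: the bound is raised to the power \<open>r\<close> later, and its product over the
  coordinates must stay below \<open>1 / L\<close> on the dual lattice.\<close>

lemma norm_dft_indicator:
  assumes M: "M > 0" and u: "u > 0" "u \<le> 1" "1 / real M \<le> u"
  shows "norm (dft M (periodic_hat (Suc 0) u) y k) \<le> min (2 * u) (1 / max (circ_abs M k) 1)"
proof -
  obtain p p' l where p: "p \<le> p'" "p' - p \<le> int M" "\<bar>of_int (p' - p) - u * real M\<bar> \<le> 1"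
    and dft: "dft M (periodic_hat (Suc 0) u) y k = cis (2 * pi * of_int (k * l) / real M) *
      ((\<Sum>n\<in>{p..<p'}. cis (2 * pi * of_int (- (k * n)) / real M)) / of_nat M)"
    using dft_indicator[OF M u(1,2)] by blast
  define N where "N = norm (\<Sum>n\<in>{p..<p'}. cis (2 * pi * of_int (- (k * n)) / real M))"
  have eq: "norm (dft M (periodic_hat (Suc 0) u) y k) = N / real M"
    unfolding dft N_def by (simp add: norm_mult norm_divide)
  have "N \<le> (\<Sum>n\<in>{p..<p'}. norm (cis (2 * pi * of_int (- (k * n)) / real M)))"
    unfolding N_def by (rule norm_sum)
  hence N: "N \<le> of_int (p' - p)" using p(1) by simp
  have "N \<le> u * real M + 1" using N p(3) by linarith
  \<comment> \<open>The grid is finer than \<open>u\<close>, so the rounding error 1 is absorbed;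
    this is the 2 in \<open>2 * u\<close>.\<close>
  also have "\<dots> \<le> 2 * u * real M" using u(3) M by (simp add: field_simps)
  finally have 1: "N / real M \<le> 2 * u" using M by (simp add: field_simps)
  have 2: "N / real M \<le> 1 / max (circ_abs M k) 1"
  proof (cases "circ_abs M k \<ge> 1")
    case True
    have "circ_abs M k * N \<le> real M / 2"
      unfolding N_def by (rule norm_geometric_sum_cis[OF M p(1)])
    hence "circ_abs M k * N \<le> real M" using M by linarith
    thus ?thesis using True M by (simp add: field_simps max_def)
  next
    case False
    have "real_of_int (p' - p) \<le> real_of_int (int M)" using p(2) by (simp only: of_int_le_iff)
    hence "N \<le> real M" using N by simp
    thus ?thesis using False M by (simp add: max_def)
  qed
  show ?thesis unfolding eq using 1 2 by simp
qed

lemma dft_indicator_0: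
  assumes M: "M > 0" and u: "u > 0" "u \<le> 1"
  shows "norm (dft M (periodic_hat (Suc 0) u) y 0 - of_real u) \<le> 1 / real M"
    and "norm (dft M (periodic_hat (Suc 0) u) y 0) \<le> 1"
proof -
  obtain p p' l where p: "p \<le> p'" "p' - p \<le> int M" "\<bar>of_int (p' - p) - u * real M\<bar> \<le> 1"
    and dft: "dft M (periodic_hat (Suc 0) u) y 0 = cis (2 * pi * of_int (0 * l) / real M) *
      ((\<Sum>n\<in>{p..<p'}. cis (2 * pi * of_int (- (0 * n)) / real M)) / of_nat M)"
    using dft_indicator[OF M u] by blast
  have d: "dft M (periodic_hat (Suc 0) u) y 0 = of_real (of_int (p' - p) / real M)"
    using p(1) unfolding dft by simp
  have "norm (dft M (periodic_hat (Suc 0) u) y 0 - of_real u) = \<bar>(of_int (p' - p) - u * real M) / real M\<bar>"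
    unfolding d of_real_diff[symmetric] norm_of_real using M by (simp add: field_simps)
  also have "\<dots> \<le> 1 / real M" using p(3) M by (simp add: divide_right_mono)
  finally show "norm (dft M (periodic_hat (Suc 0) u) y 0 - of_real u) \<le> 1 / real M" .
  have "real_of_int (p' - p) \<le> real_of_int (int M)" using p(2) by (simp only: of_int_le_iff)
  thus "norm (dft M (periodic_hat (Suc 0) u) y 0) \<le> 1"
    unfolding d norm_of_real using M p(1) by simp
qed

lemma norm_dft_periodic_hat:
  assumes M: "M > 0" and u: "u > 0" "real (Suc r) * u \<le> 1" "1 / real M \<le> u"
  shows "norm (dft M (periodic_hat (Suc r) u) y k) \<le> min (2 * u) (1 / max (circ_abs M k) 1) ^ Suc r"
  using u(2)
proof (induction r arbitrary: y)
  case 0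
  thus ?case using norm_dft_indicator[OF M u(1) _ u(3)] by simp
next
  case (Suc r)
  define b where "b = min (2 * u) (1 / max (circ_abs M k) 1)"
  have le: "real (Suc r) * u \<le> real (Suc (Suc r)) * u" "1 * u \<le> real (Suc (Suc r)) * u"
    using u(1) by (intro mult_right_mono; simp)+
  have b: "b \<ge> 0" using u(1) by (simp add: b_def)
  have "norm (LINT t:{-1/2..<-1/2 + 1 / real M}|lborel.
       dft M (periodic_hat (Suc r) u) t k * dft M (periodic_hat (Suc 0) u) (y - t) k) \<le>
       b ^ Suc r * b * (-1/2 + 1 / real M - (-1/2))"
  proof (rule norm_set_integral_le)
    show "norm (dft M (periodic_hat (Suc r) u) t k * dft M (periodic_hat (Suc 0) u) (y - t) k) \<le> b ^ Suc r * b" for t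
      unfolding norm_mult
    proof (rule mult_mono)
      show "norm (dft M (periodic_hat (Suc r) u) t k) \<le> b ^ Suc r"
        unfolding b_def using le Suc.prems by (intro Suc.IH) linarith
      show "norm (dft M (periodic_hat (Suc 0) u) (y - t) k) \<le> b"
        unfolding b_def using le Suc.prems by (intro norm_dft_indicator M u) linarith
    qed (use b in auto)
  qed simp
  also have "\<dots> = b ^ Suc (Suc r) / real M" by simp
  finally have "norm (dft M (periodic_hat (Suc (Suc r)) u) y k) \<le> real M * (b ^ Suc (Suc r) / real M)"
    unfolding dft_periodic_hat_Suc[OF M u(1) Suc.prems] norm_mult norm_of_nat by (rule mult_left_mono) simp
  thus ?case using M by (simp add: b_def)
qed

text \<open>Each convolution contributes one more factor \<open>u\<close> to the mean and one more
  error \<open>1 / M\<close>; the errors merely add because all factors are at most 1 in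
  modulus.\<close>

lemma dft_periodic_hat_0:
  assumes M: "M > 0" and u: "u > 0" "real (Suc r) * u \<le> 1"
  shows "norm (dft M (periodic_hat (Suc r) u) y 0 - of_real (u ^ Suc r)) \<le> real (Suc r) / real M"
  using u(2)
proof (induction r arbitrary: y)
  case 0
  thus ?case using dft_indicator_0[OF M u(1)] by simp
next
  case (Suc r)
  define q where "q = periodic_hat (Suc r) u"
  define p where "p = periodic_hat (Suc 0) u"
  have [measurable]: "q \<in> borel_measurable borel" "p \<in> borel_measurable borel"
    by (simp_all add: q_def p_def)
  have le: "real (Suc r) * u \<le> real (Suc (Suc r)) * u" "1 * u \<le> real (Suc (Suc r)) * u"
    using u(1) by (intro mult_right_mono; simp)+
  have u1: "u \<le> 1" using le(2) Suc.prems by linarith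
  let ?B = "{-1/2..<-1/2 + 1 / real M}"
  define f where "f t = dft M q t 0 * dft M p (y - t) 0" for t
  have p1: "norm (dft M p t 0) \<le> 1" "norm (dft M p t 0 - of_real u) \<le> 1 / real M" for t
    using dft_indicator_0[OF M u(1) u1] by (auto simp: p_def)
  have q1: "norm (dft M q t 0 - of_real (u ^ Suc r)) \<le> real (Suc r) / real M" for t
    unfolding q_def using le Suc.prems by (intro Suc.IH) linarith
  have f: "norm (f t - of_real (u ^ Suc (Suc r))) \<le> real (Suc (Suc r)) / real M" for t
  proof -
    have "f t - of_real (u ^ Suc (Suc r)) = (dft M q t 0 - of_real (u ^ Suc r)) * dft M p (y - t) 0 +
        of_real (u ^ Suc r) * (dft M p (y - t) 0 - of_real u)"
      by (simp add: f_def algebra_simps)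
    also have "norm \<dots> \<le> norm (dft M q t 0 - of_real (u ^ Suc r)) * norm (dft M p (y - t) 0) +
        norm (of_real (u ^ Suc r) :: complex) * norm (dft M p (y - t) 0 - of_real u)"
      unfolding norm_mult[symmetric] by (rule norm_triangle_ineq)
    also have "\<dots> \<le> real (Suc r) / real M * 1 + 1 * (1 / real M)"
      using p1 q1 u(1) u1 by (intro add_mono mult_mono) (auto simp: norm_power abs_le_iff power_le_one simp del: power_Suc)
    finally show ?thesis by (simp add: add_divide_distrib)
  qed
  have fin: "set_integrable lborel ?B f"
    unfolding set_integrable_def
  proof (rule integrableI_bounded_set_indicator[of _ _ _ "real (Suc (Suc r)) / real M + norm (of_real (u ^ Suc (Suc r)) :: complex)"])
    show "f \<in> borel_measurable lborel" unfolding f_def by measurable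
    show "AE t in lborel. t \<in> ?B \<longrightarrow> norm (f t) \<le> real (Suc (Suc r)) / real M + norm (of_real (u ^ Suc (Suc r)) :: complex)"
    proof (intro AE_I2 impI)
      fix t
      show "norm (f t) \<le> real (Suc (Suc r)) / real M + norm (of_real (u ^ Suc (Suc r)) :: complex)"
        using f[of t] norm_triangle_ineq2[of "f t" "of_real (u ^ Suc (Suc r))"] by linarith
    qed
  qed auto
  have cin: "set_integrable lborel ?B (\<lambda>_. of_real (u ^ Suc (Suc r)) :: complex)"
    unfolding set_integrable_def by (rule integrableI_bounded_set_indicator[of _ _ _ "norm (of_real (u ^ Suc (Suc r)) :: complex)"]) auto
  have "(LINT t:?B|lborel. f t - of_real (u ^ Suc (Suc r))) = (LINT t:?B|lborel. f t) - (LINT t:?B|lborel. of_real (u ^ Suc (Suc r)))"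
    by (rule set_integral_diff(2)[OF fin cin])
  also have "(LINT t:?B|lborel. of_real (u ^ Suc (Suc r))) = (of_real (u ^ Suc (Suc r)) / of_nat M :: complex)"
    by (simp add: set_lebesgue_integral_def scaleR_conv_of_real)
  finally have "of_nat M * (LINT t:?B|lborel. f t) - of_real (u ^ Suc (Suc r)) =
      of_nat M * (LINT t:?B|lborel. f t - of_real (u ^ Suc (Suc r)))"
    using M by (simp add: right_diff_distrib)
  moreover have "norm (LINT t:?B|lborel. f t - of_real (u ^ Suc (Suc r))) \<le>
      real (Suc (Suc r)) / real M * (-1/2 + 1 / real M - (-1/2))"
    by (intro norm_set_integral_le f) simp
  hence "real M * norm (LINT t:?B|lborel. f t - of_real (u ^ Suc (Suc r))) \<le>
      real M * (real (Suc (Suc r)) / real M * (-1/2 + 1 / real M - (-1/2)))"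
    by (rule mult_left_mono) simp
  hence "norm (of_nat M * (LINT t:?B|lborel. f t - of_real (u ^ Suc (Suc r)))) \<le> real (Suc (Suc r)) / real M"
    unfolding norm_mult norm_of_nat using M by simp
  ultimately show ?case
    unfolding dft_periodic_hat_Suc[OF M u(1) Suc.prems] f_def q_def p_def by simp
qed

text \<open>Sides of length at most 1 and half-open supports leave a single integer vector
  \<open>N\<close> that can contribute to the periodization.\<close>

lemma periodic_box_hat_eq_prod:
  fixes u w x :: "real ^ 'n"
  assumes u: "\<And>j. u $ j > 0" "\<And>j. real (Suc r) * u $ j \<le> 1"
  shows "periodic_box_hat (Suc r) w u x = (\<Prod>j\<in>UNIV. periodic_hat (Suc r) (u $ j) (x $ j - w $ j))"
proof -
  define N :: "int ^ 'n" where "N = (\<chi> j. - \<lfloor>x $ j - w $ j + 1 / 2\<rfloor>)"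
  have z: "box_hat (Suc r) w u (int_vec n + x) = 0" if nN: "n \<noteq> N" for n
  proof -
    obtain j where j: "n $ j \<noteq> N $ j" using nN unfolding vec_eq_iff by blast
    have "hat (Suc r) (u $ j) ((int_vec n + x) $ j - w $ j) = 0"
    proof (rule ccontr)
      assume "\<not> ?thesis"
      from hat_support[OF u(1) this] have
        "- 1 / 2 \<le> x $ j - w $ j + of_int (n $ j)" "x $ j - w $ j + of_int (n $ j) < 1 / 2"
        using u(2)[of j] by (auto simp: int_vec_def)
      hence "\<lfloor>x $ j - w $ j + 1 / 2\<rfloor> = - n $ j" by (simp add: floor_eq_iff)
      thus False using j by (simp add: N_def)
    qed
    thus ?thesis by (auto simp: box_hat_def intro!: prod_zero)
  qed
  have "periodic_box_hat (Suc r) w u x = (\<Sum>\<^sub>\<infinity>n\<in>{N}. box_hat (Suc r) w u (int_vec n + x))"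
    unfolding periodic_box_hat_def by (rule infsum_cong_neutral) (use z in auto)
  also have "\<dots> = box_hat (Suc r) w u (int_vec N + x)" by simp
  also have "\<dots> = (\<Prod>j\<in>UNIV. periodic_hat (Suc r) (u $ j) (x $ j - w $ j))"
    unfolding box_hat_def
    by (intro prod.cong refl) (simp add: periodic_hat_def centred_eq_diff int_vec_def N_def algebra_simps)
  finally show ?thesis .
qed

section \<open>Korobov points\<close>

lemma moment_scale:
  fixes g :: "('n::finite \<Rightarrow> int) \<Rightarrow> complex"
  shows "moment M P (\<lambda>k. of_real c * g k) = \<bar>c\<bar> ^ P * moment M P g"
proof -
  have "trig_sum M 1 (\<lambda>k. of_real c * g k) n = of_real c * trig_sum M 1 g n" for n
    by (simp add: trig_sum_def sum_distrib_left mult.assoc)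
  thus ?thesis
    by (simp add: moment_def norm_mult power_mult_distrib sum_distrib_left)
qed

lemma korobov_point_nth:
  "korobov_point m a \<mu> $ j = real \<mu> * of_int (a $ j) / real m - of_int \<lfloor>real \<mu> * of_int (a $ j) / real m\<rfloor>"
  by (simp add: korobov_point_def frac_def)

text \<open>Exactness is tested on the exponential with frequency \<open>z\<close>: for a nonzero
  dual point in the cross it equals 1 at all Korobov points, while its integral is 0.\<close>

lemma gap_of_korobov_exact:
  fixes a :: "int ^ 'n"
  assumes exact: "korobov_exact m a L" and m: "m \<ge> 1"
  shows "gap m (\<lambda>j. a $ j) L"
  unfolding gap_def
proof (intro allI impI)
  fix z :: "'n \<Rightarrow> int"
  assume z: "z \<noteq> (\<lambda>_. 0)" and dvd: "int m dvd (\<Sum>j\<in>UNIV. a $ j * z j)"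
  show "int L < box_size z"
  proof (rule ccontr)
    assume "\<not> int L < box_size z"
    define k :: "int ^ 'n" where "k = (\<chi> j. z j)"
    have k: "k \<in> hyperbolic_cross L"
      using \<open>\<not> int L < box_size z\<close> by (simp add: hyperbolic_cross_def k_def box_size_def)
    define f where "f x = exp (\<i> * of_real (2 * pi * (int_vec k \<bullet> x)))" for x :: "real ^ 'n"
    have inner: "int_vec k \<bullet> x = (\<Sum>j\<in>UNIV. of_int (z j) * x $ j)" for x
      by (simp add: inner_vec_def int_vec_def k_def)
    have f_cis: "f x = cis (2 * pi * (int_vec k \<bullet> x))" for x
      by (simp add: f_def cis_conv_exp)
    have "f \<in> trig_polys L"
    proof -
      have "f = (\<lambda>x. \<Sum>h\<in>hyperbolic_cross L. (if h = k then 1 else 0) * exp (\<i> * of_real (2 * pi * (int_vec h \<bullet> x))))"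
      proof
        fix x
        have "(\<Sum>h\<in>hyperbolic_cross L. (if h = k then 1 else 0) * exp (\<i> * of_real (2 * pi * (int_vec h \<bullet> x))))
            = (\<Sum>h\<in>hyperbolic_cross L. if h = k then f x else 0)"
          by (intro sum.cong refl) (simp add: f_def)
        thus "f x = (\<Sum>h\<in>hyperbolic_cross L. (if h = k then 1 else 0) * exp (\<i> * of_real (2 * pi * (int_vec h \<bullet> x))))"
          using k by (simp add: finite_hyperbolic_cross)
      qed
      thus ?thesis unfolding trig_polys_def by (intro CollectI exI[of _ "\<lambda>h. if h = k then 1 else 0"])
    qed
    moreover have "korobov_cubature m a f = 1"
    proof -
      have "f (korobov_point m a \<mu>) = 1" for \<mu>
      proof -
        obtain q where q: "(\<Sum>j\<in>UNIV. a $ j * z j) = int m * q" using dvd by auto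
        have "int_vec k \<bullet> korobov_point m a \<mu> = real \<mu> / real m * of_int (\<Sum>j\<in>UNIV. a $ j * z j)
            - of_int (\<Sum>j\<in>UNIV. z j * \<lfloor>real \<mu> * of_int (a $ j) / real m\<rfloor>)"
          unfolding inner korobov_point_nth
          by (simp add: right_diff_distrib sum_subtractf sum_distrib_left mult_ac)
        also have "\<dots> = of_int (int \<mu> * q - (\<Sum>j\<in>UNIV. z j * \<lfloor>real \<mu> * of_int (a $ j) / real m\<rfloor>))"
          unfolding q using m by simp
        finally obtain l :: int where "int_vec k \<bullet> korobov_point m a \<mu> = of_int l" by blast
        thus ?thesis unfolding f_cis by simp
      qed
      thus ?thesis using m by (simp add: korobov_cubature_def)
    qed
    moreover have "(LINT x:unit_cube|lborel. f x) = 0"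
    proof -
      obtain j where j: "z j \<noteq> 0" using z by auto
      \<comment> \<open>Since \<open>M\<close> exceeds the absolute value of \<open>z j\<close>,
        which is nonzero, it does not divide it. Hence the exponential sums to 0 over every
        translate of the grid, and tiling gives integral 0.\<close>
      define M where "M = nat \<bar>z j\<bar> + 1"
      have M: "M > 0" by (simp add: M_def)
      have ndvd: "\<not> int M dvd z j"
        using j zdvd_imp_le[of "int M" "\<bar>z j\<bar>"] by (auto simp: M_def)
      have "f \<in> borel_measurable borel"
        unfolding f_def by (intro borel_measurable_continuous_onI continuous_intros)
      hence fi: "set_integrable lborel unit_cube f"
        by (rule set_integrable_unit_cube[of _ 1]) (simp add: f_cis)
      have "f (x + grid_point M n) = f x * chi M z n" for x n
      proof -
        have "int_vec k \<bullet> grid_point M n = of_int (\<Sum>j\<in>UNIV. z j * n j) / real M"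
          unfolding inner by (simp add: grid_point_def sum_divide_distrib)
        thus ?thesis by (simp add: f_cis chi_def inner_add_right distrib_left cis_mult)
      qed
      hence "(\<Sum>n\<in>grid M. f (x + grid_point M n)) = 0" for x
        using sum_chi[OF M, of z] ndvd by (auto simp flip: sum_distrib_left)
      thus ?thesis
        unfolding set_integral_tiles(2)[OF finite_grid sets_small_cube unit_cube_tiles[OF M] fi] by simp
    qed
    ultimately show False using exact unfolding korobov_exact_def by auto
  qed
qed

text \<open>The points of the Korobov set are grid points modulo one; summing over them keeps exactly the
  frequencies of the dual lattice.\<close>

lemma korobov_mean_eq_trig_sum:
  fixes u y :: "real ^ 'n" and a :: "int ^ 'n" and r M :: nat
  assumes m: "m \<ge> 1" and M: "M = m * h" "h \<ge> 1"
  defines "q \<equiv> \<lambda>j. periodic_hat r (u $ j)"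
  defines "C \<equiv> \<lambda>k. \<Prod>j\<in>UNIV. dft M (q j) (y $ j) (k j)"
  shows "of_real (1 / real m * (\<Sum>\<mu>=1..m. \<Prod>j\<in>UNIV. q j (korobov_point m a \<mu> $ j + y $ j - of_int (n j) / real M)))
    = C (\<lambda>_. 0) + trig_sum M (-1) (\<lambda>k. if k \<in> dual_residues M m (\<lambda>j. a $ j) then C k else 0) n"
proof -
  have M0: "M > 0" using m M by simp
  define A where "A k = (\<Sum>j\<in>UNIV. a $ j * k j)" for k :: "'n \<Rightarrow> int"
  have pt: "of_real (\<Prod>j\<in>UNIV. q j (korobov_point m a \<mu> $ j + y $ j - of_int (n j) / real M))
     = (\<Sum>k\<in>grid M. C k * chi M (\<lambda>j. - k j) n * cis (2 * pi * of_int (A k * int \<mu>) / real m))" for \<mu>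
  proof -
    \<comment> \<open>Because \<open>M = m * h\<close>, the number \<open>\<mu> * a $ j / m\<close>
      is the grid coordinate \<open>h * \<mu> * a $ j / M\<close>; its integer part is invisible to
      periodic functions.\<close>
    define x where "x j = int h * int \<mu> * a $ j - n j" for j
    have "q j (korobov_point m a \<mu> $ j + y $ j - of_int (n j) / real M) = q j (y $ j + of_int (x j) / real M)" for j
    proof -
      have "korobov_point m a \<mu> $ j + y $ j - of_int (n j) / real M =
        (y $ j + of_int (x j) / real M) + of_int (- \<lfloor>real \<mu> * of_int (a $ j) / real m\<rfloor>)"
        using m M by (simp add: korobov_point_nth x_def field_simps)
      thus ?thesis by (simp only: q_def periodic_hat_add_int)
    qed
    hence "of_real (\<Prod>j\<in>UNIV. q j (korobov_point m a \<mu> $ j + y $ j - of_int (n j) / real M))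
      = (\<Prod>j\<in>UNIV. \<Sum>k\<in>{0..<int M}. dft M (q j) (y $ j) k * cis (2 * pi * of_int (k * x j) / real M))"
      using dft_inversion[OF M0, of "q _"] by (simp add: q_def periodic_hat_add_int)
    also have "\<dots> = (\<Sum>k\<in>grid M. C k * chi M k x)"
      unfolding C_def chi_prod prod.distrib[symmetric]
      by (rule sum_grid_prod[symmetric])
    also have "\<dots> = (\<Sum>k\<in>grid M. C k * chi M (\<lambda>j. - k j) n * cis (2 * pi * of_int (A k * int \<mu>) / real m))"
    proof (rule sum.cong[OF refl])
      fix k :: "'n \<Rightarrow> int"
      have "(\<Sum>j\<in>UNIV. k j * x j) = int h * (A k * int \<mu>) + (\<Sum>j\<in>UNIV. - k j * n j)"
        by (simp add: x_def A_def algebra_simps sum.distrib sum_subtractf sum_distrib_left sum_negf)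
      hence "2 * pi * of_int (\<Sum>j\<in>UNIV. k j * x j) / real M =
         2 * pi * of_int (\<Sum>j\<in>UNIV. - k j * n j) / real M + 2 * pi * of_int (A k * int \<mu>) / real m"
        using m M by (simp add: field_simps)
      hence "chi M k x = chi M (\<lambda>j. - k j) n * cis (2 * pi * of_int (A k * int \<mu>) / real m)"
        unfolding chi_def cis_mult by (simp only:)
      thus "C k * chi M k x = C k * chi M (\<lambda>j. - k j) n * cis (2 * pi * of_int (A k * int \<mu>) / real m)"
        by (simp add: mult.assoc)
    qed
    finally show ?thesis .
  qed
  have mean: "(\<Sum>\<mu>=1..m. cis (2 * pi * of_int (A k * int \<mu>) / real m)) = (if int m dvd A k then of_nat m else 0)" for k
  proof -
    have "(\<Sum>\<mu>=1..m. cis (2 * pi * of_int (A k * int \<mu>) / real m)) =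
        (\<Sum>x\<in>{0..<int m}. cis (2 * pi * of_int (A k * (x + 1)) / real m))"
      by (rule sum.reindex_bij_witness[of _ "\<lambda>x. nat x + 1" "\<lambda>\<mu>. int \<mu> - 1"]) auto
    also have "\<dots> = (\<Sum>x\<in>{0..<int m}. cis (2 * pi * of_int (A k * x) / real m))"
    proof (rule sum_residues_shift)
      fix x y assume "int m dvd x - y"
      hence "int m dvd A k * x - A k * y" by (simp flip: right_diff_distrib)
      thus "cis (2 * pi * of_int (A k * x) / real m) = cis (2 * pi * of_int (A k * y) / real m)"
        using m by (intro cis_int_multiple_eq) auto
    qed (use m in auto)
    also have "\<dots> = (if int m dvd A k then of_nat m else 0)" using m by (intro sum_roots_of_unity) auto
    finally show ?thesis .
  qed
  have "of_real (1 / real m * (\<Sum>\<mu>=1..m. \<Prod>j\<in>UNIV. q j (korobov_point m a \<mu> $ j + y $ j - of_int (n j) / real M)))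
     = 1 / of_nat m * (\<Sum>\<mu>=1..m. \<Sum>k\<in>grid M. C k * chi M (\<lambda>j. - k j) n * cis (2 * pi * of_int (A k * int \<mu>) / real m))"
    unfolding pt[symmetric] by simp
  also have "\<dots> = 1 / of_nat m * (\<Sum>k\<in>grid M. C k * chi M (\<lambda>j. - k j) n * (if int m dvd A k then of_nat m else 0))"
    unfolding mean[symmetric] sum_distrib_left[of "C _ * chi M _ n"] by (subst sum.swap) (rule refl)
  also have "\<dots> = (\<Sum>k\<in>grid M. if int m dvd A k then C k * chi M (\<lambda>j. - k j) n else 0)"
    using m by (simp add: sum_distrib_left if_distrib cong: if_cong)
  also have "\<dots> = (if int m dvd A (\<lambda>_. 0) then C (\<lambda>_. 0) * chi M (\<lambda>j. - 0) n else 0) +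
      (\<Sum>k\<in>grid M - {\<lambda>_. 0}. if int m dvd A k then C k * chi M (\<lambda>j. - k j) n else 0)"
    using M0 by (subst sum.remove[OF finite_grid, of "\<lambda>_. 0"]) (auto simp: grid_def)
  also have "(if int m dvd A (\<lambda>_. 0) then C (\<lambda>_. 0) * chi M (\<lambda>j. - 0) n else 0) = C (\<lambda>_. 0)"
    by (simp add: A_def chi_def)
  also have "(\<Sum>k\<in>grid M - {\<lambda>_. 0}. if int m dvd A k then C k * chi M (\<lambda>j. - k j) n else 0)
     = trig_sum M (-1) (\<lambda>k. if k \<in> dual_residues M m (\<lambda>j. a $ j) then C k else 0) n"
    unfolding trig_sum_def
    by (rule sum.mono_neutral_cong_left) (auto simp: dual_residues_def A_def)
  finally show ?thesis .
qed

lemma grid_mean_prod_dft: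
  fixes q :: "'n::finite \<Rightarrow> real \<Rightarrow> real"
  shows "of_real ((\<Sum>n\<in>grid M. \<Prod>j\<in>UNIV. q j (y j + of_int (n j) / real M)) / real M ^ CARD('n))
     = (\<Prod>j\<in>UNIV. dft M (q j) (y j) 0)"
proof -
  have "(\<Prod>j\<in>UNIV. dft M (q j) (y j) 0) =
      (\<Prod>j\<in>UNIV. \<Sum>n\<in>{0..<int M}. of_real (q j (y j + of_int n / real M))) / of_nat M ^ CARD('n)"
    by (simp add: dft_def prod_dividef)
  thus ?thesis by (simp add: sum_grid_prod[of "\<lambda>j n. of_real (q j (y j + of_int n / real M))", symmetric])
qed

text \<open>All factors have modulus at most 1, so the errors of the coordinates add.\<close>

lemma prod_dft_0:
  fixes u y :: "real ^ 'n"
  assumes M: "M > 0" and u: "\<And>j. u $ j > 0" "\<And>j. real (Suc r) * u $ j \<le> 1"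
  shows "norm ((\<Prod>j\<in>UNIV. dft M (periodic_hat (Suc r) (u $ j)) (y $ j) 0) - of_real (\<Prod>j\<in>UNIV. (u $ j) ^ Suc r))
     \<le> real (CARD('n) * Suc r) / real M"
proof -
  have u1: "u $ j \<le> 1" for j
  proof -
    have "1 * u $ j \<le> real (Suc r) * u $ j" using u(1)[of j] by (intro mult_right_mono) auto
    thus ?thesis using u(2)[of j] by simp
  qed
  have le1: "norm (dft M (periodic_hat (Suc r) (u $ j)) (y $ j) 0) \<le> 1" for j
  proof -
    have "norm (dft M (periodic_hat (Suc r) (u $ j)) (y $ j) 0) \<le>
        (\<Sum>n\<in>{0..<int M}. norm (of_real (periodic_hat (Suc r) (u $ j) (y $ j + of_int n / real M)) *
           cis (2 * pi * of_int (- (0 * n)) / real M))) / real M"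
      unfolding dft_def norm_divide norm_of_nat by (intro divide_right_mono norm_sum) simp
    also have "\<dots> \<le> (\<Sum>n\<in>{0..<int M}. 1) / real M"
      using periodic_hat_bounds[OF u(1) u1] by (intro divide_right_mono sum_mono) (auto simp: norm_mult)
    finally show ?thesis using M by simp
  qed
  have "norm ((\<Prod>j\<in>UNIV. dft M (periodic_hat (Suc r) (u $ j)) (y $ j) 0) - (\<Prod>j\<in>UNIV. of_real ((u $ j) ^ Suc r)))
    \<le> (\<Sum>j\<in>UNIV. norm (dft M (periodic_hat (Suc r) (u $ j)) (y $ j) 0 - of_real ((u $ j) ^ Suc r)))"
    using le1 u(1) u1 by (intro norm_prod_diff)
      (auto simp: norm_power abs_le_iff less_imp_le power_le_one simp del: power_Suc)
  also have "\<dots> \<le> (\<Sum>j\<in>(UNIV :: 'n set). real (Suc r) / real M)"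
    by (intro sum_mono dft_periodic_hat_0 M u)
  finally show ?thesis by (simp only: of_real_prod sum_constant of_nat_mult times_divide_eq_right)
qed

text \<open>The value is read off from the zero coefficients: on every translate of every grid the
  mean is within \<open>CARD('n) * Suc r / M\<close> of the product, hence so is the integral, and
  \<open>M\<close> is arbitrary.\<close>

lemma integral_periodic_box_hat:
  fixes u w z :: "real ^ 'n"
  assumes u: "\<And>j. u $ j > 0" "\<And>j. real (Suc r) * u $ j \<le> 1"
  shows "(LINT x:unit_cube|lborel. periodic_box_hat (Suc r) w u (x - z)) = (\<Prod>j\<in>UNIV. (u $ j) ^ Suc r)"
proof -
  define f where "f x = periodic_box_hat (Suc r) w u (x - z)" for x
  define v where "v = (\<Prod>j\<in>UNIV. (u $ j) ^ Suc r)"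
  have u1: "u $ j \<le> 1" for j
  proof -
    have "1 * u $ j \<le> real (Suc r) * u $ j" using u(1)[of j] by (intro mult_right_mono) auto
    thus ?thesis using u(2)[of j] by simp
  qed
  have f_eq: "f = (\<lambda>x. \<Prod>j\<in>UNIV. periodic_hat (Suc r) (u $ j) (x $ j - z $ j - w $ j))"
    unfolding f_def[abs_def] periodic_box_hat_eq_prod[OF u] by simp
  have f: "set_integrable lborel unit_cube f"
  proof (rule set_integrable_unit_cube[of _ 1])
    show "f \<in> borel_measurable borel" unfolding f_eq by measurable
    show "norm (f x) \<le> 1" for x
      unfolding f_eq real_norm_def abs_prod
      by (rule prod_le_1) (use periodic_hat_bounds[OF u(1) u1] in auto)
  qed
  have bound: "\<bar>(LINT x:unit_cube|lborel. f x) - v\<bar> \<le> real (CARD('n) * Suc r) / real M" if M: "M > 0" for M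
  proof -
    have mean: "\<bar>(\<Sum>n\<in>grid M. f (x + grid_point M n)) / real M ^ CARD('n) - v\<bar> \<le> real (CARD('n) * Suc r) / real M" for x
    proof -
      define t where "t = (\<Sum>n\<in>grid M. f (x + grid_point M n)) / real M ^ CARD('n)"
      have "of_real t = (\<Prod>j\<in>UNIV. dft M (periodic_hat (Suc r) (u $ j)) ((x - z - w) $ j) 0)"
        using grid_mean_prod_dft[of "\<lambda>j. periodic_hat (Suc r) (u $ j)" "\<lambda>j. (x - z - w) $ j" M]
        by (simp add: t_def f_eq grid_point_def algebra_simps)
      hence "norm (of_real t - of_real v :: complex) \<le> real (CARD('n) * Suc r) / real M"
        using prod_dft_0[OF M u, of "x - z - w"] by (simp only: v_def)
      thus ?thesis unfolding of_real_diff[symmetric] norm_of_real t_def .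
    qed
    have "(LINT x:unit_cube|lborel. f x) \<le> v + real (CARD('n) * Suc r) / real M"
    proof (rule unit_cube_integral_le[OF M f])
      show "(\<Sum>n\<in>grid M. f (x + grid_point M n)) / real M ^ CARD('n) \<le> v + real (CARD('n) * Suc r) / real M" for x
        using mean[of x] unfolding abs_le_iff by linarith
    qed
    moreover have "(LINT x:unit_cube|lborel. - f x) \<le> - v + real (CARD('n) * Suc r) / real M"
    proof (rule unit_cube_integral_le[OF M])
      show "set_integrable lborel unit_cube (\<lambda>x. - f x)"
        using f unfolding set_integrable_def by simp
      show "(\<Sum>n\<in>grid M. - f (x + grid_point M n)) / real M ^ CARD('n) \<le> - v + real (CARD('n) * Suc r) / real M" for x
        using mean[of x] unfolding abs_le_iff sum_negf minus_divide_left[symmetric] by linarith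
    qed
    ultimately show ?thesis unfolding set_integral_uminus[OF f] abs_le_iff by linarith
  qed
  have "\<bar>(LINT x:unit_cube|lborel. f x) - v\<bar> \<le> 0"
  proof (rule field_le_epsilon)
    fix e :: real assume e: "e > 0"
    obtain M where M: "real M > real (CARD('n) * Suc r) / e" using reals_Archimedean2 by blast
    have "real (CARD('n) * Suc r) / e \<ge> 0" using e by simp
    hence M0: "real M > 0" using M by linarith
    have "real (CARD('n) * Suc r) / real M \<le> e"
      using M M0 e by (simp add: field_simps)
    thus "\<bar>(LINT x:unit_cube|lborel. f x) - v\<bar> \<le> 0 + e" using bound[of M] M0 by simp
  qed
  thus ?thesis by (simp add: f_def v_def)
qed

lemma box_error_eq:
  fixes u w z :: "real ^ 'n"
  assumes u: "\<And>j. u $ j > 0" "\<And>j. real (Suc r) * u $ j \<le> 1"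
  shows "box_error m \<xi> (Suc r) w u z = (\<Prod>j\<in>UNIV. (u $ j) ^ Suc r) - 1 / real m *
    (\<Sum>\<mu>=1..m. \<Prod>j\<in>UNIV. periodic_hat (Suc r) (u $ j) (\<xi> \<mu> $ j - z $ j - w $ j))"
proof -
  have "periodic_box_hat (Suc r) w u (\<xi> \<mu> - z) =
      (\<Prod>j\<in>UNIV. periodic_hat (Suc r) (u $ j) (\<xi> \<mu> $ j - z $ j - w $ j))" for \<mu>
    unfolding periodic_box_hat_eq_prod[OF u] by simp
  thus ?thesis unfolding box_error_def integral_periodic_box_hat[OF u] by (simp only:)
qed

section \<open>The discrepancy bound\<close>

text \<open>The constant of \<open>norm2_weight\<close>: a power from splitting into levels
  coordinate by coordinate, the factor of a single block, and the factor of the sum over the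
  blocks.\<close>

definition bound_const :: "nat \<Rightarrow> nat \<Rightarrow> real" where
  "bound_const P d = real (P\<^sup>2 * (2 * P + 1)) ^ d * 4 ^ (2 * d + 1) *
     ((real P + 2) * exp 1 * (2 * real P) ^ (d - 1))"

lemma bound_const_pos:
  assumes "P > 0"
  shows "bound_const P d > 0"
proof -
  have "P\<^sup>2 * (2 * P + 1) > 0" using assms by simp
  hence 1: "real (P\<^sup>2 * (2 * P + 1)) ^ d > 0" by (intro zero_less_power) (simp only: of_nat_0_less_iff)
  have 2: "(real P + 2) * exp 1 * (2 * real P) ^ (d - 1) > 0"
    using assms by (intro mult_pos_pos add_pos_pos zero_less_power) auto
  show ?thesis unfolding bound_const_def by (intro mult_pos_pos[OF mult_pos_pos[OF 1] 2]) simp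
qed

text \<open>Here the order disappears: \<open>\<beta> \<le> 1\<close> allows
  \<open>\<beta> ^ Suc r \<le> \<beta>\<close>, after which \<open>u $ j\<close> may grow to the
  side length \<open>Suc r * u $ j\<close>. In the other order the power would act on the enlarged
  weight, which need not be at most 1 by the bound on \<open>b j\<close> alone.\<close>

lemma norm_prod_dft_le_weight:
  fixes u y :: "real ^ 'n" and a :: "'n \<Rightarrow> int"
  assumes gap: "gap m a L" and M: "m dvd M" "M > 0" and L: "L > 0"
    and u: "\<And>j. u $ j > 0" "\<And>j. real (Suc r) * u $ j \<le> 1" "\<And>j. 1 / real M \<le> u $ j"
    and k: "k \<in> dual_residues M m a"
  shows "norm (\<Prod>j\<in>UNIV. dft M (periodic_hat (Suc r) (u $ j)) (y $ j) (k j))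
     \<le> (1 / real L) ^ Suc r * weight M m a (\<lambda>j. real (Suc r) * u $ j) L k"
proof -
  define b where "b j = min (2 * u $ j) (1 / max (circ_abs M (k j)) 1)" for j
  have b: "0 \<le> b j" for j using u(1)[of j] by (simp add: b_def)
  define \<beta> where "\<beta> = real L * (\<Prod>j\<in>UNIV. b j)"
  have \<beta>0: "0 \<le> \<beta>" unfolding \<beta>_def using b by (intro mult_nonneg_nonneg prod_nonneg) auto
  define m' where "m' j = real_of_int (max (circ_abs M (k j)) 1)" for j
  have m'1: "m' j \<ge> 1" for j by (simp add: m'_def)
  have \<beta>1: "\<beta> \<le> 1"
  proof -
    have "real_of_int (int L) < real_of_int (\<Prod>j\<in>UNIV. max (circ_abs M (k j)) 1)"
      using dual_residues_box_size[OF gap M k] by (simp only: of_int_less_iff)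
    hence lt: "real L < (\<Prod>j\<in>UNIV. m' j)" by (simp add: m'_def)
    have "\<beta> \<le> real L * (\<Prod>j\<in>UNIV. 1 / m' j)"
      unfolding \<beta>_def using b by (intro mult_left_mono prod_mono) (auto simp: b_def m'_def)
    also have "\<dots> = real L / (\<Prod>j\<in>UNIV. m' j)" by (simp add: prod_dividef)
    also have "\<dots> \<le> 1" using lt by (simp add: divide_le_eq)
    finally show ?thesis .
  qed
  have "norm (\<Prod>j\<in>UNIV. dft M (periodic_hat (Suc r) (u $ j)) (y $ j) (k j)) \<le> (\<Prod>j\<in>UNIV. b j ^ Suc r)"
    unfolding prod_norm[symmetric] b_def
    by (intro prod_mono conjI norm_ge_zero norm_dft_periodic_hat M u)
  also have "\<dots> = (1 / real L) ^ Suc r * \<beta> ^ Suc r"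
    using L by (simp add: \<beta>_def prod_power_distrib[symmetric] power_mult_distrib power_divide del: power_Suc)
  also have "\<dots> \<le> (1 / real L) ^ Suc r * \<beta>"
    using \<beta>0 \<beta>1 power_le_one[of \<beta> r] by (intro mult_left_mono) (auto intro: mult_left_le)
  also have "\<dots> \<le> (1 / real L) ^ Suc r * weight M m a (\<lambda>j. real (Suc r) * u $ j) L k"
  proof (intro mult_left_mono)
    have "\<beta> \<le> real L * (\<Prod>j\<in>UNIV. min (2 * (real (Suc r) * u $ j)) (1 / max (circ_abs M (k j)) 1))"
      unfolding \<beta>_def
    proof (intro mult_left_mono prod_mono conjI b)
      fix j
      have "1 * u $ j \<le> real (Suc r) * u $ j" using u(1)[of j] by (intro mult_right_mono) auto
      thus "b j \<le> min (2 * (real (Suc r) * u $ j)) (1 / max (circ_abs M (k j)) 1)"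
        unfolding b_def by (intro min.mono) auto
    qed simp
    thus "\<beta> \<le> weight M m a (\<lambda>j. real (Suc r) * u $ j) L k" using k by (simp add: weight_def)
  qed simp
  finally show ?thesis .
qed

text \<open>The error is the deviation of the zero coefficient from the integral, at most
  \<open>\<delta>\<close> by the choice of \<open>M\<close>, minus a trigonometric sum over the dual
  residues, whose P-th moment is at most \<open>\<delta> ^ P\<close>.\<close>

lemma box_error_grid_moment:
  fixes u w z :: "real ^ 'n" and a :: "int ^ 'n"
  assumes gap: "gap m (\<lambda>j. a $ j) L" and m: "m \<ge> 1" and L: "L \<ge> 1" and P: "P \<ge> 2" "even P"
    and u: "\<And>j. u $ j > 0" "\<And>j. real (Suc r) * u $ j \<le> 1"
    and M: "M = m * h" "h \<ge> 1" "\<And>j. 1 / real M \<le> u $ j"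
  defines "V \<equiv> real L * (\<Prod>j\<in>UNIV. real (Suc r) * u $ j)"
  defines "\<delta> \<equiv> sqrt (bound_const P CARD('n) * ln V ^ (CARD('n) - 1)) * (1 / real L) ^ Suc r"
  assumes V: "ln V \<ge> 1" and \<delta>: "real (CARD('n) * Suc r) / real M \<le> \<delta>"
  shows "(\<Sum>n\<in>grid M. \<bar>box_error m (korobov_point m a) (Suc r) w u (z + grid_point M n)\<bar> ^ P) / real M ^ CARD('n)
     \<le> (4 * \<delta>) ^ P"
proof -
  define E where "E n = box_error m (korobov_point m a) (Suc r) w u (z + grid_point M n)" for n
  have M0: "M > 0" and mM: "m dvd M" using m M by simp_all
  define y :: "real ^ 'n" where "y = - z - w"
  define C where "C k = (\<Prod>j\<in>UNIV. dft M (periodic_hat (Suc r) (u $ j)) (y $ j) (k j))" for k :: "'n \<Rightarrow> int"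
  define f where "f k = (if k \<in> dual_residues M m (\<lambda>j. a $ j) then C k else 0)" for k
  define v where "v = (\<Prod>j\<in>UNIV. (u $ j) ^ Suc r)"
  define c where "c = (1 / real L) ^ Suc r"
  define g where "g = weight M m (\<lambda>j. a $ j) (\<lambda>j. real (Suc r) * u $ j) L"
  define Q where "Q = bound_const P CARD('n) * ln V ^ (CARD('n) - 1)"
  have Q: "Q > 0" unfolding Q_def using V P by (intro mult_pos_pos bound_const_pos zero_less_power) auto
  have \<delta>_eq: "\<delta> = sqrt Q * c" by (simp add: \<delta>_def Q_def c_def)
  have \<delta>0: "\<delta> \<ge> 0" using Q by (simp add: \<delta>_eq c_def)
  have E_eq: "of_real (E n) = of_real v - C (\<lambda>_. 0) - trig_sum M (-1) f n" for n
  proof -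
    have "E n = v - 1 / real m * (\<Sum>\<mu>=1..m. \<Prod>j\<in>UNIV. periodic_hat (Suc r) (u $ j)
        (korobov_point m a \<mu> $ j + y $ j - of_int (n j) / real M))"
      unfolding E_def box_error_eq[OF u] v_def by (simp add: y_def grid_point_def algebra_simps)
    thus ?thesis
      using korobov_mean_eq_trig_sum[OF m M(1,2), of "Suc r" u a y n] unfolding C_def f_def by simp
  qed
  \<comment> \<open>Translating the box by \<open>n / M\<close> reflects the frequencies;
    conjugation brings the sum into the form used by \<open>moment\<close>.\<close>
  have trig: "norm (trig_sum M (-1) f n) = norm (trig_sum M 1 (\<lambda>k. cnj (f k)) n)" for n
    using arg_cong[OF cnj_trig_sum[of M "-1" f n], of norm] by simp
  have "norm (C (\<lambda>_. 0) - of_real v) \<le> \<delta>"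
    unfolding C_def v_def using prod_dft_0[OF M0 u, of y] \<delta> by (rule order_trans)
  hence C0: "norm (of_real v - C (\<lambda>_. 0)) \<le> \<delta>" by (simp add: norm_minus_commute)
  have "moment M P (\<lambda>k. cnj (f k)) \<le> moment M P (\<lambda>k. of_real (c * g k))"
  proof (rule moment_majorant[OF M0 P(2)])
    fix k
    show "norm (cnj (f k)) \<le> c * g k"
    proof (cases "k \<in> dual_residues M m (\<lambda>j. a $ j)")
      case True
      thus ?thesis using norm_prod_dft_le_weight[OF gap mM M0 _ u M(3) True, of y] L
        unfolding complex_mod_cnj by (simp add: f_def C_def c_def g_def)
    next
      case False
      thus ?thesis by (simp add: f_def g_def weight_def)
    qed
  qed
  also have "\<dots> = c ^ P * moment M P (\<lambda>k. of_real (g k))"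
    using moment_scale[of M P c "\<lambda>k. of_real (g k)"] by (simp add: c_def)
  also have "\<dots> \<le> c ^ P * sqrt Q ^ P"
  proof (rule mult_left_mono)
    define t where "t = moment M P (\<lambda>k. of_real (g k))"
    have t: "t \<ge> 0" by (simp add: t_def moment_nonneg)
    have n2: "t powr (2 / P) \<le> Q"
      using norm2_weight[OF gap mM M0 _ P, of "\<lambda>j. real (Suc r) * u $ j"] L u(1) V
      by (simp add: norm2_def t_def g_def Q_def bound_const_def V_def)
    have "t = (t powr (2 / P)) powr (P / 2)" using t P by (cases "t = 0") (auto simp: powr_powr)
    also have "\<dots> \<le> Q powr (P / 2)" using n2 by (intro powr_mono2) auto
    also have "\<dots> = (Q powr (1 / 2)) powr P" by (simp add: powr_powr)
    also have "\<dots> = sqrt Q ^ P" using Q by (simp add: powr_half_sqrt powr_realpow)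
    finally show "moment M P (\<lambda>k. of_real (g k)) \<le> sqrt Q ^ P" by (simp add: t_def)
  qed (simp add: c_def)
  finally have mom: "moment M P (\<lambda>k. cnj (f k)) \<le> \<delta> ^ P" by (simp add: \<delta>_eq power_mult_distrib mult.commute)
  have pt: "\<bar>E n\<bar> ^ P \<le> 2 ^ P * (\<delta> ^ P + norm (trig_sum M 1 (\<lambda>k. cnj (f k)) n) ^ P)" for n
  proof -
    define s where "s = norm (trig_sum M 1 (\<lambda>k. cnj (f k)) n)"
    have s: "s \<ge> 0" by (simp add: s_def)
    have "\<bar>E n\<bar> = norm (of_real (E n) :: complex)" by simp
    also have "\<dots> \<le> norm (of_real v - C (\<lambda>_. 0)) + norm (trig_sum M (-1) f n)"
      unfolding E_eq by (rule norm_triangle_ineq4)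
    also have "\<dots> \<le> \<delta> + s" using C0 by (simp add: trig s_def)
    also have "\<dots> \<le> 2 * max \<delta> s" by simp
    finally have "\<bar>E n\<bar> ^ P \<le> (2 * max \<delta> s) ^ P" by (intro power_mono) auto
    also have "\<dots> = 2 ^ P * max \<delta> s ^ P" by (simp add: power_mult_distrib)
    also have "\<dots> \<le> 2 ^ P * (\<delta> ^ P + s ^ P)"
      using \<delta>0 s by (intro mult_left_mono) (auto simp: max_def)
    finally show ?thesis by (simp add: s_def)
  qed
  have "(\<Sum>n\<in>grid M. \<bar>E n\<bar> ^ P) / real M ^ CARD('n) \<le>
      (\<Sum>n\<in>(grid M :: ('n \<Rightarrow> int) set). 2 ^ P * (\<delta> ^ P + norm (trig_sum M 1 (\<lambda>k. cnj (f k)) n) ^ P)) / real M ^ CARD('n)"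
    using pt by (intro divide_right_mono sum_mono) auto
  also have "\<dots> = 2 ^ P * (\<delta> ^ P + moment M P (\<lambda>k. cnj (f k)))"
  proof -
    define S where "S = (\<Sum>n\<in>grid M. norm (trig_sum M 1 (\<lambda>k. cnj (f k)) n) ^ P)"
    have "(\<Sum>n\<in>(grid M :: ('n \<Rightarrow> int) set). 2 ^ P * (\<delta> ^ P + norm (trig_sum M 1 (\<lambda>k. cnj (f k)) n) ^ P))
        = 2 ^ P * (real M ^ CARD('n) * \<delta> ^ P + S)"
      unfolding S_def by (simp add: sum.distrib card_grid flip: sum_distrib_left)
    also have "\<dots> / real M ^ CARD('n) = 2 ^ P * (\<delta> ^ P + S / real M ^ CARD('n))"
      using M0 by (simp add: field_simps)
    finally show ?thesis by (simp only: S_def moment_def)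
  qed
  also have "\<dots> \<le> 2 ^ P * (2 * \<delta> ^ P)" using mom by (intro mult_left_mono) auto
  \<comment> \<open>One factor \<open>2 ^ P\<close> comes from bounding a sum by twice the maximum,
    the other is a generous bound for the two terms; together they give the 4.\<close>
  also have "\<dots> \<le> 2 ^ P * (2 ^ P * \<delta> ^ P)"
    using \<delta>0 P power_increasing[of 1 P "2::real"] by (intro mult_left_mono mult_right_mono) auto
  also have "\<dots> = (4 * \<delta>) ^ P"
  proof -
    have "(2::real) ^ P * 2 ^ P = 4 ^ P" by (simp flip: power_mult_distrib)
    thus ?thesis by (simp add: power_mult_distrib flip: mult.assoc)
  qed
  finally show ?thesis by (simp add: E_def)
qed

text \<open>The grid is chosen for the given box and disappears again: the mean over every translate
  is bounded by a quantity free of \<open>M\<close>, so the integral is too.\<close>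

lemma Lp_norm_box_error_le:
  fixes u w :: "real ^ 'n" and a :: "int ^ 'n"
  assumes gap: "gap m (\<lambda>j. a $ j) L" and m: "m \<ge> 1" and L: "L \<ge> 1" and P: "P \<ge> 2" "even P"
    and u: "\<And>j. u $ j > 0" "\<And>j. real (Suc r) * u $ j \<le> 1" and p: "1 \<le> p" "p \<le> real P"
  defines "V \<equiv> real L * (\<Prod>j\<in>UNIV. real (Suc r) * u $ j)"
  defines "\<delta> \<equiv> sqrt (bound_const P CARD('n) * ln V ^ (CARD('n) - 1)) * (1 / real L) ^ Suc r"
  assumes V: "ln V \<ge> 1"
  shows "Lp_norm_cube p (box_error m (korobov_point m a) (Suc r) w u) \<le> 8 * \<delta>"
proof -
  define E where "E = box_error m (korobov_point m a) (Suc r) w u"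
  define d where "d = 4 * \<delta>"
  have "\<delta> > 0" unfolding \<delta>_def using V P L
    by (intro mult_pos_pos real_sqrt_gt_zero bound_const_pos zero_less_power) auto
  hence d: "d > 0" by (simp add: d_def)
  \<comment> \<open>\<open>M\<close> has to resolve every side, \<open>1 / M \<le> u $ j\<close>,
    and to push the error of the zero coefficient below \<open>\<delta>\<close>; the sum of the
    reciprocals stands in for their maximum. As a multiple of \<open>m\<close> it puts the Korobov
    points on the grid.\<close>
  define h where "h = nat \<lceil>(\<Sum>j\<in>UNIV. 1 / u $ j) + real (CARD('n) * Suc r) / \<delta>\<rceil> + 1"
  define M where "M = m * h"
  have hge: "(\<Sum>j\<in>UNIV. 1 / u $ j) + real (CARD('n) * Suc r) / \<delta> \<le> real M"
  proof -
    have "(\<Sum>j\<in>UNIV. 1 / u $ j) + real (CARD('n) * Suc r) / \<delta> \<le> real h" unfolding h_def by linarith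
    also have "\<dots> \<le> real M"
      unfolding M_def of_nat_le_iff using mult_le_mono1[of 1 m h] m by simp
    finally show ?thesis .
  qed
  have M0: "M > 0" using m by (simp add: M_def h_def)
  have su: "0 \<le> (\<Sum>j\<in>UNIV. 1 / u $ j)" using u(1) by (intro sum_nonneg) (auto simp: less_imp_le)
  have Mu: "1 / real M \<le> u $ j" for j
  proof -
    have "1 / u $ j \<le> (\<Sum>j\<in>UNIV. 1 / u $ j)" using u(1) by (intro member_le_sum) (auto simp: less_imp_le)
    moreover have "0 \<le> real (CARD('n) * Suc r) / \<delta>" using \<open>\<delta> > 0\<close> by simp
    ultimately have "1 / u $ j \<le> real M" using hge by linarith
    thus ?thesis using u(1)[of j] M0 by (simp add: field_simps)
  qed
  have M\<delta>: "real (CARD('n) * Suc r) / real M \<le> \<delta>"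
  proof -
    have "real (CARD('n) * Suc r) / \<delta> \<le> real M" using hge su by linarith
    thus ?thesis using \<open>\<delta> > 0\<close> M0 by (simp add: divide_le_eq mult.commute)
  qed
  have mean: "(\<Sum>n\<in>grid M. \<bar>E (z + grid_point M n)\<bar> ^ P) / real M ^ CARD('n) \<le> d ^ P" for z
    unfolding E_def d_def \<delta>_def V_def
    by (rule box_error_grid_moment[OF gap m L P u M_def _ Mu V[unfolded V_def] M\<delta>[unfolded \<delta>_def V_def]])
       (simp add: h_def)
  have E_meas [measurable]: "E \<in> borel_measurable borel"
    unfolding E_def box_error_eq[OF u, abs_def] by measurable
  have u1: "u $ j \<le> 1" for j
  proof -
    have "1 * u $ j \<le> real (Suc r) * u $ j" using u(1)[of j] by (intro mult_right_mono) auto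
    thus ?thesis using u(2)[of j] by simp
  qed
  have ph: "\<bar>periodic_hat (Suc r) (u $ j) x\<bar> \<le> 1" for j x
    using periodic_hat_bounds[OF u(1) u1, of r j x] by (simp add: abs_le_iff)
  \<comment> \<open>Needed for integrability only.\<close>
  have E_bound: "\<bar>E z\<bar> \<le> 2" for z
  proof -
    have "\<bar>E z\<bar> \<le> \<bar>\<Prod>j\<in>UNIV. (u $ j) ^ Suc r\<bar> + 1 / real m * (\<Sum>\<mu>=1..m. \<bar>\<Prod>j\<in>UNIV. periodic_hat (Suc r) (u $ j)
        (korobov_point m a \<mu> $ j - z $ j - w $ j)\<bar>)"
      unfolding E_def box_error_eq[OF u]
      by (rule order_trans[OF abs_triangle_ineq4])
         (auto simp: abs_mult intro!: divide_right_mono sum_abs)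
    also have "\<dots> \<le> 1 + 1 / real m * (\<Sum>\<mu>=1..m. 1)"
      unfolding abs_prod using u(1) u1 ph
      by (intro add_mono mult_left_mono sum_mono prod_le_1) (auto simp: power_le_one less_imp_le simp del: power_Suc)
    also have "\<dots> = 2" using m by simp
    finally show ?thesis .
  qed
  have "(LINT z:unit_cube|lborel. \<bar>E z\<bar> powr p) \<le> 2 * d powr p"
  proof (rule unit_cube_integral_le[OF M0])
    show "set_integrable lborel unit_cube (\<lambda>z. \<bar>E z\<bar> powr p)"
    proof (rule set_integrable_unit_cube[of _ "2 powr p"])
      show "(\<lambda>z. \<bar>E z\<bar> powr p) \<in> borel_measurable borel" by measurable
      show "norm (\<bar>E z\<bar> powr p) \<le> 2 powr p" for z
        using E_bound[of z] p by (simp add: powr_mono2)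
    qed
    fix z
    \<comment> \<open>A comparison of the exponents \<open>p\<close> and \<open>P\<close> at the
      scale \<open>d\<close>; it takes the place of Jensen's inequality and costs a factor
      2.\<close>
    have pt: "x powr p \<le> d powr p * (1 + x ^ P / d ^ P)" if x: "x \<ge> 0" for x
    proof -
      have "(x / d) powr p \<le> 1 + (x / d) ^ P"
      proof (cases "x / d \<le> 1")
        case True
        hence "(x / d) powr p \<le> 1" using x d p by (intro powr_le1) auto
        thus ?thesis using x d by (simp add: add_increasing2)
      next
        case False
        hence "(x / d) powr p \<le> (x / d) powr (real P)" using p by (intro powr_mono) auto
        thus ?thesis using False x d by (simp add: powr_realpow)
      qed
      hence "d powr p * (x / d) powr p \<le> d powr p * (1 + (x / d) ^ P)" by (rule mult_left_mono) simp
      thus ?thesis using x d by (simp add: powr_divide power_divide)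
    qed
    have "(\<Sum>n\<in>grid M. \<bar>E (z + grid_point M n)\<bar> powr p) / real M ^ CARD('n)
       \<le> (\<Sum>n\<in>grid M. d powr p * (1 + \<bar>E (z + grid_point M n)\<bar> ^ P / d ^ P)) / real M ^ CARD('n)"
      by (intro divide_right_mono sum_mono pt) auto
    also have "\<dots> = d powr p * (1 + (\<Sum>n\<in>grid M. \<bar>E (z + grid_point M n)\<bar> ^ P) / real M ^ CARD('n) / d ^ P)"
    proof -
      define S where "S = (\<Sum>n\<in>grid M. \<bar>E (z + grid_point M n)\<bar> ^ P)"
      have "(\<Sum>n\<in>grid M. d powr p * (1 + \<bar>E (z + grid_point M n)\<bar> ^ P / d ^ P)) = d powr p * (real M ^ CARD('n) + S / d ^ P)"
        unfolding S_def by (simp add: sum.distrib card_grid flip: sum_distrib_left sum_divide_distrib)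
      also have "\<dots> / real M ^ CARD('n) = d powr p * (1 + S / real M ^ CARD('n) / d ^ P)"
        using M0 d by (simp add: field_simps)
      finally show ?thesis by (simp only: S_def)
    qed
    also have "\<dots> \<le> d powr p * (1 + 1)"
    proof (intro mult_left_mono add_left_mono)
      have "(\<Sum>n\<in>grid M. \<bar>E (z + grid_point M n)\<bar> ^ P) / real M ^ CARD('n) / d ^ P \<le> d ^ P / d ^ P"
        using mean[of z] d by (intro divide_right_mono) auto
      thus "(\<Sum>n\<in>grid M. \<bar>E (z + grid_point M n)\<bar> ^ P) / real M ^ CARD('n) / d ^ P \<le> 1"
        using d by simp
    qed simp
    finally show "(\<Sum>n\<in>grid M. \<bar>E (z + grid_point M n)\<bar> powr p) / real M ^ CARD('n) \<le> 2 * d powr p" by simp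
  qed
  moreover have "0 \<le> (LINT z:unit_cube|lborel. \<bar>E z\<bar> powr p)"
    unfolding set_lebesgue_integral_def by (intro Bochner_Integration.integral_nonneg) auto
  ultimately have "Lp_norm_cube p E \<le> (2 * d powr p) powr (1 / p)"
    unfolding Lp_norm_cube_def using p by (intro powr_mono2) auto
  also have "\<dots> = 2 powr (1 / p) * d" using p d by (simp add: powr_mult powr_powr)
  \<comment> \<open>The factor 2, uniform in \<open>p\<close>, and \<open>d = 4 * \<delta>\<close>
    make up the constant 8.\<close>
  also have "\<dots> \<le> 2 powr 1 * d" using p d by (intro mult_right_mono powr_mono) auto
  finally show ?thesis by (simp add: E_def d_def)
qed

lemma box_of_subset_unit_cube:
  fixes u w :: "real ^ 'n"
  assumes u: "\<And>j. u $ j > 0" and r: "r \<ge> 1" and sub: "box_of r w u \<subseteq> unit_cube"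
  shows "real r * u $ j \<le> 1" "measure lborel (box_of r w u) = (\<Prod>j\<in>UNIV. real r * u $ j)"
proof -
  have ru: "real r * u $ j > 0" for j using u r by simp
  define x where "x = (\<chi> j. w $ j - real r * u $ j / 2)"
  have "x \<in> box_of r w u" using ru by (auto simp: box_of_def x_def field_simps)
  hence x: "0 \<le> x $ j" for j using sub by (auto simp: unit_cube_def)
  show "real r * u $ j \<le> 1"
  proof (rule ccontr)
    assume gt: "\<not> real r * u $ j \<le> 1"
    \<comment> \<open>One unit to the right of the lower corner, which belongs to the half-open box:
      a side longer than 1 would contain this point, and the unit cube does not.\<close>
    define x' where "x' = (\<chi> i. if i = j then x $ j + 1 else x $ i)"
    have "x' \<in> box_of r w u" using ru gt by (auto simp: box_of_def x'_def x_def field_simps)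
    hence "x' $ j < 1" using sub by (auto simp: unit_cube_def)
    thus False using x[of j] by (simp add: x'_def)
  qed
  have "emeasure lborel (box_of r w u) = ennreal (\<Prod>j\<in>UNIV. real r * u $ j)"
    using measure_half_open_box[of "\<chi> j. w $ j - real r * u $ j / 2" "\<chi> j. w $ j + real r * u $ j / 2"] ru
    by (simp add: box_of_def less_imp_le)
  thus "measure lborel (box_of r w u) = (\<Prod>j\<in>UNIV. real r * u $ j)"
    using ru by (simp add: measure_def prod_nonneg less_imp_le)
qed

theorem theorem1p4:
  shows "\<exists>c>0. \<forall>p\<ge>1. \<exists>C>0.
    \<forall>(r::nat) (m::nat) (a :: int ^ 'n) (L::nat) (v::real).
      r \<ge> 1 \<longrightarrow> m \<ge> 1 \<longrightarrow> L \<ge> 2 \<longrightarrow> korobov_exact m a L \<longrightarrow>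
      0 < v \<longrightarrow> v \<le> 1 \<longrightarrow> v \<ge> c / real L \<longrightarrow>
      periodic_discrepancy r p m (korobov_point m a) v
        \<le> ereal (C * (1 / real L) ^ r * ln (real L * v) powr ((real CARD('n) - 1) / 2))"
proof (rule exI[of _ "exp 1"], intro conjI allI impI)
  fix p :: real assume p: "1 \<le> p"
  \<comment> \<open>An even exponent that is at least \<open>p\<close>, and at least 2 because
    \<open>p \<ge> 1\<close>. It depends on \<open>p\<close> alone, so the constant depends on
    \<open>p\<close> and the dimension only.\<close>
  define P where "P = 2 * nat \<lceil>p\<rceil>"
  have "p \<le> real (nat \<lceil>p\<rceil>)" by linarith
  moreover have "real P = 2 * real (nat \<lceil>p\<rceil>)" by (simp only: P_def of_nat_mult of_nat_numeral)
  ultimately have "real 1 \<le> real (nat \<lceil>p\<rceil>)" "p \<le> real P" using p by linarith+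
  hence "1 \<le> nat \<lceil>p\<rceil>" "p \<le> real P" by (simp_all only: of_nat_le_iff)
  hence P: "P \<ge> 2" "even P" "p \<le> real P" by (simp_all add: P_def)
  define K where "K = bound_const P CARD('n)"
  have K: "K > 0" unfolding K_def using P by (intro bound_const_pos) simp
  show "\<exists>C>0. \<forall>(r::nat) (m::nat) (a :: int ^ 'n) (L::nat) (v::real).
      r \<ge> 1 \<longrightarrow> m \<ge> 1 \<longrightarrow> L \<ge> 2 \<longrightarrow> korobov_exact m a L \<longrightarrow>
      0 < v \<longrightarrow> v \<le> 1 \<longrightarrow> v \<ge> exp 1 / real L \<longrightarrow>
      periodic_discrepancy r p m (korobov_point m a) v
        \<le> ereal (C * (1 / real L) ^ r * ln (real L * v) powr ((real CARD('n) - 1) / 2))"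
  proof (intro exI[of _ "8 * sqrt K"] conjI allI impI)
    fix r m :: nat and a :: "int ^ 'n" and L :: nat and v :: real
    assume r: "r \<ge> 1" and m: "m \<ge> 1" and L: "L \<ge> 2" and exact: "korobov_exact m a L"
      and v: "0 < v" "v \<le> 1" "v \<ge> exp 1 / real L"
    define V where "V = real L * v"
    \<comment> \<open>The choice \<open>c = exp 1\<close> is made for this:
      \<open>ln V \<ge> 1\<close> keeps the exponent \<open>a / ln V\<close> of the sum over the
      blocks at most \<open>a\<close>, and makes the bound positive.\<close>
    have "exp 1 \<le> V" using v L by (simp add: V_def divide_le_eq mult.commute)
    hence lnV: "ln V \<ge> 1" by (subst ln_ge_iff) (auto intro: less_le_trans[OF exp_gt_zero])
    obtain r' where r': "r = Suc r'" using r by (cases r) auto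
    show "periodic_discrepancy r p m (korobov_point m a) v
        \<le> ereal (8 * sqrt K * (1 / real L) ^ r * ln (real L * v) powr ((real CARD('n) - 1) / 2))"
      unfolding periodic_discrepancy_def
    proof (rule SUP_least, goal_cases)
      case (1 wu)
      obtain w u where wu: "wu = (w, u)" by (cases wu)
      have u: "\<forall>j. 0 < u $ j" and sub: "box_of r w u \<subseteq> unit_cube"
        and vol: "v = measure lborel (box_of r w u)"
        using 1 by (auto simp: wu)
      note box = box_of_subset_unit_cube[OF _ r sub]
      have vol': "V = real L * (\<Prod>j\<in>UNIV. real (Suc r') * u $ j)"
        unfolding V_def vol using box(2) u r' by simp
      have "Lp_norm_cube p (box_error m (korobov_point m a) (Suc r') w u) \<le>
         8 * (sqrt (K * ln V ^ (CARD('n) - 1)) * (1 / real L) ^ Suc r')"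
        unfolding vol' K_def
        by (rule Lp_norm_box_error_le[OF gap_of_korobov_exact[OF exact m] m _ P(1,2) _ _ p P(3)])
           (use L u box(1) r' lnV vol' in auto)
      also have "sqrt (K * ln V ^ (CARD('n) - 1)) = sqrt K * ln V powr ((real CARD('n) - 1) / 2)"
      proof -
        have "ln V ^ (CARD('n) - 1) = ln V powr (real CARD('n) - 1)"
          using lnV by (simp add: powr_realpow[symmetric] of_nat_diff)
        hence "sqrt (ln V ^ (CARD('n) - 1)) = (ln V powr (real CARD('n) - 1)) powr (1 / 2)"
          by (simp add: powr_half_sqrt)
        thus ?thesis by (simp add: real_sqrt_mult powr_powr)
      qed
      finally have "Lp_norm_cube p (box_error m (korobov_point m a) r w u) \<le>
         8 * sqrt K * (1 / real L) ^ r * ln (real L * v) powr ((real CARD('n) - 1) / 2)"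
        by (simp add: r' V_def mult_ac)
      thus ?case by (simp only: wu case_prod_conv ereal_less_eq)
    qed
  qed (use K in simp)
qed simp

end
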